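(* For every integer $n\ge3$ there are uncountably many positive numbers $h$ for each of which there exists an embedded Delaunay hypersurface of constant mean curvature $h$ in $\mathbb S^n$ of unduloid type, i.e. a closed embedded hypersurface generated by the complete curve $\gamma_{h,C}$ for some $C\in(0,C_h)$.
   Context: $\mathbb S^n$ is the unit sphere of $\mathbb C\oplus\mathbb R^{n-1}$, $\mathbb S^2$ the unit sphere of $\mathbb C\oplus\mathbb R$, $S^{n-2}$ the unit sphere of $\mathbb R^{n-1}$. A curve $\gamma=(z,b)$ in $\mathbb S^2$ with $b>0$ generates the hypersurface $G_\gamma(t,x)=(z(t),b(t)x)$, $x\in S^{n-2}$, in $\mathbb S^n$. Mean curvature is unnormalized (trace of the second fundamental form) with respect to the normal pointing toward the great circle $\{b=0\}$, sign such that thin tubes around this great circle have positive mean curvature. For $h>0$ put $L(s)=\cos s\,\sin^{n-2}s$, $R(s,C,h)=C+\frac{h}{n-1}\sin^{n-1}s$; let $s_h\in(0,\frac{\pi}{2})$ be the unique solution of $-\tan s_h+(n-2)\cot s_h=h$ and $C_h:=L(s_h)-\frac{h}{n-1}\sin^{n-1}s_h>0$. For $C\in(0,C_h)$ the set $\{s\in(0,\frac{\pi}{2}):R(s,C,h)<L(s)\}$ is an interval $(z_L,z_R)$ with $0<z_L<z_R<\frac{\pi}{2}$. Let $s_1(s)=\int_{z_L}^{s}\frac{R}{\cos\sigma\sqrt{L^2-R^2}}\,d\sigma$, $T=s_1(z_R)<\infty$, let $s=\rho(t)$, $t\in[0,T]$, be the inverse function of $s_1$, and extend $\rho$ to $\mathbb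 R$ as an even $2T$-periodic function. Then $\gamma_{h,C}(t)=(\cos\rho(t)\,e^{it},\sin\rho(t))$, $t\in\mathbb R$. *)

theory Defs
  imports "HOL-Analysis.Analysis"
begin

section \<open>Smooth submanifolds of Euclidean space\<close>

text \<open>These notions are meant for open \<^term>\<open>S\<close>, where all derivatives below are taken.\<close>

primrec times_differentiable_on ::
    "nat \<Rightarrow> 'a::real_normed_vector set \<Rightarrow> ('a \<Rightarrow> 'b::real_normed_vector) \<Rightarrow> bool" where
  "times_differentiable_on 0 S f \<longleftrightarrow> continuous_on S f"
| "times_differentiable_on (Suc k) S f \<longleftrightarrow>
     (\<forall>x\<in>S. f differentiable (at x)) \<and>
     (\<forall>v. times_differentiable_on k S (\<lambda>x. frechet_derivative f (at x) v))"

definition smooth_on :: "'a::real_normed_vector set \<Rightarrow> ('a \<Rightarrow> 'b::real_normed_vector) \<Rightarrow> bool" where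
  "smooth_on S f \<longleftrightarrow> (\<forall>k. times_differentiable_on k S f)"

text \<open>Slice charts: near each of its points, \<open>M\<close> is mapped onto an open piece of a
  \<open>k\<close>-dimensional linear subspace by a diffeomorphism between open sets of the ambient space.\<close>

definition embedded_submanifold :: "nat \<Rightarrow> 'a::euclidean_space set \<Rightarrow> bool" where
  "embedded_submanifold k M \<longleftrightarrow>
     (\<forall>p\<in>M. \<exists>(U :: 'a set) (V :: 'a set) \<phi> \<psi> W. open U \<and> p \<in> U \<and> open V \<and>
        homeomorphism U V \<phi> \<psi> \<and> smooth_on U \<phi> \<and> smooth_on V \<psi> \<and>
        subspace W \<and> dim W = k \<and> \<phi> ` (M \<inter> U) = W \<inter> V)"

text \<open>The unit sphere of \<^typ>\<open>'a\<close> has dimension \<open>DIM('a) - 1\<close>, so its hypersurfaces have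
  dimension \<open>DIM('a) - 2\<close>. A closed manifold is a compact one without boundary.\<close>

definition closed_embedded_hypersurface_in_sphere :: "'a::euclidean_space set \<Rightarrow> bool" where
  "closed_embedded_hypersurface_in_sphere M \<longleftrightarrow>
     M \<noteq> {} \<and> M \<subseteq> sphere 0 1 \<and> compact M \<and> embedded_submanifold (DIM('a) - 2) M"

definition tangent_vectors :: "'a::real_normed_vector set \<Rightarrow> 'a \<Rightarrow> 'a set" where
  "tangent_vectors M p =
     {v. \<exists>c \<epsilon>. 0 < \<epsilon> \<and> smooth_on {-\<epsilon><..<\<epsilon>} c \<and> c ` {-\<epsilon><..<\<epsilon>} \<subseteq> M \<and>
            c 0 = p \<and> (c has_vector_derivative v) (at 0)}"

section \<open>Mean curvature of hypersurfaces of the unit sphere\<close>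

definition unit_normal_field :: "'a::euclidean_space set \<Rightarrow> ('a \<Rightarrow> 'a) \<Rightarrow> bool" where
  "unit_normal_field M \<nu> \<longleftrightarrow>
     (\<forall>p\<in>M. norm (\<nu> p) = 1 \<and> \<nu> p \<bullet> p = 0 \<and> (\<forall>v\<in>tangent_vectors M p. \<nu> p \<bullet> v = 0))"

text \<open>Unnormalized mean curvature: the trace of the second fundamental form
  \<open>(v, w) \<mapsto> - (D\<^sub>v \<nu> \<bullet> w)\<close>, computed in an orthonormal basis \<open>B\<close> of the tangent space.
  The derivative \<open>D\<close> of \<open>\<nu>\<close> within \<open>M\<close> is determined only on tangent vectors, and only those
  are used. For \<open>w\<close> tangent to \<open>M\<close>, differentiating in the ambient Euclidean space or
  covariantly in the sphere gives the same value.\<close>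

definition has_mean_curvature ::
    "'a::euclidean_space set \<Rightarrow> ('a \<Rightarrow> 'a) \<Rightarrow> 'a \<Rightarrow> real \<Rightarrow> bool" where
  "has_mean_curvature M \<nu> p H \<longleftrightarrow>
     (\<exists>D B. (\<nu> has_derivative D) (at p within M) \<and>
        pairwise orthogonal B \<and> (\<forall>e\<in>B. norm e = 1) \<and> span B = tangent_vectors M p \<and>
        H = - (\<Sum>e\<in>B. D e \<bullet> e))"

text \<open>In \<open>\<complex> \<oplus> \<real>\<^sup>m\<close>, the distance in the unit sphere from \<open>(z, y)\<close> to the great circle
  \<open>y = 0\<close> is \<open>arcsin \<bar>y\<bar>\<close>; its derivative in the direction of a tangent vector \<open>(w, u)\<close> has the
  sign of \<open>u \<bullet> y\<close> when \<open>0 < \<bar>y\<bar> < 1\<close>. So \<open>u \<bullet> y < 0\<close> says that \<open>(w, u)\<close> points toward the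
  great circle. For the tube \<open>\<bar>y\<bar> = sin r\<close> this normal is \<open>(tan r z, - cot r y)\<close>, and the mean
  curvature is \<open>- tan r + (m - 1) cot r\<close>, positive for small \<open>r\<close>.\<close>

definition points_toward_great_circle ::
    "(complex \<times> (real ^ 'm)) set \<Rightarrow> (complex \<times> (real ^ 'm) \<Rightarrow> complex \<times> (real ^ 'm)) \<Rightarrow> bool" where
  "points_toward_great_circle M \<nu> \<longleftrightarrow> (\<forall>p\<in>M. snd (\<nu> p) \<bullet> snd p < 0)"

definition has_constant_mean_curvature :: "(complex \<times> (real ^ 'm)) set \<Rightarrow> real \<Rightarrow> bool" where
  "has_constant_mean_curvature M h \<longleftrightarrow>
     (\<exists>\<nu>. unit_normal_field M \<nu> \<and> points_toward_great_circle M \<nu> \<and>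
        (\<forall>p\<in>M. has_mean_curvature M \<nu> p h))"

section \<open>Hypersurfaces generated by the curves \<open>\<gamma>\<^sub>h\<^sub>,\<^sub>C\<close>\<close>

text \<open>With \<open>\<real>\<^sup>n\<^sup>-\<^sup>1\<close> represented by \<^typ>\<open>real ^ 'm\<close>, we have \<open>n = CARD('m) + 1\<close>.\<close>

definition rotation_map :: "(real \<Rightarrow> complex \<times> real) \<Rightarrow> real \<Rightarrow> real ^ 'm \<Rightarrow> complex \<times> (real ^ 'm)" where
  "rotation_map \<gamma> t x = (fst (\<gamma> t), snd (\<gamma> t) *\<^sub>R x)"

definition generated_hypersurface :: "(real \<Rightarrow> complex \<times> real) \<Rightarrow> (complex \<times> (real ^ 'm)) set" where
  "generated_hypersurface \<gamma> = {rotation_map \<gamma> t x | t x. x \<in> sphere 0 1}"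

definition L_fun :: "nat \<Rightarrow> real \<Rightarrow> real" where
  "L_fun n s = cos s * sin s ^ (n - 2)"

definition R_fun :: "nat \<Rightarrow> real \<Rightarrow> real \<Rightarrow> real \<Rightarrow> real" where
  "R_fun n s C h = C + h / (real n - 1) * sin s ^ (n - 1)"

definition s_crit :: "nat \<Rightarrow> real \<Rightarrow> real" where
  "s_crit n h = (THE s. 0 < s \<and> s < pi / 2 \<and> - tan s + (real n - 2) * cot s = h)"

definition C_crit :: "nat \<Rightarrow> real \<Rightarrow> real" where
  "C_crit n h = L_fun n (s_crit n h) - h / (real n - 1) * sin (s_crit n h) ^ (n - 1)"

definition admissible :: "nat \<Rightarrow> real \<Rightarrow> real \<Rightarrow> real set" where
  "admissible n h C = {s. 0 < s \<and> s < pi / 2 \<and> R_fun n s C h < L_fun n s}"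

definition z_L :: "nat \<Rightarrow> real \<Rightarrow> real \<Rightarrow> real" where
  "z_L n h C = Inf (admissible n h C)"

definition z_R :: "nat \<Rightarrow> real \<Rightarrow> real \<Rightarrow> real" where
  "z_R n h C = Sup (admissible n h C)"

text \<open>The integrand is nonnegative and singular at \<open>z\<^sub>L\<close> and \<open>z\<^sub>R\<close>, so the gauge integral agrees with the
  improper one; the values given by division by zero at the end points are irrelevant.\<close>

definition s_one :: "nat \<Rightarrow> real \<Rightarrow> real \<Rightarrow> real \<Rightarrow> real" where
  "s_one n h C s =
     integral {z_L n h C..s}
       (\<lambda>\<sigma>. R_fun n \<sigma> C h / (cos \<sigma> * sqrt ((L_fun n \<sigma>)\<^sup>2 - (R_fun n \<sigma> C h)\<^sup>2)))"

definition half_period :: "nat \<Rightarrow> real \<Rightarrow> real \<Rightarrow> real" where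
  "half_period n h C = s_one n h C (z_R n h C)"

text \<open>The even \<open>2T\<close>-periodic extension of the inverse function of \<^const>\<open>s_one\<close>: if \<open>2Tk\<close> is
  the multiple of \<open>2T\<close> closest to \<open>t\<close>, then \<open>\<bar>t - 2Tk\<bar> \<in> [0, T]\<close>. Ties (\<open>t\<close> an odd multiple
  of \<open>T\<close>) do not matter.\<close>

definition profile :: "nat \<Rightarrow> real \<Rightarrow> real \<Rightarrow> real \<Rightarrow> real" where
  "profile n h C t =
     (let T = half_period n h C in
      inv_into {z_L n h C..z_R n h C} (s_one n h C)
        \<bar>t - 2 * T * of_int (round (t / (2 * T)))\<bar>)"

definition unduloid_curve :: "nat \<Rightarrow> real \<Rightarrow> real \<Rightarrow> real \<Rightarrow> complex \<times> real" where
  "unduloid_curve n h C t =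
     (of_real (cos (profile n h C t)) * cis t, sin (profile n h C t))"

end

theory Submission
  imports Defs
begin

text \<open>
  If the half period of \<open>\<rho>\<close> is \<open>\<pi>/2\<close>, then \<open>\<rho>\<close> is \<open>2\<pi>\<close>-periodic, the curve \<open>\<gamma>\<^sub>h\<^sub>,\<^sub>C\<close> is a closed graph
  over the great circle, and the hypersurface is compact and embedded. For every \<open>h \<in> (0, 1)\<close>
  some \<open>C \<in> (0, C\<^sub>h)\<close> has this half period, by the intermediate value theorem. Indeed, put
  \<open>p = n - 2\<close>, \<open>k = h / (p + 1)\<close>, \<open>c = C\<^bsup>1 / (p + 1)\<^esup>\<close>, \<open>sin s = c \<mu>\<close>, \<open>v = k + \<mu>\<^bsup>- (p + 1)\<^esup>\<close> and
  \<open>g = \<mu>\<^sup>2 (1 + v\<^sup>2)\<close>. Then \<open>(L\<^sup>2 - R\<^sup>2) / sin\<^bsup>2 p\<^esup> s = 1 - c\<^sup>2 g\<close>, and adding to the integrand of \<open>s\<^sub>1\<close> the derivative of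
  \<open>arctan (sqrt (1 - c\<^sup>2 g) / v)\<close>, which vanishes at both turning points, gives
  \<open>T = \<integral> - d(arctan v) / sqrt (1 - c\<^sup>2 g)\<close>, where only \<open>c\<close> depends on \<open>C\<close>. As \<open>C \<rightarrow> C\<^sub>h\<close> this tends to
  \<open>\<pi> / sqrt (1 + p v\<^sub>*\<^sup>2) > \<pi>/2\<close>, where \<open>v\<^sub>*\<close> is the positive root of \<open>p v\<^sup>2 - h v = 1\<close>; as \<open>C \<rightarrow> 0\<close> it tends
  to \<open>\<pi>/2 - arctan k < \<pi>/2\<close>.
\<close>

section \<open>Smooth maps\<close>

text \<open>The integrand of the half period is singular at both turning points, and these move with
  \<open>C\<close>, so neither continuity in \<open>C\<close> nor the two limits are visible from
  the definition. In the form with \<open>arctan v\<close> only the square root depends on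
  \<open>C\<close>. A Morse coordinate \<open>\<sigma>\<close> for the well, with
  \<open>g = g0 + \<sigma>^2\<close>, removes the remaining singularity: if the turning points are
  \<open>\<sigma> = -a\<close> and \<open>\<sigma> = a\<close>, the substitution
  \<open>\<sigma> = a sin \<phi>\<close> leaves a continuous integrand on a fixed interval. The
  amplitude \<open>a > 0\<close> therefore replaces \<open>C\<close>; \<open>a = 0\<close>
  corresponds to \<open>C_h\<close>, and \<open>a\<close> tending to infinity to \<open>C\<close>
  tending to 0. The bound \<open>h < 1\<close> comes from the limit at \<open>C_h\<close>: since
  \<open>1 + p v_*^2 = 2 + h v_*\<close>, that limit exceeds \<open>pi / 2\<close> exactly when
  \<open>h v_* < 2\<close>, and \<open>h < 1\<close> guarantees this in every dimension. A second
  obstacle is smoothness of the inverse of \<open>s_1\<close> across the turning points, where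
  \<open>s_1\<close> has infinite slope. The parameter \<open>\<phi>\<close> continues all
  quantities to the real line, where the profile satisfies an autonomous second-order equation with
  smooth right-hand side.\<close>

lemma times_differentiable_on_cong:
  assumes "open S" and "\<And>x. x \<in> S \<Longrightarrow> f x = g x" and "times_differentiable_on k S f"
  shows "times_differentiable_on k S g"
  using assms(2,3)
proof (induction k arbitrary: f g)
  case 0
  then show ?case by (simp cong: continuous_on_cong)
next
  case (Suc k)
  have f: "f differentiable (at x)" if "x \<in> S" for x
    using Suc.prems(2) that by simp
  have g: "g differentiable (at x)" if x: "x \<in> S" for x
  proof -
    obtain D where "(f has_derivative D) (at x)"
      using f[OF x] by (auto simp: differentiable_def)
    then have "(g has_derivative D) (at x)"
      by (rule has_derivative_transform_within_open[OF _ assms(1) x Suc.prems(1)])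
    then show ?thesis by (auto simp: differentiable_def)
  qed
  have fr: "frechet_derivative f (at x) = frechet_derivative g (at x)" if x: "x \<in> S" for x
    by (rule frechet_derivative_transform_within_open[OF f[OF x] assms(1) x Suc.prems(1)])
  have "times_differentiable_on k S (\<lambda>x. frechet_derivative g (at x) v)" for v
    by (rule Suc.IH[of "\<lambda>x. frechet_derivative f (at x) v"]) (use Suc.prems fr in auto)
  then show ?case using g by simp
qed

text \<open>Lets explicit derivatives replace \<open>frechet_derivative\<close>: each closure
  property below becomes an induction on the order whose step is the usual derivative
  formula.\<close>

lemma times_differentiable_on_SucI:
  assumes "open S" and der: "\<And>x. x \<in> S \<Longrightarrow> (f has_derivative f' x) (at x)"
    and "\<And>v. times_differentiable_on k S (\<lambda>x. f' x v)"
  shows "times_differentiable_on (Suc k) S f"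
proof -
  have "frechet_derivative f (at x) = f' x" if "x \<in> S" for x
    using der[OF that] frechet_derivative_at by metis
  then have "times_differentiable_on k S (\<lambda>x. frechet_derivative f (at x) v)" for v
    by (intro times_differentiable_on_cong[OF assms(1) _ assms(3)[of v]]) auto
  then show ?thesis using der by (auto simp: differentiable_def)
qed

lemma times_differentiable_on_SucE:
  assumes "times_differentiable_on (Suc k) S f"
  obtains f' where "\<And>x. x \<in> S \<Longrightarrow> (f has_derivative f' x) (at x)"
    and "\<And>v. times_differentiable_on k S (\<lambda>x. f' x v)"
  using assms that[of "\<lambda>x. frechet_derivative f (at x)"]
  by (auto simp: frechet_derivative_works[symmetric])

lemma times_differentiable_on_SucD:
  "times_differentiable_on (Suc k) S f \<Longrightarrow> times_differentiable_on k S f"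
proof (induction k arbitrary: f)
  case 0
  then show ?case
    by (auto intro!: continuous_at_imp_continuous_on differentiable_imp_continuous_within)
qed simp

lemma times_differentiable_on_subset:
  "times_differentiable_on k S f \<Longrightarrow> T \<subseteq> S \<Longrightarrow> times_differentiable_on k T f"
  by (induction k arbitrary: f) (auto intro: continuous_on_subset)

lemma times_differentiable_on_const: "times_differentiable_on k S (\<lambda>x. c)"
  by (induction k arbitrary: c) auto

lemma times_differentiable_on_linear:
  assumes "open S" and "bounded_linear T" "times_differentiable_on k S f"
  shows "times_differentiable_on k S (\<lambda>x. T (f x))"
  using assms(3)
proof (induction k arbitrary: f)
  case 0
  then show ?case using assms(2) by (auto intro: bounded_linear.continuous_on)
next
  case (Suc k)
  obtain f' where f': "\<And>x. x \<in> S \<Longrightarrow> (f has_derivative f' x) (at x)"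
    "\<And>v. times_differentiable_on k S (\<lambda>x. f' x v)"
    using Suc.prems by (rule times_differentiable_on_SucE) blast
  show ?case
    by (rule times_differentiable_on_SucI[OF assms(1), where f' = "\<lambda>x v. T (f' x v)"])
      (auto intro: bounded_linear.has_derivative[OF assms(2)] f' Suc.IH)
qed

lemma times_differentiable_on_id:
  assumes "open S" shows "times_differentiable_on k S (\<lambda>x. x)"
  by (cases k) (use times_differentiable_on_SucI[OF assms, where f' = "\<lambda>x v. v"]
      in \<open>auto simp: times_differentiable_on_const\<close>)

lemma times_differentiable_on_add:
  assumes "open S" "times_differentiable_on k S f" "times_differentiable_on k S g"
  shows "times_differentiable_on k S (\<lambda>x. f x + g x)"
  using assms(2,3)
proof (induction k arbitrary: f g)
  case 0
  then show ?case by (auto intro: continuous_intros)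
next
  case (Suc k)
  obtain f' where f': "\<And>x. x \<in> S \<Longrightarrow> (f has_derivative f' x) (at x)"
    "\<And>v. times_differentiable_on k S (\<lambda>x. f' x v)"
    using Suc.prems(1) by (rule times_differentiable_on_SucE) blast
  obtain g' where g': "\<And>x. x \<in> S \<Longrightarrow> (g has_derivative g' x) (at x)"
    "\<And>v. times_differentiable_on k S (\<lambda>x. g' x v)"
    using Suc.prems(2) by (rule times_differentiable_on_SucE) blast
  show ?case
    by (rule times_differentiable_on_SucI[OF assms(1), where f' = "\<lambda>x v. f' x v + g' x v"])
      (use f' g' Suc.IH in \<open>auto intro: has_derivative_add\<close>)
qed

lemma times_differentiable_on_bilinear:
  assumes "open S" "bounded_bilinear b"
    and "times_differentiable_on k S f" "times_differentiable_on k S g"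
  shows "times_differentiable_on k S (\<lambda>x. b (f x) (g x))"
  using assms(3,4)
proof (induction k arbitrary: f g)
  case 0
  then show ?case using assms(2) by (auto intro: bounded_bilinear.continuous_on)
next
  case (Suc k)
  obtain f' where f': "\<And>x. x \<in> S \<Longrightarrow> (f has_derivative f' x) (at x)"
    "\<And>v. times_differentiable_on k S (\<lambda>x. f' x v)"
    using Suc.prems(1) by (rule times_differentiable_on_SucE) blast
  obtain g' where g': "\<And>x. x \<in> S \<Longrightarrow> (g has_derivative g' x) (at x)"
    "\<And>v. times_differentiable_on k S (\<lambda>x. g' x v)"
    using Suc.prems(2) by (rule times_differentiable_on_SucE) blast
  show ?case
    by (rule times_differentiable_on_SucI[OF assms(1),
          where f' = "\<lambda>x v. b (f x) (g' x v) + b (f' x v) (g x)"])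
      (intro f' g' Suc.IH Suc.prems[THEN times_differentiable_on_SucD]
        times_differentiable_on_add[OF assms(1)] bounded_bilinear.FDERIV[OF assms(2)]; assumption)+
qed

lemma times_differentiable_on_sum:
  assumes "open S" "\<And>i. i \<in> I \<Longrightarrow> times_differentiable_on k S (f i)"
  shows "times_differentiable_on k S (\<lambda>x. \<Sum>i\<in>I. f i x)"
  using assms(2)
  by (induction I rule: infinite_finite_induct)
    (auto simp: times_differentiable_on_const intro: times_differentiable_on_add[OF assms(1)])

text \<open>The derivative of the composite in direction \<open>v\<close> is
  \<open>f' (g x) (g' x v)\<close>, whose direction varies with \<open>x\<close>, while the
  induction hypothesis concerns fixed directions. Expanding \<open>g' x v\<close> in
  \<open>Basis\<close> turns it into a finite sum of products; this is why the intermediate space is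
  Euclidean.\<close>

lemma times_differentiable_on_compose:
  fixes f :: "'b::euclidean_space \<Rightarrow> 'c::real_normed_vector"
  assumes "open S" "open T" "\<And>x. x \<in> S \<Longrightarrow> g x \<in> T"
    and "times_differentiable_on k T f" "times_differentiable_on k S g"
  shows "times_differentiable_on k S (\<lambda>x. f (g x))"
  using assms(4,5)
proof (induction k arbitrary: f)
  case 0
  then show ?case using assms(3) by (auto intro!: continuous_on_compose2[of T f S g])
next
  case (Suc k)
  obtain f' where f': "\<And>x. x \<in> T \<Longrightarrow> (f has_derivative f' x) (at x)"
    "\<And>v. times_differentiable_on k T (\<lambda>x. f' x v)"
    using Suc.prems(1) by (rule times_differentiable_on_SucE) blast
  obtain g' where g': "\<And>x. x \<in> S \<Longrightarrow> (g has_derivative g' x) (at x)"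
    "\<And>v. times_differentiable_on k S (\<lambda>x. g' x v)"
    using Suc.prems(2) by (rule times_differentiable_on_SucE) blast
  have eq: "f' (g x) w = (\<Sum>i\<in>Basis. (w \<bullet> i) *\<^sub>R f' (g x) i)" if "x \<in> S" for x w
  proof -
    have "linear (f' (g x))"
      using f'(1)[OF assms(3)[OF that]] has_derivative_linear by blast
    then show ?thesis
      using arg_cong[OF euclidean_representation[of w], of "f' (g x)"]
      by (simp add: linear_sum linear_cmul)
  qed
  show ?case
  proof (rule times_differentiable_on_SucI[OF assms(1),
          where f' = "\<lambda>x v. \<Sum>i\<in>Basis. (g' x v \<bullet> i) *\<^sub>R f' (g x) i"])
    show "((\<lambda>x. f (g x)) has_derivative (\<lambda>v. \<Sum>i\<in>Basis. (g' x v \<bullet> i) *\<^sub>R f' (g x) i)) (at x)"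
      if "x \<in> S" for x
      using has_derivative_compose[OF g'(1)[OF that] f'(1)[OF assms(3)[OF that]]]
      by (simp only: eq[OF that, symmetric])
    have "times_differentiable_on k S (\<lambda>x. f' (g x) i)" for i
      using Suc.IH[OF f'(2)] Suc.prems times_differentiable_on_SucD by blast
    moreover have "times_differentiable_on k S (\<lambda>x. g' x v \<bullet> i)" for v i
      by (rule times_differentiable_on_linear[OF assms(1) bounded_linear_inner_left g'(2)])
    ultimately show "times_differentiable_on k S (\<lambda>x. \<Sum>i\<in>Basis. (g' x v \<bullet> i) *\<^sub>R f' (g x) i)" for v
      by (intro times_differentiable_on_sum[OF assms(1)]
          times_differentiable_on_bilinear[OF assms(1) bounded_bilinear_scaleR])
  qed
qed

lemma smooth_on_const: "smooth_on S (\<lambda>x. c)"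
  by (simp add: smooth_on_def times_differentiable_on_const)

lemma smooth_on_id: "open S \<Longrightarrow> smooth_on S (\<lambda>x. x)"
  by (simp add: smooth_on_def times_differentiable_on_id)

lemma smooth_on_cong:
  "open S \<Longrightarrow> smooth_on S f \<Longrightarrow> (\<And>x. x \<in> S \<Longrightarrow> f x = g x) \<Longrightarrow> smooth_on S g"
  unfolding smooth_on_def using times_differentiable_on_cong by blast

lemma smooth_on_subset: "smooth_on S f \<Longrightarrow> T \<subseteq> S \<Longrightarrow> smooth_on T f"
  unfolding smooth_on_def using times_differentiable_on_subset by blast

lemma smooth_on_linear:
  "open S \<Longrightarrow> bounded_linear T \<Longrightarrow> smooth_on S f \<Longrightarrow> smooth_on S (\<lambda>x. T (f x))"
  unfolding smooth_on_def using times_differentiable_on_linear by blast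

lemma smooth_on_add:
  "open S \<Longrightarrow> smooth_on S f \<Longrightarrow> smooth_on S g \<Longrightarrow> smooth_on S (\<lambda>x. f x + g x)"
  unfolding smooth_on_def using times_differentiable_on_add by blast

lemma smooth_on_bilinear:
  "open S \<Longrightarrow> bounded_bilinear b \<Longrightarrow> smooth_on S f \<Longrightarrow> smooth_on S g
    \<Longrightarrow> smooth_on S (\<lambda>x. b (f x) (g x))"
  unfolding smooth_on_def using times_differentiable_on_bilinear by blast

lemma smooth_on_compose:
  fixes f :: "'b::euclidean_space \<Rightarrow> 'c::real_normed_vector"
  shows "smooth_on T f \<Longrightarrow> open S \<Longrightarrow> open T \<Longrightarrow> (\<And>x. x \<in> S \<Longrightarrow> g x \<in> T) \<Longrightarrow> smooth_on S g
    \<Longrightarrow> smooth_on S (\<lambda>x. f (g x))"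
  unfolding smooth_on_def using times_differentiable_on_compose by blast

lemma smooth_on_minus: "open S \<Longrightarrow> smooth_on S f \<Longrightarrow> smooth_on S (\<lambda>x. - f x)"
  by (rule smooth_on_linear) (auto intro: bounded_linear_minus bounded_linear_ident)

lemma smooth_on_diff:
  "open S \<Longrightarrow> smooth_on S f \<Longrightarrow> smooth_on S g \<Longrightarrow> smooth_on S (\<lambda>x. f x - g x)"
  using smooth_on_add[of S f "\<lambda>x. - g x"] smooth_on_minus by auto

lemma smooth_on_Pair:
  assumes "open S" "smooth_on S f" "smooth_on S g"
  shows "smooth_on S (\<lambda>x. (f x, g x))"
proof -
  have "bounded_linear (\<lambda>x::'b. (x, 0::'c))" "bounded_linear (\<lambda>x::'c. (0::'b, x))"
    by (auto intro!: bounded_linear_Pair bounded_linear_ident bounded_linear_zero)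
  then have "smooth_on S (\<lambda>x. (f x, 0) + (0, g x))"
    using assms by (intro smooth_on_add smooth_on_linear[where T = "\<lambda>x. (x, 0)"]
        smooth_on_linear[where T = "\<lambda>x. (0, x)"])
  then show ?thesis by simp
qed

lemmas smooth_on_mult = smooth_on_bilinear[OF _ bounded_bilinear_mult]
lemmas smooth_on_scaleR = smooth_on_bilinear[OF _ bounded_bilinear_scaleR]
lemmas smooth_on_inner = smooth_on_bilinear[OF _ bounded_bilinear_inner]
lemmas smooth_on_fst = smooth_on_linear[OF _ bounded_linear_fst]
lemmas smooth_on_snd = smooth_on_linear[OF _ bounded_linear_snd]
lemmas smooth_on_Im = smooth_on_linear[OF _ bounded_linear_Im]
lemmas smooth_on_of_real = smooth_on_linear[OF _ bounded_linear_of_real]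

section \<open>Smoothness of powers, reciprocals and elementary functions\<close>

lemma smooth_on_power:
  fixes f :: "'a::real_normed_vector \<Rightarrow> 'b::real_normed_algebra_1"
  assumes "open S" "smooth_on S f"
  shows "smooth_on S (\<lambda>x. f x ^ j)"
  by (induction j) (auto intro: smooth_on_const smooth_on_mult assms)

lemma smooth_on_imp_continuous_on: "smooth_on S f \<Longrightarrow> continuous_on S f"
  unfolding smooth_on_def by (metis times_differentiable_on.simps(1))

text \<open>A bootstrap for functions whose derivative is an expression in the function itself or is
  already known to be smooth: order \<open>k\<close> of \<open>f\<close> gives order
  \<open>k\<close> of \<open>f'\<close>, hence order \<open>k + 1\<close> of
  \<open>f\<close>.\<close>

lemma smooth_on_if_derivative:
  fixes f :: "'a::real_normed_field \<Rightarrow> 'a"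
  assumes "open S" "\<And>x. x \<in> S \<Longrightarrow> (f has_field_derivative f' x) (at x)"
    and "\<And>k. times_differentiable_on k S f \<Longrightarrow> times_differentiable_on k S f'"
  shows "smooth_on S f"
proof -
  have "times_differentiable_on k S f" for k
  proof (induction k)
    case 0
    then show ?case
      using assms(2) by (auto intro!: continuous_at_imp_continuous_on DERIV_isCont)
  next
    case (Suc k)
    show ?case
      by (rule times_differentiable_on_SucI[OF assms(1), where f' = "\<lambda>x v. f' x * v"])
        (use assms Suc.IH
          in \<open>auto simp: has_field_derivative_def intro: times_differentiable_on_linear[OF assms(1) bounded_linear_mult_left]\<close>)
  qed
  then show ?thesis by (simp add: smooth_on_def)
qed

lemma smooth_on_inverse_field:
  "smooth_on (- {0}) (inverse :: 'a::real_normed_field \<Rightarrow> 'a)"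
proof (rule smooth_on_if_derivative)
  show "(inverse has_field_derivative - (inverse x * inverse x)) (at x)" if "x \<in> - {0}" for x :: 'a
    using that DERIV_inverse[of x UNIV] by (simp add: power2_eq_square numeral_2_eq_2)
  show "times_differentiable_on k (- {0}) (\<lambda>x::'a. - (inverse x * inverse x))"
    if "times_differentiable_on k (- {0}) (inverse :: 'a \<Rightarrow> 'a)" for k
    using times_differentiable_on_linear[OF _ bounded_linear_minus[OF bounded_linear_ident]
        times_differentiable_on_bilinear[OF _ bounded_bilinear_mult that that]] by auto
qed auto

lemma smooth_on_inverse:
  fixes f :: "'a::real_normed_vector \<Rightarrow> 'b::{real_normed_field, euclidean_space}"
  assumes "open S" "smooth_on S f" "\<And>x. x \<in> S \<Longrightarrow> f x \<noteq> 0"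
  shows "smooth_on S (\<lambda>x. inverse (f x))"
  by (rule smooth_on_compose[OF smooth_on_inverse_field]) (use assms in auto)

lemma smooth_on_divide:
  fixes f :: "'a::real_normed_vector \<Rightarrow> 'b::{real_normed_field, euclidean_space}"
  assumes "open S" "smooth_on S f" "smooth_on S g" "\<And>x. x \<in> S \<Longrightarrow> g x \<noteq> 0"
  shows "smooth_on S (\<lambda>x. f x / g x)"
  unfolding divide_inverse using assms by (intro smooth_on_mult smooth_on_inverse)

lemma smooth_on_exp_field: "smooth_on UNIV (exp :: 'a::{banach,real_normed_field} \<Rightarrow> 'a)"
  by (rule smooth_on_if_derivative) (auto intro: DERIV_exp)

lemma smooth_on_exp:
  fixes f :: "'a::real_normed_vector \<Rightarrow> 'b::{banach,real_normed_field,euclidean_space}"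
  assumes "open S" "smooth_on S f"
  shows "smooth_on S (\<lambda>x. exp (f x))"
  by (rule smooth_on_compose[OF smooth_on_exp_field]) (use assms in auto)

text \<open>The two inductions run together because each function is, up to sign, the derivative of
  the other.\<close>

lemma smooth_on_sin_cos_real: "smooth_on UNIV (sin :: real \<Rightarrow> real)" "smooth_on UNIV (cos :: real \<Rightarrow> real)"
proof -
  have "times_differentiable_on k UNIV (sin :: real \<Rightarrow> real) \<and>
      times_differentiable_on k UNIV (cos :: real \<Rightarrow> real)" for k
  proof (induction k)
    case 0
    then show ?case by (auto intro: continuous_intros)
  next
    case (Suc k)
    have "times_differentiable_on (Suc k) UNIV (sin :: real \<Rightarrow> real)"
      by (rule times_differentiable_on_SucI[where f' = "\<lambda>x v. cos x * v"])
        (use Suc.IH in \<open>auto intro: times_differentiable_on_linear[OF _ bounded_linear_mult_left]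
          has_field_derivative_imp_has_derivative DERIV_sin\<close>)
    moreover have "(cos has_derivative (\<lambda>v. sin x * - v)) (at x)" for x :: real
      by (rule has_derivative_eq_rhs[OF DERIV_cos[unfolded has_field_derivative_def]]) auto
    then have "times_differentiable_on (Suc k) UNIV (cos :: real \<Rightarrow> real)"
      by (rule times_differentiable_on_SucI[where f' = "\<lambda>x v. sin x * - v", rotated])
        (use Suc.IH in \<open>auto
          intro: times_differentiable_on_linear[OF _ bounded_linear_minus[OF bounded_linear_mult_left]]\<close>)
    ultimately show ?case ..
  qed
  then show "smooth_on UNIV (sin :: real \<Rightarrow> real)" "smooth_on UNIV (cos :: real \<Rightarrow> real)"
    by (auto simp: smooth_on_def)
qed

lemma smooth_on_sin:
  fixes f :: "'a::real_normed_vector \<Rightarrow> real"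
  shows "open S \<Longrightarrow> smooth_on S f \<Longrightarrow> smooth_on S (\<lambda>x. sin (f x))"
  by (rule smooth_on_compose[OF smooth_on_sin_cos_real(1)]) auto

lemma smooth_on_cos:
  fixes f :: "'a::real_normed_vector \<Rightarrow> real"
  shows "open S \<Longrightarrow> smooth_on S f \<Longrightarrow> smooth_on S (\<lambda>x. cos (f x))"
  by (rule smooth_on_compose[OF smooth_on_sin_cos_real(2)]) auto

lemma smooth_on_ln:
  fixes f :: "'a::real_normed_vector \<Rightarrow> real"
  assumes "open S" "smooth_on S f" "\<And>x. x \<in> S \<Longrightarrow> 0 < f x"
  shows "smooth_on S (\<lambda>x. ln (f x))"
proof -
  have "smooth_on {0<..} (ln :: real \<Rightarrow> real)"
    by (rule smooth_on_if_derivative[where f' = inverse])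
      (use smooth_on_subset[OF smooth_on_inverse_field, of "{0::real<..}"] in
        \<open>auto simp: smooth_on_def intro: DERIV_ln\<close>)
  then show ?thesis by (rule smooth_on_compose) (use assms in auto)
qed

lemma smooth_on_Ln:
  fixes f :: "'a::real_normed_vector \<Rightarrow> complex"
  assumes "open S" "smooth_on S f" "\<And>x. x \<in> S \<Longrightarrow> f x \<notin> \<real>\<^sub>\<le>\<^sub>0"
  shows "smooth_on S (\<lambda>x. Ln (f x))"
proof -
  have "smooth_on (- \<real>\<^sub>\<le>\<^sub>0) Ln"
  proof (rule smooth_on_if_derivative[where f' = inverse])
    show "times_differentiable_on k (- \<real>\<^sub>\<le>\<^sub>0) (inverse :: complex \<Rightarrow> complex)" for k
      using smooth_on_subset[OF smooth_on_inverse_field, of "- \<real>\<^sub>\<le>\<^sub>0"]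
      by (auto simp: smooth_on_def)
  qed (auto intro: has_field_derivative_Ln open_Compl closed_nonpos_Reals_complex)
  then show ?thesis
    by (rule smooth_on_compose) (use assms in \<open>auto intro: open_Compl closed_nonpos_Reals_complex\<close>)
qed

lemma smooth_on_sqrt:
  fixes f :: "'a::real_normed_vector \<Rightarrow> real"
  assumes "open S" "smooth_on S f" "\<And>x. x \<in> S \<Longrightarrow> 0 < f x"
  shows "smooth_on S (\<lambda>x. sqrt (f x))"
proof -
  have "smooth_on S (\<lambda>x. exp (inverse 2 * ln (f x)))"
    using assms by (intro smooth_on_exp smooth_on_mult smooth_on_const smooth_on_ln)
  then show ?thesis
    by (rule smooth_on_cong[OF assms(1)])
      (use assms(3) in \<open>simp add: powr_half_sqrt[symmetric] powr_def less_imp_le less_imp_neq[symmetric]\<close>)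
qed

section \<open>Rotation hypersurfaces in the sphere\<close>

lemma periodic_int:
  fixes f :: "real \<Rightarrow> 'a"
  assumes "\<And>t. f (t + c) = f t"
  shows "f (t + c * of_int j) = f t"
proof (induction j rule: int_induct[where k = 0])
  case base
  then show ?case by simp
next
  case (step1 i)
  then show ?case using assms[of "t + c * of_int i"] by (simp add: algebra_simps)
next
  case (step2 i)
  then show ?case using assms[of "t + c * of_int (i - 1)"] by (simp add: algebra_simps)
qed

lemma cis_eq_imp_periodic:
  fixes f :: "real \<Rightarrow> 'a"
  assumes "\<And>t. f (t + 2 * pi) = f t" "cis s = cis t"
  shows "f s = f t"
proof -
  obtain j :: int where "s = t + 2 * pi * j"
    using assms(2) sin_cos_eq_iff[of s t] by (auto simp: complex_eq_iff)
  then show ?thesis using periodic_int[where f = f and c = "2 * pi"] assms(1) by simp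
qed

section \<open>Local branches of the argument\<close>

definition slit :: "real \<Rightarrow> complex set" where
  "slit t0 = {w. w * cis (- t0) \<notin> \<real>\<^sub>\<le>\<^sub>0}"

text \<open>The branch of the argument on the plane cut along the ray opposite to
  \<open>cis t0\<close>, normalized to be \<open>t0\<close> at \<open>cis t0\<close>. With one
  branch for each \<open>t0\<close>, every point off the origin lies inside the domain of some
  branch.\<close>

definition arg_near :: "real \<Rightarrow> complex \<Rightarrow> real" where
  "arg_near t0 w = t0 + Im (Ln (w * cis (- t0)))"

lemma open_slit: "open (slit t0)"
proof -
  have "slit t0 = (\<lambda>w. w * cis (- t0)) -` (- \<real>\<^sub>\<le>\<^sub>0)" by (auto simp: slit_def)
  then show ?thesis
    by (simp add: open_vimage open_Compl closed_nonpos_Reals_complex continuous_intros)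
qed

lemma slit_nonzero: "w \<in> slit t0 \<Longrightarrow> w \<noteq> 0"
  by (auto simp: slit_def)

lemma slit_center: "0 < r \<Longrightarrow> of_real r * cis t0 \<in> slit t0"
  by (simp add: slit_def cis_mult mult.assoc)

lemma arg_near_center: "0 < r \<Longrightarrow> arg_near t0 (of_real r * cis t0) = t0"
  by (simp add: arg_near_def cis_mult mult.assoc flip: Ln_of_real)

lemma arg_near_polar:
  assumes "w \<in> slit t0"
  shows "w = of_real (norm w) * cis (arg_near t0 w)"
proof -
  have nz: "w * cis (- t0) \<noteq> 0" using slit_nonzero[OF assms] by simp
  have "w * cis (- t0) = of_real (norm w) * cis (Im (Ln (w * cis (- t0))))"
    using exp_eq_polar[of "Ln (w * cis (- t0))"] nz slit_nonzero[OF assms]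
    by (simp add: norm_mult flip: exp_of_real)
  then have "w * cis (- t0) * cis t0 = of_real (norm w) * (cis t0 * cis (Im (Ln (w * cis (- t0)))))"
    by simp
  moreover have "w * cis (- t0) * cis t0 = w" by (simp add: mult.assoc cis_mult)
  ultimately show ?thesis by (simp add: arg_near_def cis_mult)
qed

lemma arg_near_periodic:
  fixes f :: "real \<Rightarrow> 'a"
  assumes "\<And>t. f (t + 2 * pi) = f t" "of_real r * cis t \<in> slit t0" "0 < r"
  shows "f (arg_near t0 (of_real r * cis t)) = f t"
proof (rule cis_eq_imp_periodic[where f = f])
  show "f (t + 2 * pi) = f t" for t by (rule assms(1))
  have "of_real r * cis t = of_real r * cis (arg_near t0 (of_real r * cis t))"
    using arg_near_polar[OF assms(2)] assms(3) by (simp add: norm_mult)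
  then show "cis (arg_near t0 (of_real r * cis t)) = cis t" using assms(3) by simp
qed

lemma smooth_on_Ln_slit: "smooth_on (slit t0) (\<lambda>w. Ln (w * cis (- t0)))"
  by (intro smooth_on_Ln smooth_on_mult smooth_on_id smooth_on_const open_slit) (simp add: slit_def)

lemma smooth_on_arg_near: "smooth_on (slit t0) (arg_near t0)"
  unfolding arg_near_def[abs_def]
  by (intro smooth_on_add smooth_on_const smooth_on_Im smooth_on_Ln_slit open_slit)

lemma has_derivative_arg_near:
  assumes "w \<in> slit t0"
  shows "(arg_near t0 has_derivative (\<lambda>v. Im (v / w))) (at w)"
proof -
  have "((\<lambda>w. Ln (w * cis (- t0))) has_field_derivative (inverse (w * cis (- t0)) * cis (- t0))) (at w)"
    using assms by (auto intro!: derivative_eq_intros simp: slit_def)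
  then have "((\<lambda>w. Ln (w * cis (- t0))) has_field_derivative inverse w) (at w)"
    by (simp add: cis_mult mult.assoc)
  then have "((\<lambda>w. Ln (w * cis (- t0))) has_derivative (\<lambda>v. v / w)) (at w)"
    by (simp add: has_field_derivative_def mult_commute_abs divide_inverse)
  then show ?thesis unfolding arg_near_def[abs_def]
    by (auto intro!: derivative_eq_intros bounded_linear.has_derivative[OF bounded_linear_Im])
qed

section \<open>Compactness and slice charts of a rotation hypersurface\<close>

locale rotation_profile =
  fixes \<rho> \<rho>' \<rho>'' :: "real \<Rightarrow> real"
  assumes pos: "0 < \<rho> t" and less: "\<rho> t < pi / 2"
    and periodic: "\<rho> (t + 2 * pi) = \<rho> t"
    and deriv: "(\<rho> has_real_derivative \<rho>' t) (at t)"
    and deriv2: "(\<rho>' has_real_derivative \<rho>'' t) (at t)"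
    and smooth: "smooth_on UNIV \<rho>"
begin

definition curve :: "real \<Rightarrow> complex \<times> real" where
  "curve t = (of_real (cos (\<rho> t)) * cis t, sin (\<rho> t))"

definition M :: "(complex \<times> (real ^ 'm)) set" where
  "M = generated_hypersurface curve"

lemma sin_pos: "0 < sin (\<rho> t)"
  using pos[of t] less[of t] by (intro sin_gt_zero) auto

lemma cos_pos: "0 < cos (\<rho> t)"
  using pos[of t] less[of t] by (intro cos_gt_zero_pi) auto

lemma mem_M:
  "(w, y) \<in> M \<longleftrightarrow> (\<exists>t. w = of_real (cos (\<rho> t)) * cis t \<and> norm y = sin (\<rho> t))"
proof
  assume "(w, y) \<in> M"
  then show "\<exists>t. w = of_real (cos (\<rho> t)) * cis t \<and> norm y = sin (\<rho> t)"
    using sin_pos by (auto simp: M_def generated_hypersurface_def rotation_map_def curve_def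
        less_imp_le)
next
  assume "\<exists>t. w = of_real (cos (\<rho> t)) * cis t \<and> norm y = sin (\<rho> t)"
  then obtain t where t: "w = of_real (cos (\<rho> t)) * cis t" "norm y = sin (\<rho> t)" by blast
  define x where "x = inverse (sin (\<rho> t)) *\<^sub>R y"
  have "y = sin (\<rho> t) *\<^sub>R x" "x \<in> sphere 0 1"
    using sin_pos[of t] t(2) by (auto simp: x_def)
  then show "(w, y) \<in> M" using t(1)
    unfolding M_def generated_hypersurface_def rotation_map_def curve_def by auto
qed

text \<open>Over a slit plane the existentially quantified angle can be replaced by a local branch,
  because the profile is periodic. Each direction in the plane then determines a single radius
  \<open>cos \<rho>\<close>, which excludes self-intersections.\<close>

lemma mem_M_slit:
  assumes "w \<in> slit t0"
  shows "(w, y) \<in> M \<longleftrightarrow>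
    norm w = cos (\<rho> (arg_near t0 w)) \<and> norm y = sin (\<rho> (arg_near t0 w))"
proof
  assume "(w, y) \<in> M"
  then obtain t where t: "w = of_real (cos (\<rho> t)) * cis t" "norm y = sin (\<rho> t)"
    by (auto simp: mem_M)
  have "\<rho> (arg_near t0 w) = \<rho> t"
    using arg_near_periodic[of \<rho>, OF periodic] assms cos_pos[of t] t(1) by auto
  then show "norm w = cos (\<rho> (arg_near t0 w)) \<and> norm y = sin (\<rho> (arg_near t0 w))"
    using t cos_pos[of t] by (auto simp: norm_mult)
next
  assume "norm w = cos (\<rho> (arg_near t0 w)) \<and> norm y = sin (\<rho> (arg_near t0 w))"
  then show "(w, y) \<in> M"
    using arg_near_polar[OF assms] by (auto simp: mem_M intro!: exI[of _ "arg_near t0 w"])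
qed

lemma M_nonempty: "M \<noteq> {}"
proof -
  have "(of_real (cos (\<rho> 0)) * cis 0, sin (\<rho> 0) *\<^sub>R axis undefined 1) \<in> M"
    using sin_pos[of 0] by (auto simp: mem_M intro!: exI[of _ 0])
  then show ?thesis by blast
qed

lemma M_subset_sphere: "M \<subseteq> sphere 0 1"
  by (auto simp: mem_M norm_Pair norm_mult)

lemma continuous_rho: "continuous_on A \<rho>"
  using deriv by (auto intro!: continuous_at_imp_continuous_on DERIV_isCont)

lemma compact_M: "compact (M :: (complex \<times> (real ^ 'm)) set)"
proof -
  let ?f = "\<lambda>(t, x). (of_real (cos (\<rho> t)) * cis t, sin (\<rho> t) *\<^sub>R x) :: complex \<times> (real ^ 'm)"
  have "M = ?f ` ({0..2 * pi} \<times> sphere 0 1)"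
  proof (intro set_eqI iffI)
    fix p :: "complex \<times> (real ^ 'm)"
    assume "p \<in> M"
    then obtain t x where p: "p = ?f (t, x)" "x \<in> sphere 0 1"
      by (auto simp: M_def generated_hypersurface_def rotation_map_def curve_def)
    define j where "j = \<lfloor>t / (2 * pi)\<rfloor>"
    define s where "s = t - 2 * pi * of_int j"
    have "of_int j \<le> t / (2 * pi)" "t / (2 * pi) \<le> of_int j + 1"
      unfolding j_def by linarith+
    then have s: "s \<in> {0..2 * pi}"
      by (simp add: s_def field_simps)
    have "?f (s + 2 * pi * of_int j, x) = ?f (s, x)"
      by (rule periodic_int[where f = "\<lambda>s. ?f (s, x)"])
        (simp add: periodic cis_mult[symmetric])
    then have "?f (t, x) = ?f (s, x)" by (simp add: s_def)
    then show "p \<in> ?f ` ({0..2 * pi} \<times> sphere 0 1)" using p s by blast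
  next
    fix p :: "complex \<times> (real ^ 'm)"
    assume "p \<in> ?f ` ({0..2 * pi} \<times> sphere 0 1)"
    then show "p \<in> M" using sin_pos
      by (auto simp: mem_M less_imp_le)
  qed
  moreover have "continuous_on ({0..2 * pi} \<times> sphere 0 1) ?f"
    unfolding split_beta
    by (intro continuous_intros continuous_on_compose2[OF continuous_rho]) auto
  ultimately show ?thesis
    using compact_continuous_image[of "{0..2 * pi} \<times> sphere 0 1" ?f]
    by (simp add: compact_Times del: split_paired_All)
qed

text \<open>The slice chart: logarithm in the plane \<open>\<complex>\<close>, shifted by \<open>ln (cos \<rho>)\<close> so that the curve becomes
  a vertical segment, and in \<open>\<real>\<^sup>m\<close> the component of \<open>y\<close> along the base point is replaced by
  \<open>\<bar>y\<bar>\<^sup>2 - sin\<^sup>2 \<rho>\<close>.\<close>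

lemma embedded_submanifold_M: "embedded_submanifold CARD('m) (M :: (complex \<times> (real ^ 'm)) set)"
  unfolding embedded_submanifold_def
proof
  fix p0 :: "complex \<times> (real ^ 'm)"
  assume "p0 \<in> M"
  then obtain t0 w0 y0 where p0: "p0 = (w0, y0)" "w0 = of_real (cos (\<rho> t0)) * cis t0"
    "norm y0 = sin (\<rho> t0)"
    by (metis mem_M surj_pair)
  define e where "e = inverse (norm y0) *\<^sub>R y0"
  have y0: "y0 \<noteq> 0" using p0(3) sin_pos[of t0] by auto
  have ee: "e \<bullet> e = 1" using y0
    by (simp add: e_def dot_square_norm power2_eq_square)
  define P where "P y = y - (y \<bullet> e) *\<^sub>R e" for y
  have P: "P y \<bullet> e = 0" "P (P y + s *\<^sub>R e) = P y" "(P y + s *\<^sub>R e) \<bullet> e = s" 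
      "P y + (y \<bullet> e) *\<^sub>R e = y" "y \<bullet> y = P y \<bullet> P y + (y \<bullet> e)\<^sup>2"
      "(P y + s *\<^sub>R e) \<bullet> (P y + s *\<^sub>R e) = P y \<bullet> P y + s\<^sup>2" for y s
    by (auto simp: P_def inner_simps ee algebra_simps power2_eq_square inner_commute)
  have bP: "bounded_linear P"
    unfolding P_def by (intro bounded_linear_sub bounded_linear_ident 
        bounded_linear_compose[OF bounded_linear_scaleR_left bounded_linear_inner_left])
  \<comment> \<open>The sign condition on \<open>snd p \<bullet> e\<close> selects one of the two
    vectors with given norm and given \<open>P\<close>-part, so that the square root in
    \<open>\<psi>\<close> recovers it.\<close>
  define U where "U = {p :: complex \<times> (real ^ 'm). fst p \<in> slit t0 \<and> 0 < snd p \<bullet> e}"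
  define \<tau> where "\<tau> = arg_near t0"
  define b where "b t = (sin (\<rho> t))\<^sup>2" for t
  define l where "l t = ln (cos (\<rho> t))" for t
  define \<phi> where "\<phi> p = (Ln (fst p * cis (- t0)) - of_real (l (\<tau> (fst p))),
      P (snd p) + (snd p \<bullet> snd p - b (\<tau> (fst p))) *\<^sub>R e)" for p
  \<comment> \<open>\<open>d q\<close> is the square of the lost component of \<open>y\<close> along
    \<open>e\<close>: the coordinate along \<open>e\<close> plus \<open>b\<close> returns the
    squared norm of \<open>y\<close>, from which the part orthogonal to \<open>e\<close> is
    subtracted.\<close>
  define d where "d q = snd q \<bullet> e + b (t0 + Im (fst q)) - P (snd q) \<bullet> P (snd q)" for q
  define V where "V = {q :: complex \<times> (real ^ 'm). \<bar>Im (fst q)\<bar> < pi \<and> 0 < d q}"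
  define \<psi> where "\<psi> q = (cis t0 * exp (fst q + of_real (l (t0 + Im (fst q)))),
      P (snd q) + sqrt (d q) *\<^sub>R e)" for q
  define W where "W = {q :: complex \<times> (real ^ 'm). (1, 0) \<bullet> q = 0 \<and> (0, e) \<bullet> q = 0}"
  have smooth_b: "smooth_on UNIV b" and smooth_l: "smooth_on UNIV l"
    unfolding b_def l_def
    by (intro smooth_on_power smooth_on_sin smooth_on_ln smooth_on_cos smooth open_UNIV cos_pos)+
  have smooth_d: "smooth_on UNIV d"
    unfolding d_def
    by (intro smooth_on_add smooth_on_diff smooth_on_inner smooth_on_linear[OF _ bP] smooth_on_const
        smooth_on_snd smooth_on_compose[OF smooth_b] smooth_on_Im smooth_on_fst smooth_on_id) auto
  have "U = (slit t0 \<times> UNIV) \<inter> (\<lambda>p. snd p \<bullet> e) -` {0<..}" by (auto simp: U_def)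
  also have "open \<dots>"
    by (intro open_Int open_Times open_slit open_vimage continuous_intros) auto
  finally have oU: "open U" .
  have "V = (\<lambda>q. \<bar>Im (fst q)\<bar>) -` {..<pi} \<inter> d -` {0<..}" by (auto simp: V_def)
  also have "open \<dots>"
    by (intro open_Int open_vimage continuous_intros smooth_on_imp_continuous_on[OF smooth_d])
  finally have oV: "open V" .
  have smU: "smooth_on U (\<lambda>p. \<tau> (fst p))" unfolding \<tau>_def
    by (intro smooth_on_compose[OF smooth_on_arg_near] smooth_on_fst smooth_on_id oU open_slit)
      (auto simp: U_def)
  have sm\<phi>: "smooth_on U \<phi>"
    unfolding \<phi>_def
    by (intro smooth_on_Pair smooth_on_add smooth_on_diff smooth_on_compose[OF smooth_on_Ln_slit] 
        smooth_on_of_real smooth_on_compose[OF smooth_l] smooth_on_compose[OF smooth_b]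
        smooth_on_linear[OF _ bP] smooth_on_scaleR smooth_on_inner smooth_on_const
        smooth_on_snd smooth_on_fst smooth_on_id oU open_slit smU) (auto simp: U_def)
  have sm\<psi>: "smooth_on V \<psi>"
    unfolding \<psi>_def
    by (intro smooth_on_Pair smooth_on_add smooth_on_mult smooth_on_exp
        smooth_on_of_real smooth_on_compose[OF smooth_l] smooth_on_Im
        smooth_on_linear[OF _ bP] smooth_on_scaleR smooth_on_sqrt smooth_on_const
        smooth_on_snd smooth_on_fst smooth_on_id oV smooth_on_subset[OF smooth_d]) (auto simp: V_def)
  have \<phi>V: "\<phi> p \<in> V" and \<psi>\<phi>: "\<psi> (\<phi> p) = p" if "p \<in> U" for p
  proof -
    obtain w y where p: "p = (w, y)" by fastforce
    have w: "w \<in> slit t0" "w \<noteq> 0" and ye: "0 < y \<bullet> e"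
      using that slit_nonzero by (auto simp: U_def p)
    have Im: "t0 + Im (fst (\<phi> p)) = \<tau> w"
      by (simp add: \<phi>_def p \<tau>_def arg_near_def)
    have d: "d (\<phi> p) = (y \<bullet> e)\<^sup>2"
      unfolding d_def Im using P(5)[of y] by (simp add: \<phi>_def p P(1-4,6))
    have "\<bar>Im (fst (\<phi> p))\<bar> < pi"
      using w mpi_less_Im_Ln[of "w * cis (- t0)"] Im_Ln_less_pi[of "w * cis (- t0)"]
      by (auto simp: \<phi>_def p slit_def)
    then show "\<phi> p \<in> V" using d ye by (simp add: V_def)
    have "fst (\<psi> (\<phi> p)) = cis t0 * exp (Ln (w * cis (- t0)))"
      unfolding \<psi>_def Im by (simp add: \<phi>_def p)
    then have "fst (\<psi> (\<phi> p)) = w" using w by (simp add: cis_mult mult.commute mult.left_commute)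
    moreover have "snd (\<psi> (\<phi> p)) = y"
      unfolding \<psi>_def d using ye P(4)[of y] by (simp add: \<phi>_def p P(1-4,6))
    ultimately show "\<psi> (\<phi> p) = p" by (simp add: p prod_eq_iff)
  qed
  have \<psi>w: "fst (\<psi> q) \<in> slit t0" "Ln (fst (\<psi> q) * cis (- t0)) = fst q + of_real (l (t0 + Im (fst q)))"
    "\<tau> (fst (\<psi> q)) = t0 + Im (fst q)" if "q \<in> V" for q
  proof -
    have a: "fst (\<psi> q) * cis (- t0) = exp (fst q + of_real (l (t0 + Im (fst q))))"
      by (simp add: \<psi>_def cis_mult mult.commute mult.left_commute)
    show L: "Ln (fst (\<psi> q) * cis (- t0)) = fst q + of_real (l (t0 + Im (fst q)))"
      unfolding a using that by (intro Ln_exp) (auto simp: V_def)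
    then show "\<tau> (fst (\<psi> q)) = t0 + Im (fst q)"
      by (simp add: \<tau>_def arg_near_def)
    have "Im (Ln (fst (\<psi> q) * cis (- t0))) \<noteq> pi" "fst (\<psi> q) * cis (- t0) \<noteq> 0"
      using that unfolding L by (auto simp: V_def a)
    then show "fst (\<psi> q) \<in> slit t0"
      by (auto simp: slit_def complex_nonpos_Reals_iff Im_Ln_eq_pi complex_eq_iff)
  qed
  have \<psi>U: "\<psi> q \<in> U" and \<phi>\<psi>: "\<phi> (\<psi> q) = q" if "q \<in> V" for q
  proof -
    have d: "0 < d q" using that by (simp add: V_def)
    show "\<psi> q \<in> U" using \<psi>w(1)[OF that] d by (simp add: U_def \<psi>_def P(1-4,6))
    have "fst (\<phi> (\<psi> q)) = fst q"
      unfolding \<phi>_def using \<psi>w[OF that] by simp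
    moreover have "P (snd (\<psi> q)) = P (snd q)" "snd (\<psi> q) \<bullet> snd (\<psi> q) = P (snd q) \<bullet> P (snd q) + d q"
      using d by (simp_all add: \<psi>_def P(1-4,6))
    then have "snd (\<phi> (\<psi> q)) = snd q"
      unfolding \<phi>_def using \<psi>w(3)[OF that] P(4)[of "snd q"] by (simp add: d_def)
    ultimately show "\<phi> (\<psi> q) = q" by (simp add: prod_eq_iff)
  qed
  have hom: "homeomorphism U V \<phi> \<psi>"
  proof (rule homeomorphismI)
    show "continuous_on U \<phi>" "continuous_on V \<psi>"
      by (rule smooth_on_imp_continuous_on[OF sm\<phi>] smooth_on_imp_continuous_on[OF sm\<psi>])+
  qed (use \<phi>V \<psi>\<phi> \<psi>U \<phi>\<psi> in blast)+
  have p0U: "p0 \<in> U"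
    using slit_center[OF cos_pos[of t0]] y0 sin_pos[of t0]
    by (simp add: U_def p0 e_def dot_square_norm)
  have M_iff: "p \<in> M \<longleftrightarrow> \<phi> p \<in> W" if "p \<in> U" for p
  proof -
    obtain w y where p: "p = (w, y)" by fastforce
    have w: "w \<in> slit t0" "w \<noteq> 0" and ye: "0 < y \<bullet> e"
      using that slit_nonzero by (auto simp: U_def p)
    have "(1, 0) \<bullet> \<phi> p = ln (norm w) - ln (cos (\<rho> (\<tau> w)))"
      using w by (simp add: \<phi>_def p l_def norm_mult inner_complex_def)
    moreover have "(0, e) \<bullet> q = snd q \<bullet> e" for q :: "complex \<times> (real ^ 'm)"
      using inner_commute[of e "snd q"] by (cases q) simp
    then have "(0, e) \<bullet> \<phi> p = (norm y)\<^sup>2 - (sin (\<rho> (\<tau> w)))\<^sup>2"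
      unfolding \<phi>_def p b_def by (simp only: snd_conv fst_conv P(3) dot_square_norm)
    moreover have "ln (norm w) = ln (cos (\<rho> (\<tau> w))) \<longleftrightarrow> norm w = cos (\<rho> (\<tau> w))"
      using w cos_pos by simp
    moreover have "(norm y)\<^sup>2 = (sin (\<rho> (\<tau> w)))\<^sup>2 \<longleftrightarrow> norm y = sin (\<rho> (\<tau> w))"
      using sin_pos[of "\<tau> w"] by (simp add: power2_eq_iff_nonneg)
    ultimately show ?thesis
      using mem_M_slit[OF w(1), of y] by (simp add: W_def p \<tau>_def)
  qed
  have "\<phi> ` (M \<inter> U) = W \<inter> V"
  proof (intro set_eqI iffI)
    fix q assume q: "q \<in> W \<inter> V"
    then have "\<psi> q \<in> M \<inter> U" using M_iff[OF \<psi>U] \<phi>\<psi> \<psi>U by auto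
    then show "q \<in> \<phi> ` (M \<inter> U)" using \<phi>\<psi>[of q] q by (metis IntD2 imageI)
  qed (use M_iff \<phi>V in blast)
  moreover have "subspace W"
    unfolding W_def by (auto intro: subspace_inter[unfolded Collect_conj_eq] subspace_hyperplane simp: Collect_conj_eq)
  \<comment> \<open>\<open>W\<close> is the orthogonal complement of two non-zero orthogonal vectors
    in a space of real dimension \<open>CARD('m) + 2\<close>.\<close>
  moreover have "dim W = CARD('m)"
  proof -
    let ?A = "{(1, 0), (0, e)} :: (complex \<times> (real ^ 'm)) set"
    have "dim {y \<in> UNIV. \<forall>x\<in>span ?A. orthogonal x y} + dim (span ?A) = dim (UNIV :: (complex \<times> (real ^ 'm)) set)"
      by (rule dim_subspace_orthogonal_to_vectors) auto
    moreover have "{y \<in> UNIV. \<forall>x\<in>span ?A. orthogonal x y} = W"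
    proof -
      have "(\<forall>x\<in>span ?A. orthogonal x y) \<longleftrightarrow> (\<forall>x\<in>?A. orthogonal x y)" for y
        by (auto simp only: orthogonal_commute[of _ y] intro: span_base orthogonal_to_span)
      then show ?thesis by (auto simp: W_def orthogonal_def)
    qed
    moreover have "dim (span ?A) = 2"
    proof -
      have "independent ?A"
        by (rule pairwise_orthogonal_independent)
          (use ee in \<open>auto simp: pairwise_def orthogonal_def zero_prod_def\<close>)
      then have "dim ?A = card ?A" by (rule dim_eq_card_independent)
      then show ?thesis by (simp add: dim_span)
    qed
    ultimately show ?thesis by (simp add: dim_UNIV)
  qed
  ultimately show "\<exists>(U :: (complex \<times> (real ^ 'm)) set) (V :: (complex \<times> (real ^ 'm)) set) \<phi> \<psi> W. open U \<and> p0 \<in> U \<and> open V \<and>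
        homeomorphism U V \<phi> \<psi> \<and> smooth_on U \<phi> \<and> smooth_on V \<psi> \<and>
        subspace W \<and> dim W = CARD('m) \<and> \<phi> ` (M \<inter> U) = W \<inter> V"
    using oU oV p0U hom sm\<phi> sm\<psi>
    by (intro exI[of _ U] exI[of _ V] exI[of _ \<phi>] exI[of _ \<psi>] exI[of _ W] conjI)
qed

end

section \<open>Tangent spaces, unit normal and mean curvature\<close>

lemma inner_mult_cis: "(u * cis t) \<bullet> (v * cis t) = u \<bullet> v"
proof -
  have "(u * Complex c s) \<bullet> (v * Complex c s) = (u \<bullet> v) * (s\<^sup>2 + c\<^sup>2)" for c s
    by (simp add: inner_complex_def algebra_simps power2_eq_square)
  then show ?thesis by (simp add: cis.ctr)
qed

lemma inner_frame:
  fixes y :: "'a::real_inner"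
  assumes "y \<bullet> u = 0"
  shows "(A * cis t, m *\<^sub>R y) \<bullet> (a *\<^sub>R (B * cis t), c *\<^sub>R y + u) = a * (A \<bullet> B) + m * c * (y \<bullet> y)"
  using assms by (simp add: inner_simps inner_mult_cis)

lemma has_vector_derivative_cis: "(cis has_vector_derivative \<i> * cis t) (at t)"
proof -
  have d: "((\<lambda>z. exp (\<i> * z)) has_field_derivative \<i> * exp (\<i> * of_real t)) (at (of_real t))"
    by (auto intro!: derivative_eq_intros)
  have cis: "cis = (\<lambda>t. exp (\<i> * of_real t))" by (rule ext) (rule cis_conv_exp)
  show ?thesis unfolding cis by (rule has_vector_derivative_real_field[OF d])
qed

context rotation_profile
begin

lemma deriv_periodic: "\<rho>' (t + 2 * pi) = \<rho>' t"
proof -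
  have "((\<lambda>s. \<rho> (s + 2 * pi)) has_real_derivative \<rho>' (t + 2 * pi)) (at t)"
    using deriv[of "t + 2 * pi"] by (simp add: DERIV_shift)
  then show ?thesis
    using DERIV_unique[OF deriv[of t]] by (simp add: periodic)
qed

definition base :: "real \<Rightarrow> complex" where
  "base t = of_real (cos (\<rho> t)) * cis t"

text \<open>Velocity and acceleration in the plane are kept as coefficients relative to the rotating
  frame \<open>cis t\<close>; rotation preserves inner products, so later computations involve only
  these coefficients.\<close>

definition base' :: "real \<Rightarrow> complex" where
  "base' t = Complex (- sin (\<rho> t) * \<rho>' t) (cos (\<rho> t)) * cis t"

definition base'' :: "real \<Rightarrow> complex" where
  "base'' t = Complex (- cos (\<rho> t) * (\<rho>' t)\<^sup>2 - sin (\<rho> t) * \<rho>'' t - cos (\<rho> t))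
    (- 2 * sin (\<rho> t) * \<rho>' t) * cis t"

lemma has_vector_derivative_Complex_cis:
  assumes "(a has_real_derivative a') (at t)" "(b has_real_derivative b') (at t)"
  shows "((\<lambda>t. Complex (a t) (b t) * cis t) has_vector_derivative
    Complex (a' - b t) (b' + a t) * cis t) (at t)"
proof -
  have "((\<lambda>t. of_real (a t) + \<i> * of_real (b t)) has_vector_derivative of_real a' + \<i> * of_real b') (at t)"
    using assms by (intro derivative_intros) auto
  from has_vector_derivative_mult[OF this has_vector_derivative_cis]
  have "((\<lambda>t. (of_real (a t) + \<i> * of_real (b t)) * cis t) has_vector_derivative
      (of_real (a t) + \<i> * of_real (b t)) * (\<i> * cis t) + (of_real a' + \<i> * of_real b') * cis t) (at t)" .
  moreover have "(of_real (a t) + \<i> * of_real (b t)) * (\<i> * cis t) + (of_real a' + \<i> * of_real b') * cis t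
      = Complex (a' - b t) (b' + a t) * cis t"
    by (simp add: Complex_eq algebra_simps)
  ultimately show ?thesis by (simp add: Complex_eq)
qed

lemma has_vector_derivative_base: "(base has_vector_derivative base' t) (at t)"
proof -
  have "((\<lambda>t. Complex (cos (\<rho> t)) 0 * cis t) has_vector_derivative
    Complex (- sin (\<rho> t) * \<rho>' t - 0) (0 + cos (\<rho> t)) * cis t) (at t)"
    by (intro has_vector_derivative_Complex_cis) (auto intro!: derivative_eq_intros deriv)
  then show ?thesis by (simp add: base_def[abs_def] base'_def complex_of_real_def)
qed

lemma has_vector_derivative_base': "(base' has_vector_derivative base'' t) (at t)"
proof -
  have "((\<lambda>t. Complex (- sin (\<rho> t) * \<rho>' t) (cos (\<rho> t)) * cis t) has_vector_derivative
    Complex ((- cos (\<rho> t) * (\<rho>' t)\<^sup>2 - sin (\<rho> t) * \<rho>'' t) - cos (\<rho> t))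
      (- sin (\<rho> t) * \<rho>' t + - sin (\<rho> t) * \<rho>' t) * cis t) (at t)"
    by (intro has_vector_derivative_Complex_cis)
      (auto intro!: derivative_eq_intros deriv deriv2 simp: power2_eq_square algebra_simps)
  then show ?thesis by (simp add: base'_def[abs_def] base''_def mult_ac)
qed

lemma smooth_base: "smooth_on UNIV base"
proof -
  have "smooth_on UNIV (\<lambda>t. of_real (cos (\<rho> t)) * exp (\<i> * of_real t))"
    by (intro smooth_on_mult smooth_on_of_real smooth_on_cos smooth_on_exp smooth_on_const
        smooth smooth_on_id open_UNIV)
  then show ?thesis by (simp add: base_def[abs_def] cis_conv_exp)
qed

text \<open>A tangent vector consists of an angular speed \<open>a\<close> and a motion
  \<open>u\<close> along the orbit sphere; the component along \<open>y\<close> is forced by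
  differentiating the condition that \<open>y\<close> has norm \<open>sin \<rho>\<close>.
  Conversely, each such pair is realized by an explicit curve.\<close>

lemma tangent_vectors_M:
  fixes y :: "real ^ 'm"
  assumes y: "norm y = sin (\<rho> t)"
  shows "tangent_vectors M (base t, y) =
    {(a *\<^sub>R base' t, (a * cos (\<rho> t) * \<rho>' t / sin (\<rho> t)) *\<^sub>R y + u) | a u. y \<bullet> u = 0}"
    (is "_ = ?T")
proof (intro set_eqI iffI)
  fix v assume "v \<in> ?T"
  then obtain a u where v: "v = (a *\<^sub>R base' t, (a * cos (\<rho> t) * \<rho>' t / sin (\<rho> t)) *\<^sub>R y + u)"
    and u: "y \<bullet> u = 0" by blast
  \<comment> \<open>Since \<open>u\<close> is orthogonal to \<open>y\<close>, \<open>q s\<close> is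
    the squared norm of \<open>y + s *\<^sub>R u\<close>; the factor in \<open>c\<close> rescales
    this vector to the radius prescribed at the angle \<open>t + a * s\<close>.\<close>
  define q where "q s = (sin (\<rho> t))\<^sup>2 + s\<^sup>2 * (u \<bullet> u)" for s
  define c where "c s = (base (t + a * s), (sin (\<rho> (t + a * s)) / sqrt (q s)) *\<^sub>R (y + s *\<^sub>R u))" for s
  have q: "0 < q s" for s
    using sin_pos[of t] by (simp add: q_def add_pos_nonneg)
  have nq: "norm (y + s *\<^sub>R u) = sqrt (q s)" for s
  proof -
    have "(y + s *\<^sub>R u) \<bullet> (y + s *\<^sub>R u) = q s"
      using u by (simp add: q_def inner_simps inner_commute[of u y] power2_eq_square dot_square_norm[of y] y)
    then show ?thesis by (simp add: norm_eq_sqrt_inner)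
  qed
  have lin: "smooth_on UNIV (\<lambda>s. t + a * s)"
    by (intro smooth_on_add smooth_on_const smooth_on_mult smooth_on_id open_UNIV)
  have "smooth_on UNIV c"
    unfolding c_def q_def
    using q unfolding q_def
    by (intro smooth_on_Pair smooth_on_compose[OF smooth_base] smooth_on_scaleR smooth_on_divide
        smooth_on_sin smooth_on_compose[OF smooth] lin smooth_on_sqrt smooth_on_add smooth_on_const
        smooth_on_mult smooth_on_power smooth_on_id open_UNIV UNIV_I)
      (auto simp: less_imp_neq[symmetric])
  then have "smooth_on {-1<..<1} c" by (rule smooth_on_subset) simp
  moreover have "c ` {-1<..<1} \<subseteq> M"
    using q by (auto simp: c_def mem_M base_def nq less_imp_neq[symmetric] abs_of_pos sin_pos)
  moreover have "c 0 = (base t, y)"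
    using sin_pos[of t] by (simp add: c_def q_def)
  moreover have "(c has_vector_derivative v) (at 0)"
  proof -
    have "((\<lambda>s. base (t + a * s)) has_vector_derivative a *\<^sub>R base' t) (at 0)"
      by (rule vector_diff_chain_at[of "\<lambda>s. t + a * s" a 0 base, unfolded o_def])
        (auto intro!: derivative_eq_intros has_vector_derivative_base
          simp: has_real_derivative_iff_has_vector_derivative[symmetric])
    moreover have "((\<lambda>s. sin (\<rho> (t + a * s)) / sqrt (q s)) has_real_derivative
        a * cos (\<rho> t) * \<rho>' t / sin (\<rho> t)) (at 0)"
      unfolding q_def
      using sin_pos[of t]
      by (auto intro!: derivative_eq_intros DERIV_chain2[OF deriv] simp: power2_eq_square)
    then have "((\<lambda>s. (sin (\<rho> (t + a * s)) / sqrt (q s)) *\<^sub>R (y + s *\<^sub>R u)) has_vector_derivative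
        (sin (\<rho> (t + a * 0)) / sqrt (q 0)) *\<^sub>R u + (a * cos (\<rho> t) * \<rho>' t / sin (\<rho> t)) *\<^sub>R (y + 0 *\<^sub>R u)) (at 0)"
      by (rule has_vector_derivative_scaleR)
        (auto intro!: derivative_eq_intros)
    then have "((\<lambda>s. (sin (\<rho> (t + a * s)) / sqrt (q s)) *\<^sub>R (y + s *\<^sub>R u)) has_vector_derivative
        (a * cos (\<rho> t) * \<rho>' t / sin (\<rho> t)) *\<^sub>R y + u) (at 0)"
      using sin_pos[of t] by (simp add: q_def add.commute)
    ultimately show ?thesis
      unfolding c_def v by (rule has_vector_derivative_Pair)
  qed
  ultimately show "v \<in> tangent_vectors M (base t, y)"
    unfolding tangent_vectors_def by (auto intro!: exI[of _ c] exI[of _ "1::real"])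
next
  fix v assume "v \<in> tangent_vectors M (base t, y)"
  then obtain c \<epsilon> where c: "0 < \<epsilon>" "c ` {-\<epsilon><..<\<epsilon>} \<subseteq> M" "c 0 = (base t, y)"
    "(c has_vector_derivative v) (at 0)"
    unfolding tangent_vectors_def by blast
  obtain v1 v2 where v: "v = (v1, v2)" by fastforce
  have d1: "((\<lambda>s. fst (c s)) has_vector_derivative v1) (at 0)"
    and d2: "((\<lambda>s. snd (c s)) has_vector_derivative v2) (at 0)"
    using bounded_linear.has_vector_derivative[OF bounded_linear_fst c(4)]
      bounded_linear.has_vector_derivative[OF bounded_linear_snd c(4)] by (auto simp: v)
  have bs: "base t \<in> slit t"
    using slit_center[OF cos_pos] by (simp add: base_def)
  \<comment> \<open>The differential of the argument at \<open>w\<close> is the imaginary part of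
    \<open>dw / w\<close>, so \<open>a\<close> is the angular speed of the given curve.\<close>
  define a where "a = Im (v1 / base t)"
  define g where "g s = arg_near t (fst (c s))" for s
  have g0: "g 0 = t" using arg_near_center[OF cos_pos] by (simp add: g_def c(3) base_def)
  have "(g has_derivative (\<lambda>s. Im ((s *\<^sub>R v1) / base t))) (at 0)"
    unfolding g_def
    using has_derivative_compose[OF d1[unfolded has_vector_derivative_def], of "arg_near t"]
      has_derivative_arg_near[OF bs] by (simp add: c(3))
  moreover have "(\<lambda>s. Im ((s *\<^sub>R v1) / base t)) = (*) a"
    by (rule ext) (simp add: a_def scaleR_conv_of_real times_divide_eq_right[symmetric] del: times_divide_eq_right)
  ultimately have dg: "(g has_real_derivative a) (at 0)"
    by (simp add: has_field_derivative_def)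
  have "((\<lambda>s. fst (c s)) \<longlongrightarrow> base t) (at 0)"
    using has_vector_derivative_continuous[OF d1] by (simp add: continuous_at c(3))
  then have "eventually (\<lambda>s. fst (c s) \<in> slit t) (at 0)"
    using topological_tendstoD[OF _ open_slit bs] by blast
  moreover have "eventually (\<lambda>s. s \<in> {-\<epsilon><..<\<epsilon>}) (at 0)"
    using c(1) by (intro eventually_at_in_open') auto
  ultimately have ev: "eventually (\<lambda>s. norm (fst (c s)) = cos (\<rho> (g s)) \<and> norm (snd (c s)) = sin (\<rho> (g s))
      \<and> fst (c s) = base (g s)) (at 0)"
  proof eventually_elim
    case (elim s)
    then have "(fst (c s), snd (c s)) \<in> M" using c(2) by auto
    then have n: "norm (fst (c s)) = cos (\<rho> (g s))" "norm (snd (c s)) = sin (\<rho> (g s))"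
      using mem_M_slit[OF elim(1), of "snd (c s)"] by (simp_all add: g_def)
    show ?case
      using arg_near_polar[OF elim(1), unfolded n(1)] n by (simp add: base_def g_def[symmetric])
  qed
  have "((\<lambda>s. base (g s)) has_vector_derivative a *\<^sub>R base' t) (at 0)"
    by (rule vector_diff_chain_at[of g a 0 base, unfolded o_def])
      (use dg has_vector_derivative_base g0 in \<open>auto simp: has_real_derivative_iff_has_vector_derivative\<close>)
  moreover have "eventually (\<lambda>s. fst (c s) = base (g s)) (nhds 0)"
    using ev by (auto simp: eventually_nhds_conv_at g0 c(3) elim: eventually_mono)
  then have "((\<lambda>s. base (g s)) has_vector_derivative v1) (at 0)"
    using d1 has_vector_derivative_cong_ev[where x = 0 and S = UNIV and f = "\<lambda>s. fst (c s)" and g = "\<lambda>s. base (g s)"]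
    by (simp add: eventually_mono g0 c(3))
  ultimately have v1: "v1 = a *\<^sub>R base' t"
    by (rule vector_derivative_unique_at[symmetric])
  have d3: "((\<lambda>s. (sin (\<rho> (g s)))\<^sup>2) has_real_derivative 2 * sin (\<rho> t) * cos (\<rho> t) * \<rho>' t * a) (at 0)"
    using g0 by (auto intro!: derivative_eq_intros DERIV_chain2[OF deriv] dg)
  have d4: "((\<lambda>s. snd (c s) \<bullet> snd (c s)) has_real_derivative 2 * (y \<bullet> v2)) (at 0)"
    unfolding has_real_derivative_iff_has_vector_derivative
    using bounded_bilinear.has_vector_derivative[OF bounded_bilinear_inner d2 d2]
    by (simp add: c(3) inner_commute)
  have ev2: "eventually (\<lambda>s. (sin (\<rho> (g s)))\<^sup>2 = snd (c s) \<bullet> snd (c s)) (nhds 0)"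
    using ev by (auto simp: eventually_nhds_conv_at g0 c(3) dot_square_norm y elim: eventually_mono)
  have yv: "2 * sin (\<rho> t) * cos (\<rho> t) * \<rho>' t * a = 2 * (y \<bullet> v2)"
    using d3 DERIV_unique[OF d4] by (simp add: DERIV_cong_ev[OF refl ev2 refl])
  define u where "u = v2 - (a * cos (\<rho> t) * \<rho>' t / sin (\<rho> t)) *\<^sub>R y"
  have "y \<bullet> u = 0"
    using yv sin_pos[of t]
    by (simp add: u_def inner_simps dot_square_norm y power2_eq_square field_simps)
  moreover have "v2 = (a * cos (\<rho> t) * \<rho>' t / sin (\<rho> t)) *\<^sub>R y + u" by (simp add: u_def)
  ultimately show "v \<in> ?T" using v v1 by blast
qed

text \<open>Up to the factor \<open>1 / N\<close>, the normal is \<open>\<rho>'\<close> times the unit vector \<open>i e\<^sup>i\<^sup>t\<close> minus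
  \<open>cos \<rho>\<close> times the derivative of \<open>(cos \<rho> e\<^sup>i\<^sup>t, sin \<rho> x)\<close> by \<open>\<rho>\<close>.\<close>

definition N :: "real \<Rightarrow> real" where
  "N t = sqrt ((cos (\<rho> t))\<^sup>2 + (\<rho>' t)\<^sup>2)"

lemma N_pos: "0 < N t" and N_sq: "(N t)\<^sup>2 = (cos (\<rho> t))\<^sup>2 + (\<rho>' t)\<^sup>2"
  using cos_pos[of t] by (simp_all add: N_def add_pos_nonneg)

text \<open>The coefficient of \<open>cis t\<close> in the normal is divided by
  \<open>cos \<rho>\<close>, so that it multiplies the planar component of the point itself. In this
  form the field extends off the hypersurface and can be differentiated in the ambient
  space.\<close>

definition \<alpha> :: "real \<Rightarrow> complex" where
  "\<alpha> t = Complex (sin (\<rho> t) / N t) (\<rho>' t / (N t * cos (\<rho> t)))"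

definition \<beta> :: "real \<Rightarrow> real" where
  "\<beta> t = (cos (\<rho> t))\<^sup>2 / (N t * sin (\<rho> t))"

text \<open>\<open>Arg\<close> makes the field a function of the point; the jump of
  \<open>Arg\<close> is harmless because \<open>\<alpha>\<close> and \<open>\<beta>\<close> are
  \<open>2 * pi\<close>-periodic.\<close>

definition \<nu> :: "complex \<times> (real ^ 'm) \<Rightarrow> complex \<times> (real ^ 'm)" where
  "\<nu> p = (\<alpha> (Arg (fst p)) * fst p, - \<beta> (Arg (fst p)) *\<^sub>R snd p)"

lemma N_periodic: "N (t + 2 * pi) = N t"
  by (simp add: N_def periodic deriv_periodic)

lemma \<alpha>_periodic: "\<alpha> (t + 2 * pi) = \<alpha> t" and \<beta>_periodic: "\<beta> (t + 2 * pi) = \<beta> t"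
  by (simp_all add: \<alpha>_def \<beta>_def periodic deriv_periodic N_periodic)

lemma \<nu>_polar:
  assumes "0 < r"
  shows "\<nu> (of_real r * cis t, y) = (\<alpha> t * (of_real r * cis t), - \<beta> t *\<^sub>R y)"
proof -
  have "of_real r * cis t \<noteq> 0" using assms by simp
  then have "cis (Arg (of_real r * cis t)) = sgn (of_real r * cis t)" by (rule cis_Arg)
  then have "cis (Arg (of_real r * cis t)) = cis t"
    using assms by (simp add: sgn_eq norm_mult)
  from cis_eq_imp_periodic[where f = \<alpha>, OF \<alpha>_periodic this]
    cis_eq_imp_periodic[where f = \<beta>, OF \<beta>_periodic this]
  show ?thesis by (simp add: \<nu>_def)
qed

lemma \<nu>_base: "\<nu> (base t, y) = (Complex (sin (\<rho> t) * cos (\<rho> t) / N t) (\<rho>' t / N t) * cis t, - \<beta> t *\<^sub>R y)"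
proof -
  have "\<alpha> t * of_real (cos (\<rho> t)) = Complex (sin (\<rho> t) * cos (\<rho> t) / N t) (\<rho>' t / N t)"
    using cos_pos[of t] by (simp add: \<alpha>_def complex_eq_iff)
  then show ?thesis unfolding base_def \<nu>_polar[OF cos_pos] by (simp flip: mult.assoc)
qed

lemma \<nu>_orthogonal_tangent:
  assumes "norm y = sin (\<rho> t)" "v \<in> tangent_vectors M (base t, y)"
  shows "\<nu> (base t, y) \<bullet> v = 0"
proof -
  obtain a u where v: "v = (a *\<^sub>R base' t, (a * cos (\<rho> t) * \<rho>' t / sin (\<rho> t)) *\<^sub>R y + u)" "y \<bullet> u = 0"
    using assms(2) unfolding tangent_vectors_M[OF assms(1)] by blast
  have "a * (S * C / n * (- S * p) + p / n * C) + - (C\<^sup>2 / (n * S)) * (a * C * p / S) * S\<^sup>2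
      = a * C * p * (1 - (S\<^sup>2 + C\<^sup>2)) / n" if "0 < n" "0 < S" for S C n p :: real
    using that by (simp add: field_simps power2_eq_square)
  from this[OF N_pos[of t] sin_pos[of t]] show ?thesis
    unfolding \<nu>_base v(1) base'_def inner_frame[OF v(2)] dot_square_norm assms(1) \<beta>_def inner_complex_def
    by (simp only: complex.sel sin_cos_squared_add diff_self mult_zero_right div_0)
qed

lemma unit_normal_field_\<nu>: "unit_normal_field M \<nu>"
  unfolding unit_normal_field_def
proof (intro ballI conjI)
  fix p :: "complex \<times> (real ^ 'm)"
  assume "p \<in> M"
  then obtain t y where p: "p = (base t, y)" and y: "norm y = sin (\<rho> t)"
    by (metis mem_M base_def surj_pair)
  have "\<nu> p \<bullet> \<nu> p = ((sin (\<rho> t) * cos (\<rho> t))\<^sup>2 + (\<rho>' t)\<^sup>2 + ((cos (\<rho> t))\<^sup>2)\<^sup>2) / (N t)\<^sup>2"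
    using N_pos[of t] sin_pos[of t] unfolding p \<nu>_base inner_prod_def fst_conv snd_conv inner_mult_cis
      inner_scaleR_left inner_scaleR_right
    unfolding dot_square_norm[of y] y
    by (simp add: inner_complex_def \<beta>_def field_simps power2_eq_square)
  also have "(sin (\<rho> t) * cos (\<rho> t))\<^sup>2 + (\<rho>' t)\<^sup>2 + ((cos (\<rho> t))\<^sup>2)\<^sup>2
      = (cos (\<rho> t))\<^sup>2 * ((sin (\<rho> t))\<^sup>2 + (cos (\<rho> t))\<^sup>2) + (\<rho>' t)\<^sup>2"
    by algebra
  also have "\<dots> / (N t)\<^sup>2 = 1" using N_pos[of t] by (simp flip: N_sq)
  finally show "norm (\<nu> p) = 1" by (simp add: norm_eq_1)
  show "\<nu> p \<bullet> p = 0"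
    using N_pos[of t] sin_pos[of t] unfolding p \<nu>_base
    unfolding base_def inner_prod_def fst_conv snd_conv inner_mult_cis inner_scaleR_left
    unfolding dot_square_norm[of y] y
    by (simp add: inner_complex_def \<beta>_def field_simps power2_eq_square)
  show "\<nu> p \<bullet> v = 0" if "v \<in> tangent_vectors M p" for v
    using \<nu>_orthogonal_tangent[OF y] that by (simp add: p)
qed

lemma points_toward_great_circle_\<nu>: "points_toward_great_circle M \<nu>"
  unfolding points_toward_great_circle_def
proof
  fix p :: "complex \<times> (real ^ 'm)"
  assume "p \<in> M"
  then obtain t y where p: "p = (base t, y)" and y: "norm y = sin (\<rho> t)"
    by (metis mem_M base_def surj_pair)
  have "0 < \<beta> t" "y \<noteq> 0" using N_pos[of t] sin_pos[of t] cos_pos[of t] y by (auto simp: \<beta>_def)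
  then show "snd (\<nu> p) \<bullet> snd p < 0" unfolding p \<nu>_base by simp
qed

text \<open>The second factor is the acceleration of a profile curve through
  \<open>(base t, y)\<close>. Its normal component is minus the inner product of the velocity with
  the derivative of \<open>\<nu>\<close> along it.\<close>

lemma inner_\<nu>_acceleration:
  assumes "norm y = sin (\<rho> t)"
  shows "\<nu> (base t, y) \<bullet> (base'' t, ((- sin (\<rho> t) * (\<rho>' t)\<^sup>2 + cos (\<rho> t) * \<rho>'' t) / sin (\<rho> t)) *\<^sub>R y)
    = - (cos (\<rho> t) * \<rho>'' t + sin (\<rho> t) * (cos (\<rho> t))\<^sup>2 + 2 * sin (\<rho> t) * (\<rho>' t)\<^sup>2) / N t"
proof -
  have gen: "S * C / n * (- C * p\<^sup>2 - S * q - C) + p / n * (- 2 * S * p)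
        + (- S * p\<^sup>2 + C * q) / S * (- (C\<^sup>2 / (n * S)) * S\<^sup>2)
      = - (C * q * (S\<^sup>2 + C\<^sup>2) + S * C\<^sup>2 + 2 * S * p\<^sup>2) / n" if "0 < n" "0 < S" for S C n p q :: real
    using that by (simp add: field_simps power2_eq_square)
  show ?thesis
    unfolding \<nu>_base base''_def inner_prod_def fst_conv snd_conv inner_mult_cis inner_scaleR_left
      inner_scaleR_right
    unfolding dot_square_norm[of y] assms \<beta>_def inner_complex_def
    using gen[OF N_pos[of t] sin_pos[of t], of "cos (\<rho> t)" "\<rho>' t" "\<rho>'' t"]
    by (simp only: complex.sel sin_cos_squared_add mult_1_right)
qed

text \<open>The first summand is the principal curvature along the profile, the second the
  contribution of the \<open>m - 1\<close> equal principal curvatures along the orbit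
  sphere.\<close>

definition mean_curv :: "real \<Rightarrow> real \<Rightarrow> real" where
  "mean_curv m t = - (cos (\<rho> t) * \<rho>'' t + sin (\<rho> t) * (cos (\<rho> t))\<^sup>2 + 2 * sin (\<rho> t) * (\<rho>' t)\<^sup>2) / N t ^ 3
    + (m - 1) * (cos (\<rho> t))\<^sup>2 / (N t * sin (\<rho> t))"

text \<open>The orthonormal basis is the normalized profile velocity together with a basis of the
  tangent space of the orbit sphere. Along the orbit the field multiplies \<open>y\<close> by the
  constant \<open>- \<beta> t\<close>, so only the profile direction needs a computation.\<close>

lemma has_mean_curvature_\<nu>:
  fixes y :: "real ^ 'm"
  assumes y: "norm y = sin (\<rho> t)"
  shows "has_mean_curvature M \<nu> (base t, y) (mean_curv (real CARD('m)) t)"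
proof -
  define S where "S s = sin (\<rho> s)" for s
  have y0: "y \<noteq> 0" using y sin_pos[of t] by auto
  have bs: "base t \<in> slit t"
    using slit_center[OF cos_pos] by (simp add: base_def)
  have at: "arg_near t (base t) = t"
    using arg_near_center[OF cos_pos] by (simp add: base_def)
  have "((\<lambda>x. (cos (\<rho> x))\<^sup>2 + (\<rho>' x)\<^sup>2) has_real_derivative
      - (2 * cos (\<rho> t) * sin (\<rho> t) * \<rho>' t) + 2 * \<rho>' t * \<rho>'' t) (at t)"
    by (auto intro!: derivative_eq_intros deriv deriv2)
  then have "\<exists>d. (N has_real_derivative d) (at t)"
    unfolding N_def[abs_def] using zero_less_power[OF N_pos[of t], of 2] N_sq[of t]
    by (intro exI) (rule DERIV_chain2[OF DERIV_real_sqrt], simp_all)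
  then obtain N' where dN: "(N has_real_derivative N') (at t)" by blast
  \<comment> \<open>Of these derivatives only the existence matters: in orbit directions they are
    multiplied by \<open>\<theta> 0 = 0\<close>, and in the profile direction the value comes from
    orthogonality.\<close>
  have "\<exists>d. (\<beta> has_real_derivative d) (at t)"
    unfolding \<beta>_def[abs_def] using sin_pos[of t] N_pos[of t]
    by (intro exI) (rule derivative_eq_intros deriv dN refl | simp)+
  then obtain \<beta>' where \<beta>': "(\<beta> has_real_derivative \<beta>') (at t)" by blast
  have "\<exists>d. ((\<lambda>t. sin (\<rho> t) / N t) has_real_derivative d) (at t)"
    using sin_pos[of t] N_pos[of t]
    by (intro exI) (rule derivative_eq_intros deriv dN refl | simp)+
  then obtain k1 where k1: "((\<lambda>t. sin (\<rho> t) / N t) has_real_derivative k1) (at t)" by blast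
  have "\<exists>d. ((\<lambda>t. \<rho>' t / (N t * cos (\<rho> t))) has_real_derivative d) (at t)"
    using cos_pos[of t] N_pos[of t]
    by (intro exI) (rule derivative_eq_intros deriv deriv2 dN refl | simp)+
  then obtain k2 where k2: "((\<lambda>t. \<rho>' t / (N t * cos (\<rho> t))) has_real_derivative k2) (at t)" by blast
  define \<alpha>' where "\<alpha>' = of_real k1 + \<i> * of_real k2"
  have \<alpha>': "(\<alpha> has_vector_derivative \<alpha>') (at t)"
    unfolding \<alpha>_def[abs_def] \<alpha>'_def Complex_eq using k1 k2 by (intro derivative_intros) auto
  define \<theta> where "\<theta> v = Im (v / base t)" for v
  define D where "D p = (\<alpha> t * fst p + (\<theta> (fst p) *\<^sub>R \<alpha>') * base t,
      (- \<beta> t) *\<^sub>R snd p + (- (\<theta> (fst p) * \<beta>')) *\<^sub>R y)" for p :: "complex \<times> (real ^ 'm)"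
  have D: "(\<nu> has_derivative D) (at (base t, y))"
  proof -
    have darg: "((\<lambda>p. arg_near t (fst p)) has_derivative (\<lambda>p. \<theta> (fst p))) (at (base t, y))"
      using has_derivative_compose[OF has_derivative_fst[OF has_derivative_ident], of "arg_near t" _ "(base t, y)"]
        has_derivative_arg_near[OF bs] by (simp add: \<theta>_def)
    have d\<alpha>: "((\<lambda>p. \<alpha> (arg_near t (fst p))) has_derivative (\<lambda>p. \<theta> (fst p) *\<^sub>R \<alpha>')) (at (base t, y))"
      using has_derivative_compose[OF darg, of \<alpha>] \<alpha>' by (simp add: at has_vector_derivative_def)
    have d\<beta>: "((\<lambda>p. - \<beta> (arg_near t (fst p))) has_derivative (\<lambda>p. - (\<theta> (fst p) * \<beta>'))) (at (base t, y))"
      using has_derivative_minus[OF has_derivative_compose[OF darg, of \<beta>]] \<beta>'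
      by (simp add: at has_real_derivative_iff_has_vector_derivative has_vector_derivative_def)
    have "((\<lambda>p. (\<alpha> (arg_near t (fst p)) * fst p, - \<beta> (arg_near t (fst p)) *\<^sub>R snd p)) has_derivative D) (at (base t, y))"
      unfolding D_def
      using has_derivative_Pair[OF has_derivative_mult[OF d\<alpha> has_derivative_fst[OF has_derivative_ident]]
          has_derivative_scaleR[OF d\<beta> has_derivative_snd[OF has_derivative_ident]]]
      by (simp add: at)
    then show ?thesis
    proof (rule has_derivative_transform_within_open)
      show "open (slit t \<times> (UNIV :: (real ^ 'm) set))" by (intro open_Times open_slit open_UNIV)
      show "(base t, y) \<in> slit t \<times> UNIV" using bs by simp
    next
      fix p :: "complex \<times> (real ^ 'm)" assume "p \<in> slit t \<times> UNIV"
      then have w: "fst p \<in> slit t" by auto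
      have "\<nu> (of_real (norm (fst p)) * cis (arg_near t (fst p)), snd p)
          = (\<alpha> (arg_near t (fst p)) * (of_real (norm (fst p)) * cis (arg_near t (fst p))),
             - \<beta> (arg_near t (fst p)) *\<^sub>R snd p)"
        using slit_nonzero[OF w] by (intro \<nu>_polar) simp
      then show "(\<alpha> (arg_near t (fst p)) * fst p, - \<beta> (arg_near t (fst p)) *\<^sub>R snd p) = \<nu> p"
        unfolding arg_near_polar[OF w, symmetric] by simp
    qed
  qed
  define P where "P s = (base s, (S s / S t) *\<^sub>R y)" for s
  define P' where "P' s = (base' s, (cos (\<rho> s) * \<rho>' s / S t) *\<^sub>R y)" for s
  define P'' where "P'' = (base'' t, ((- sin (\<rho> t) * (\<rho>' t)\<^sup>2 + cos (\<rho> t) * \<rho>'' t) / sin (\<rho> t)) *\<^sub>R y)"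
  have St: "0 < S s" for s by (simp add: S_def sin_pos)
  have Pt: "P t = (base t, y)" using St[of t] by (simp add: P_def)
  have scl: "((\<lambda>s. f s *\<^sub>R y) has_vector_derivative f' *\<^sub>R y) (at t)"
    if "(f has_real_derivative f') (at t)" for f f'
    using has_vector_derivative_scaleR[OF that has_vector_derivative_const[of y]] by simp
  have dP: "(P has_vector_derivative P' t) (at t)"
    unfolding P_def P'_def S_def
    by (intro has_vector_derivative_Pair has_vector_derivative_base scl)
      (use sin_pos[of t] in \<open>auto intro!: derivative_eq_intros deriv\<close>)
  have dP': "(P' has_vector_derivative P'') (at t)"
    unfolding P'_def P''_def S_def
    by (intro has_vector_derivative_Pair has_vector_derivative_base' scl)
      (use sin_pos[of t] in \<open>auto intro!: derivative_eq_intros deriv deriv2 simp: power2_eq_square\<close>)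
  \<comment> \<open>Differentiating this identity expresses \<open>D (P' t) \<bullet> P' t\<close> without the derivative of \<open>\<nu>\<close>.\<close>
  have orth: "\<nu> (P s) \<bullet> P' s = 0" for s
  proof -
    have n: "norm ((S s / S t) *\<^sub>R y) = sin (\<rho> s)"
      using y St[of s] St[of t] by (simp add: S_def abs_of_pos)
    have "P' s = (1 *\<^sub>R base' s, (1 * cos (\<rho> s) * \<rho>' s / sin (\<rho> s)) *\<^sub>R ((S s / S t) *\<^sub>R y) + 0)"
      using St[of s] by (simp add: P'_def S_def)
    then have "P' s \<in> tangent_vectors M (P s)"
      unfolding P_def tangent_vectors_M[OF n] using inner_zero_right by blast
    then show ?thesis unfolding P_def by (rule \<nu>_orthogonal_tangent[OF n])
  qed
  have linD: "linear D" using D by (rule has_derivative_linear)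
  have "((\<lambda>s. \<nu> (P s)) has_derivative (\<lambda>x. D (x *\<^sub>R P' t))) (at t)"
    using has_derivative_compose[OF dP[unfolded has_vector_derivative_def], of \<nu> D] D by (simp add: Pt)
  then have "((\<lambda>s. \<nu> (P s)) has_vector_derivative D (P' t)) (at t)"
    by (simp add: has_vector_derivative_def linear_cmul[OF linD])
  from bounded_bilinear.has_vector_derivative[OF bounded_bilinear_inner this dP']
  have "((\<lambda>s. 0) has_vector_derivative (\<nu> (P t) \<bullet> P'' + D (P' t) \<bullet> P' t)) (at t)"
    by (simp add: orth)
  then have "\<nu> (P t) \<bullet> P'' + D (P' t) \<bullet> P' t = 0"
    using vector_derivative_unique_at has_vector_derivative_const by blast
  then have DP: "D (P' t) \<bullet> P' t =
      (cos (\<rho> t) * \<rho>'' t + sin (\<rho> t) * (cos (\<rho> t))\<^sup>2 + 2 * sin (\<rho> t) * (\<rho>' t)\<^sup>2) / N t"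
    unfolding Pt P''_def inner_\<nu>_acceleration[OF y] by linarith
  have "- S * p * (- S * p) + C * C + C * p / S * (C * p / S * S\<^sup>2) = C\<^sup>2 + p\<^sup>2 * (S\<^sup>2 + C\<^sup>2)" if "0 < S" for S C p :: real
    using that by (simp add: field_simps power2_eq_square)
  from this[OF sin_pos[of t]] have nP: "P' t \<bullet> P' t = (N t)\<^sup>2"
    unfolding P'_def base'_def N_sq inner_prod_def fst_conv snd_conv inner_mult_cis inner_scaleR_left
      inner_scaleR_right
    unfolding dot_square_norm[of y] y S_def inner_complex_def
    by (simp only: complex.sel sin_cos_squared_add mult_1_right)
  obtain B0 where B0: "B0 \<subseteq> {u. y \<bullet> u = 0}" "pairwise orthogonal B0" "\<And>u. u \<in> B0 \<Longrightarrow> norm u = 1"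
    "independent B0" "card B0 = dim {u. y \<bullet> u = 0}" "span B0 = {u. y \<bullet> u = 0}"
    by (rule orthonormal_basis_subspace[OF subspace_hyperplane]) blast
  have card: "real (card B0) = real CARD('m) - 1"
    using B0(5) dim_hyperplane[OF y0] by (simp add: of_nat_diff)
  have fin: "finite B0" using B0(4) by (rule independent_imp_finite)
  define e1 where "e1 = inverse (N t) *\<^sub>R P' t"
  define B where "B = insert e1 (Pair 0 ` B0)"
  have Im_e1: "Im (fst e1 * cis (- t)) \<noteq> 0"
    using N_pos[of t] cos_pos[of t] by (simp add: e1_def P'_def base'_def cis_mult mult.assoc)
  have e1_notin: "e1 \<notin> Pair 0 ` B0" using Im_e1 by auto
  have P'u: "P' t \<bullet> (0, u) = 0" if "y \<bullet> u = 0" for u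
    using that by (simp add: P'_def)
  have "pairwise orthogonal B"
  proof -
    have "orthogonal e1 (0, u)" if "u \<in> B0" for u
      using P'u[of u] B0(1) that by (auto simp: orthogonal_def e1_def)
    moreover have "pairwise orthogonal (Pair 0 ` B0 :: (complex \<times> (real ^ 'm)) set)"
      using B0(2) by (auto simp: pairwise_def orthogonal_def)
    ultimately show ?thesis by (auto simp: B_def pairwise_insert orthogonal_commute)
  qed
  moreover have "\<forall>e\<in>B. norm e = 1"
    using B0(3) nP N_pos[of t] by (auto simp: B_def e1_def norm_eq_sqrt_inner norm_Pair power2_eq_square field_simps)
  moreover have "span B = tangent_vectors M (base t, y)"
  proof -
    have "linear (Pair 0 :: _ \<Rightarrow> complex \<times> (real ^ 'm))" by (intro linearI) auto
    then have sp: "span (Pair 0 ` B0) = Pair (0::complex) ` {u. y \<bullet> u = 0}"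
      by (simp add: linear_span_image B0(6))
    have eq: "(a *\<^sub>R base' t, (a * cos (\<rho> t) * \<rho>' t / sin (\<rho> t)) *\<^sub>R y + u) = (a * N t) *\<^sub>R e1 + (0, u)" for a u
      using N_pos[of t] by (simp add: e1_def P'_def S_def)
    show ?thesis
    proof (intro set_eqI iffI)
      fix v assume "v \<in> span B"
      then obtain k u where u: "v - k *\<^sub>R e1 = (0, u)" "y \<bullet> u = 0"
        unfolding B_def span_insert sp by blast
      then have "v = (k / N t * N t) *\<^sub>R e1 + (0, u)" using N_pos[of t] by (simp add: algebra_simps)
      then show "v \<in> tangent_vectors M (base t, y)"
        unfolding tangent_vectors_M[OF y] eq[symmetric] using u(2) by blast
    next
      fix v assume "v \<in> tangent_vectors M (base t, y)"
      then obtain a u where u: "v = (a * N t) *\<^sub>R e1 + (0, u)" "y \<bullet> u = 0"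
        unfolding tangent_vectors_M[OF y] eq by blast
      then have "v - (a * N t) *\<^sub>R e1 \<in> Pair 0 ` {u. y \<bullet> u = 0}" by auto
      then show "v \<in> span B" unfolding B_def span_insert sp by blast
    qed
  qed
  moreover have "mean_curv (real CARD('m)) t = - (\<Sum>e\<in>B. D e \<bullet> e)"
  proof -
    have "(\<Sum>e\<in>Pair 0 ` B0. D e \<bullet> e) = (\<Sum>u\<in>B0. D (0, u) \<bullet> (0, u))"
      by (subst sum.reindex) (auto simp: inj_on_def)
    also have "\<dots> = (\<Sum>u\<in>B0. - \<beta> t)"
      using B0(3) by (intro sum.cong) (auto simp: D_def \<theta>_def dot_square_norm)
    also have "\<dots> = - ((real CARD('m) - 1) * \<beta> t)" by (simp add: card)
    finally have "(\<Sum>e\<in>B. D e \<bullet> e) = D e1 \<bullet> e1 - (real CARD('m) - 1) * \<beta> t"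
      using fin e1_notin by (simp add: B_def)
    moreover have "D e1 \<bullet> e1 = D (P' t) \<bullet> P' t / (N t)\<^sup>2"
      using N_pos[of t] by (simp add: e1_def linear_cmul[OF linD] power2_eq_square field_simps)
    moreover define X where
      "X = cos (\<rho> t) * \<rho>'' t + sin (\<rho> t) * (cos (\<rho> t))\<^sup>2 + 2 * sin (\<rho> t) * (\<rho>' t)\<^sup>2"
    ultimately show ?thesis
      unfolding mean_curv_def DP X_def[symmetric] \<beta>_def
      by (simp add: power2_eq_square power3_eq_cube mult.assoc)
  qed
  moreover have "(\<nu> has_derivative D) (at (base t, y) within M)"
    using D by (rule has_derivative_at_withinI)
  ultimately show ?thesis unfolding has_mean_curvature_def by blast
qed

lemma has_constant_mean_curvature_M:
  assumes "\<And>t. mean_curv (real CARD('m)) t = h"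
  shows "has_constant_mean_curvature (M :: (complex \<times> (real ^ 'm)) set) h"
  unfolding has_constant_mean_curvature_def
proof (intro exI conjI ballI)
  fix p :: "complex \<times> (real ^ 'm)"
  assume "p \<in> M"
  then obtain t y where p: "p = (base t, y)" and y: "norm y = sin (\<rho> t)"
    by (metis mem_M base_def surj_pair)
  then show "has_mean_curvature M \<nu> p h"
    using has_mean_curvature_\<nu>[OF y] assms by simp
qed (rule unit_normal_field_\<nu> points_toward_great_circle_\<nu>)+

end

section \<open>The half period\<close>

text \<open>A one-dimensional Morse lemma: \<open>\<sigma>\<close> is a coordinate in which the well \<open>g\<close> becomes
  \<open>g x0 + \<sigma>\<^sup>2\<close>, and \<open>K\<close> is the derivative of the inverse coordinate change.\<close>

locale potential_well =
  fixes g g' :: "real \<Rightarrow> real" and x0 g2 :: real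
  assumes x0_pos: "0 < x0"
    and deriv_g: "0 < x \<Longrightarrow> (g has_real_derivative g' x) (at x)"
    and g'_zero: "g' x0 = 0"
    and g'_neg: "0 < x \<Longrightarrow> x < x0 \<Longrightarrow> g' x < 0"
    and g'_pos: "x0 < x \<Longrightarrow> 0 < g' x"
    and continuous_g': "continuous_on {0<..} g'"
    and deriv_g': "(g' has_real_derivative g2) (at x0)"
    and g2_pos: "0 < g2"
    and unbounded_left: "\<exists>x. 0 < x \<and> x < x0 \<and> B < g x"
    and unbounded_right: "\<exists>x>x0. B < g x"
begin

definition \<sigma> :: "real \<Rightarrow> real" where
  "\<sigma> x = sgn (x - x0) * sqrt (g x - g x0)"

definition K :: "real \<Rightarrow> real" where
  "K x = (if x = x0 then sqrt (2 / g2) else 2 * \<sigma> x / g' x)"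

definition m :: "real \<Rightarrow> real" where
  "m s = (THE x. 0 < x \<and> \<sigma> x = s)"

lemma g_above:
  assumes "0 < x" "x \<noteq> x0"
  shows "g x0 < g x"
proof (cases "x < x0")
  case True
  have "\<exists>y. (g has_real_derivative y) (at z) \<and> y < 0" if "x < z" "z < x0" for z
    using deriv_g[of z] g'_neg[of z] that assms by auto
  moreover have "continuous_on {x..x0} g"
    using assms by (auto intro!: continuous_at_imp_continuous_on DERIV_isCont[OF deriv_g])
  ultimately show ?thesis using DERIV_neg_imp_decreasing_open[OF True] by blast
next
  case False
  then have *: "x0 < x" using assms by simp
  have "\<exists>y. (g has_real_derivative y) (at z) \<and> y > 0" if "x0 < z" "z < x" for z
    using deriv_g[of z] g'_pos[of z] that x0_pos by auto
  moreover have "continuous_on {x0..x} g"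
    using x0_pos by (auto intro!: continuous_at_imp_continuous_on DERIV_isCont[OF deriv_g])
  ultimately show ?thesis using DERIV_pos_imp_increasing_open[OF *] by blast
qed

lemma \<sigma>_x0 [simp]: "\<sigma> x0 = 0"
  by (simp add: \<sigma>_def)

lemma \<sigma>_sq: "0 < x \<Longrightarrow> (\<sigma> x)\<^sup>2 = g x - g x0"
  using g_above[of x] by (auto simp: \<sigma>_def power_mult_distrib sgn_if)

lemma \<sigma>_pos: "x0 < x \<Longrightarrow> 0 < \<sigma> x" and \<sigma>_neg: "0 < x \<Longrightarrow> x < x0 \<Longrightarrow> \<sigma> x < 0"
  using g_above[of x] x0_pos by (auto simp: \<sigma>_def)

lemma K_pos: "0 < x \<Longrightarrow> 0 < K x"
  using g2_pos \<sigma>_pos[of x] \<sigma>_neg[of x] g'_pos[of x] g'_neg[of x]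
  by (cases x x0 rule: linorder_cases) (auto simp: K_def zero_less_divide_iff)

text \<open>This is the derivative of \<open>(\<sigma> x)^2 = g x - g x0\<close>, where
  \<open>\<sigma>\<close> has derivative \<open>1 / K\<close>; written as a product it also holds at
  \<open>x0\<close>.\<close>

lemma \<sigma>_eq: "0 < x \<Longrightarrow> 2 * \<sigma> x = g' x * K x"
  using g'_pos[of x] g'_neg[of x] by (cases x x0 rule: linorder_cases) (auto simp: K_def g'_zero)

lemma g'_quotient: "((\<lambda>x. g' x / (x - x0)) \<longlongrightarrow> g2) (at x0)"
  using deriv_g' by (simp add: has_field_derivative_iff g'_zero)

lemma ev_pos: "eventually (\<lambda>x. 0 < x \<and> x \<noteq> x0) (at x0)"
  using eventually_at_in_open'[of "{0<..}" x0] x0_pos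
  by (auto simp: eventually_conj_iff eventually_at_filter elim: eventually_mono)

text \<open>The second derivative is available only at the single point \<open>x0\<close>, so the
  Taylor coefficient is obtained from the quotient of \<open>g'\<close> by l'Hopital's rule.\<close>

lemma g_quotient: "((\<lambda>x. (g x - g x0) / (x - x0)\<^sup>2) \<longlongrightarrow> g2 / 2) (at x0)"
proof (rule lhopital)
  show "((\<lambda>x. g x - g x0) \<longlongrightarrow> 0) (at x0)"
    using DERIV_isCont[OF deriv_g[OF x0_pos]] by (simp add: isCont_def LIM_zero)
  show "((\<lambda>x. (x - x0)\<^sup>2) \<longlongrightarrow> 0) (at x0)"
    by (auto intro!: tendsto_eq_intros)
  show "\<forall>\<^sub>F x in at x0. (x - x0)\<^sup>2 \<noteq> 0" "\<forall>\<^sub>F x in at x0. 2 * (x - x0) \<noteq> 0"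
    using ev_pos by (auto elim: eventually_mono)
  show "\<forall>\<^sub>F x in at x0. ((\<lambda>x. g x - g x0) has_real_derivative g' x) (at x)"
    using ev_pos by (auto elim!: eventually_mono intro!: derivative_eq_intros deriv_g)
  show "\<forall>\<^sub>F x in at x0. ((\<lambda>x. (x - x0)\<^sup>2) has_real_derivative 2 * (x - x0)) (at x)"
    by (auto intro!: always_eventually derivative_eq_intros)
  show "((\<lambda>x. g' x / (2 * (x - x0))) \<longlongrightarrow> g2 / 2) (at x0)"
    using tendsto_mult[OF g'_quotient tendsto_const[of "1/2"]] by (simp add: field_simps)
qed

lemma \<sigma>_quotient: "((\<lambda>x. \<sigma> x / (x - x0)) \<longlongrightarrow> sqrt (g2 / 2)) (at x0)"
proof (rule Lim_transform_eventually)
  show "((\<lambda>x. sqrt ((g x - g x0) / (x - x0)\<^sup>2)) \<longlongrightarrow> sqrt (g2 / 2)) (at x0)"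
    by (intro tendsto_real_sqrt g_quotient)
  show "\<forall>\<^sub>F x in at x0. sqrt ((g x - g x0) / (x - x0)\<^sup>2) = \<sigma> x / (x - x0)"
    by (intro always_eventually) (auto simp: \<sigma>_def real_sqrt_divide sgn_if divide_simps)
qed

text \<open>Away from \<open>x0\<close> this is the chain rule. At \<open>x0\<close> the square root
  has a corner; the sign factor in \<open>\<sigma>\<close> straightens it into the slope
  \<open>sqrt (g2 / 2)\<close>.\<close>

lemma deriv_\<sigma>:
  assumes "0 < x"
  shows "(\<sigma> has_real_derivative inverse (K x)) (at x)"
proof (cases "x = x0")
  case True
  have "inverse (K x0) = sqrt (g2 / 2)" by (simp add: K_def flip: real_sqrt_inverse)
  then show ?thesis using \<sigma>_quotient True by (simp add: has_field_derivative_iff)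
next
  case False
  have "0 < g x - g x0" using g_above[OF assms False] by simp
  then have "((\<lambda>x. sgn (x - x0) * sqrt (g x - g x0)) has_real_derivative
      sgn (x - x0) * (inverse (sqrt (g x - g x0)) / 2 * g' x)) (at x)"
    if "((\<lambda>x. sgn (x - x0)) has_real_derivative 0) (at x)"
    using assms by (auto intro!: derivative_eq_intros that deriv_g)
  moreover have "((\<lambda>x. sgn (x - x0)) has_real_derivative 0) (at x)"
  proof (cases "x < x0")
    case True
    then show ?thesis
      by (intro has_field_derivative_transform_within_open[OF DERIV_const[of "-1"], of "{..<x0}"]) auto
  next
    case F: False
    then show ?thesis using False
      by (intro has_field_derivative_transform_within_open[OF DERIV_const[of "1"], of "{x0<..}"]) auto
  qed
  moreover have "sgn (x - x0) * (inverse (sqrt (g x - g x0)) / 2 * g' x) = inverse (K x)"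
    using False \<open>0 < g x - g x0\<close> by (auto simp: K_def \<sigma>_def field_simps sgn_if)
  ultimately show ?thesis unfolding \<sigma>_def[abs_def] by simp
qed

lemma continuous_\<sigma>: "continuous_on {0<..} \<sigma>"
  using deriv_\<sigma> by (auto intro!: continuous_at_imp_continuous_on DERIV_isCont)

text \<open>At \<open>x0\<close> numerator and denominator are both divided by
  \<open>x - x0\<close>; the limit is the value prescribed for \<open>K x0\<close>.\<close>

lemma continuous_K: "continuous_on {0<..} K"
proof (intro continuous_at_imp_continuous_on ballI)
  fix x :: real assume x: "x \<in> {0<..}"
  show "isCont K x"
  proof (cases "x = x0")
    case True
    have "((\<lambda>x. 2 * (\<sigma> x / (x - x0)) / (g' x / (x - x0))) \<longlongrightarrow> 2 * sqrt (g2 / 2) / g2) (at x0)"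
      using g2_pos by (intro tendsto_intros \<sigma>_quotient g'_quotient) simp
    moreover have "\<forall>\<^sub>F x in at x0. 2 * (\<sigma> x / (x - x0)) / (g' x / (x - x0)) = K x"
      using ev_pos by eventually_elim (auto simp: K_def)
    moreover have "2 * sqrt (g2 / 2) / g2 = sqrt (2 / g2)"
      using g2_pos by (intro real_sqrt_unique[symmetric])
        (simp_all add: power_divide power_mult_distrib power2_eq_square[of g2])
    ultimately have "(K \<longlongrightarrow> sqrt (2 / g2)) (at x0)"
      using Lim_transform_eventually by fastforce
    then show ?thesis using True by (simp add: isCont_def K_def)
  next
    case False
    have "g' x \<noteq> 0"
      using x False g'_pos[of x] g'_neg[of x] by (cases x x0 rule: linorder_cases) auto
    then have "isCont (\<lambda>x. 2 * \<sigma> x / g' x) x"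
      using x False continuous_on_interior[OF continuous_g', of x] DERIV_isCont[OF deriv_\<sigma>, of x]
        g'_pos[of x] g'_neg[of x]
      by (intro continuous_intros) (auto simp: interior_open)
    moreover have "\<forall>\<^sub>F y in nhds x. 2 * \<sigma> y / g' y = K y"
      by (rule eventually_mono[OF eventually_nhds_in_open[of "- {x0}" x]]) (use False in \<open>auto simp: K_def\<close>)
    ultimately show ?thesis by (simp add: isCont_cong)
  qed
qed

lemma \<sigma>_strict_mono:
  assumes "0 < x" "x < y"
  shows "\<sigma> x < \<sigma> y"
  using assms(2)
proof (rule DERIV_pos_imp_increasing)
  fix z assume "x \<le> z"
  then have "0 < z" using assms by simp
  then show "\<exists>d. (\<sigma> has_real_derivative d) (at z) \<and> 0 < d"
    using deriv_\<sigma>[of z] K_pos[of z] by (intro exI[of _ "inverse (K z)"]) simp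
qed

lemma \<sigma>_inj: "0 < x \<Longrightarrow> 0 < y \<Longrightarrow> \<sigma> x = \<sigma> y \<Longrightarrow> x = y"
  using \<sigma>_strict_mono[of x y] \<sigma>_strict_mono[of y x] by (cases x y rule: linorder_cases) auto

lemma \<sigma>_surj: "\<exists>x>0. \<sigma> x = s"
proof -
  obtain x1 where x1: "0 < x1" "x1 < x0" "g x0 + s\<^sup>2 < g x1" using unbounded_left by blast
  obtain x2 where x2: "x0 < x2" "g x0 + s\<^sup>2 < g x2" using unbounded_right by blast
  have "s\<^sup>2 < (\<sigma> x1)\<^sup>2" "s\<^sup>2 < (\<sigma> x2)\<^sup>2"
    using \<sigma>_sq[of x1] \<sigma>_sq[of x2] x1 x2 x0_pos by auto
  then have "\<bar>s\<bar> < \<bar>\<sigma> x1\<bar>" "\<bar>s\<bar> < \<bar>\<sigma> x2\<bar>" by (auto simp: power2_less_imp_less real_sqrt_less_iff simp flip: real_sqrt_abs)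
  then have "\<sigma> x1 \<le> s" "s \<le> \<sigma> x2"
    using \<sigma>_neg[of x1] \<sigma>_pos[of x2] x1 x2 by auto
  moreover have "continuous_on {x1..x2} \<sigma>"
    using continuous_\<sigma> by (rule continuous_on_subset) (use x1 in auto)
  ultimately obtain x where "x1 \<le> x" "\<sigma> x = s"
    using IVT'[of \<sigma> x1 s x2] x1 x2 by auto
  then show ?thesis using x1 by (intro exI[of _ x]) auto
qed

lemma m: "0 < m s" "\<sigma> (m s) = s"
proof -
  have "\<exists>!x. 0 < x \<and> \<sigma> x = s" using \<sigma>_surj \<sigma>_inj by blast
  from theI'[OF this] show "0 < m s" "\<sigma> (m s) = s" by (simp_all add: m_def)
qed

lemma m_\<sigma>: "0 < x \<Longrightarrow> m (\<sigma> x) = x"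
  using m \<sigma>_inj by blast

lemma g_m: "g (m s) = g x0 + s\<^sup>2"
  using \<sigma>_sq[OF m(1)] m(2) by (simp add: algebra_simps)

lemma m_0: "m 0 = x0"
  using m_\<sigma>[OF x0_pos] by simp

lemma m_less_iff: "m s < m t \<longleftrightarrow> s < t"
proof
  assume "m s < m t"
  from \<sigma>_strict_mono[OF m(1) this] show "s < t" unfolding m(2) .
next
  assume st: "s < t"
  show "m s < m t"
  proof (rule ccontr)
    assume "\<not> m s < m t"
    then consider "m s = m t" | "m t < m s" by linarith
    then show False
    proof cases
      case 1
      then show ?thesis using m(2)[of s] m(2)[of t] st by (metis less_irrefl)
    next
      case 2
      from \<sigma>_strict_mono[OF m(1) this] show ?thesis unfolding m(2) using st by simp
    qed
  qed
qed

lemma isCont_m: "isCont m s"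
proof -
  have z: "0 < z" if "\<bar>z - m s\<bar> \<le> m s / 2" for z
    using that m(1)[of s] by linarith
  have "isCont m (\<sigma> (m s))"
    by (rule isCont_inverse_function[where d = "m s / 2"])
      (use m(1)[of s] z in \<open>auto intro!: m_\<sigma> DERIV_isCont[OF deriv_\<sigma>]\<close>)
  then show ?thesis by (simp add: m)
qed

lemma deriv_m: "(m has_real_derivative K (m s)) (at s)"
proof -
  have "(m has_real_derivative inverse (inverse (K (m s)))) (at s)"
  proof (rule DERIV_inverse_function)
    show "(\<sigma> has_real_derivative inverse (K (m s))) (at (m s))" by (rule deriv_\<sigma>[OF m(1)])
    show "inverse (K (m s)) \<noteq> 0" using K_pos[OF m(1)[of s]] by simp
    show "s - 1 < s" "s < s + 1" by simp_all
    show "isCont m s" by (rule isCont_m)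
  qed (rule m(2))
  then show ?thesis by simp
qed

end

section \<open>The well attached to the unduloid problem\<close>

locale unduloid =
  fixes p :: nat and h :: real
  assumes p: "1 \<le> p" and h_pos: "0 < h" and h_less: "h < 1"
begin

definition "k = h / (real p + 1)"
definition "v \<mu> = k + 1 / \<mu> ^ Suc p"
definition "g \<mu> = \<mu>\<^sup>2 * (1 + (v \<mu>)\<^sup>2)"
text \<open>Since \<open>\<mu> v' = - (p + 1) (v - k)\<close> and \<open>(p + 1) k = h\<close>, the
  derivative of \<open>g\<close> is \<open>2 \<mu>\<close> times a quadratic in \<open>v\<close>, so
  the critical point is governed by the positive root \<open>vs\<close>.\<close>

definition "g' \<mu> = 2 * \<mu> * (1 + h * v \<mu> - p * (v \<mu>)\<^sup>2)"
definition "vs = (h + sqrt (h\<^sup>2 + 4 * p)) / (2 * p)"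
definition "\<mu>_of w = root (Suc p) (1 / (w - k))"
text \<open>The second derivative of \<open>g\<close> at its minimum: the quadratic factor of
  \<open>g'\<close> vanishes there, so only the derivative of that factor contributes.\<close>

definition "g2 = 2 * (real p + 1) * (vs - k) * (2 * p * vs - h)"

lemma k_mult: "(real p + 1) * k = h"
  by (simp add: k_def add_nonneg_eq_0_iff)

lemma k_pos: "0 < k"
  using h_pos by (simp add: k_def add_nonneg_pos)

lemma vs_pos: "0 < vs"
  using p h_pos by (simp add: vs_def add_pos_nonneg)

lemma vs_eq: "p * vs\<^sup>2 = 1 + h * vs"
proof -
  have "(2 * p * vs - h)\<^sup>2 = h\<^sup>2 + 4 * p"
    using p by (simp add: vs_def)
  then have "4 * real p * (p * vs\<^sup>2) = 4 * real p * (1 + h * vs)"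
    by (simp add: power2_eq_square algebra_simps)
  then show ?thesis using p by simp
qed

text \<open>The function \<open>v\<close> takes exactly the values above \<open>k\<close>, so this
  says that the critical value \<open>vs\<close> is attained. Otherwise
  \<open>p vs \<le> p k < h\<close>, which contradicts \<open>p vs^2 = 1 + h vs\<close>.\<close>

lemma k_less_vs: "k < vs"
proof (rule ccontr)
  assume "\<not> k < vs"
  then have "p * vs \<le> p * k" by (simp add: mult_left_mono)
  then have "p * vs \<le> h" using k_pos k_mult by (simp add: distrib_right)
  then have "(p * vs) * vs \<le> h * vs" using vs_pos by (simp add: mult_right_mono)
  then show False using vs_eq by (simp add: power2_eq_square)
qed

lemma h_vs: "h * vs < 2"
proof (rule ccontr)
  assume "\<not> h * vs < 2"
  then have "2 \<le> h * vs" by simp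
  moreover have "h * vs < 1 * vs" using h_less vs_pos by (intro mult_strict_right_mono)
  ultimately have "2 < vs" by simp
  then have "2 * vs < vs * vs" by simp
  moreover have "1 * vs\<^sup>2 \<le> p * vs\<^sup>2" using p by (intro mult_right_mono) auto
  ultimately show False using vs_eq \<open>h * vs < 1 * vs\<close> \<open>2 < vs\<close> unfolding power2_eq_square by linarith
qed

lemma v_gt_k: "0 < \<mu> \<Longrightarrow> k < v \<mu>"
  by (simp add: v_def)

lemma v_pos: "0 < \<mu> \<Longrightarrow> 0 < v \<mu>"
  using v_gt_k[of \<mu>] k_pos by linarith

lemma v_less_iff:
  assumes "0 < \<mu>" "0 < \<mu>'"
  shows "v \<mu> < v \<mu>' \<longleftrightarrow> \<mu>' < \<mu>"
proof -
  have "v \<mu> < v \<mu>' \<longleftrightarrow> \<mu>' ^ Suc p < \<mu> ^ Suc p"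
    using assms by (simp add: v_def frac_less_eq zero_less_mult_iff divide_less_cancel
        inverse_eq_divide[symmetric] del: power_Suc)
  also have "\<dots> \<longleftrightarrow> \<mu>' < \<mu>"
    using assms power_less_imp_less_base[of \<mu>' "Suc p" \<mu>] power_strict_mono[of \<mu>' \<mu> "Suc p"] by auto
  finally show ?thesis .
qed

lemma \<mu>_of_pos: "k < w \<Longrightarrow> 0 < \<mu>_of w"
  by (simp add: \<mu>_of_def)

lemma v_\<mu>_of: "k < w \<Longrightarrow> v (\<mu>_of w) = w"
  by (simp add: v_def \<mu>_of_def real_root_pow_pos2 del: power_Suc)

lemma deriv_v:
  assumes "0 < \<mu>"
  shows "(v has_real_derivative - ((real p + 1) * (v \<mu> - k) / \<mu>)) (at \<mu>)"
proof -
  have "((\<lambda>\<mu>. k + inverse (\<mu> ^ Suc p)) has_real_derivative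
      - (inverse (\<mu> ^ Suc p) * (real (Suc p) * \<mu> ^ p) * inverse (\<mu> ^ Suc p))) (at \<mu>)"
    using assms DERIV_pow[of "Suc p" \<mu> UNIV] by (auto intro!: derivative_eq_intros simp del: power_Suc)
  moreover have "inverse (\<mu> ^ Suc p) * (real (Suc p) * \<mu> ^ p) * inverse (\<mu> ^ Suc p) = (real p + 1) * (v \<mu> - k) / \<mu>"
    using assms by (simp add: v_def field_simps)
  ultimately show ?thesis by (simp add: v_def[abs_def] inverse_eq_divide)
qed

text \<open>The roots of \<open>p w^2 - h w - 1\<close> have product \<open>-1 / p\<close>, so the
  second one is \<open>-1 / (p vs)\<close>. For positive \<open>w\<close> the sign is therefore that
  of \<open>vs - w\<close>.\<close>

lemma quad_factor:
  fixes w :: real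
  shows "1 + h * w - real p * w\<^sup>2 = p * (vs - w) * (w + 1 / (p * vs))"
proof -
  have "p * (vs - w) * (1 / (p * vs)) = 1 - w / vs" using p vs_pos by (simp add: field_simps)
  moreover have "w * h = w * (p * vs) - w / vs"
  proof -
    have "h = p * vs - 1 / vs" using vs_eq vs_pos by (simp add: field_simps power2_eq_square)
    then have "w * h = w * (p * vs - 1 / vs)" by simp
    then show ?thesis by (simp add: algebra_simps)
  qed
  ultimately show ?thesis unfolding distrib_left by (simp add: algebra_simps power2_eq_square)
qed

sublocale potential_well g g' "\<mu>_of vs" g2
proof
  let ?x = "\<mu>_of vs"
  show x0: "0 < ?x" using \<mu>_of_pos k_less_vs by simp
  note vx = v_\<mu>_of[OF k_less_vs]
  show "(g has_real_derivative g' x) (at x)" if "0 < x" for x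
  proof -
    have "(g has_real_derivative 2 * x * (1 + (v x)\<^sup>2) + x\<^sup>2 * (2 * v x * - ((real p + 1) * (v x - k) / x))) (at x)"
      unfolding g_def[abs_def] using that by (auto intro!: derivative_eq_intros deriv_v)
    moreover have "x\<^sup>2 * (2 * v x * - ((real p + 1) * (v x - k) / x)) = - (2 * x * v x * ((real p + 1) * v x - (real p + 1) * k))"
      using that by (simp add: power2_eq_square field_simps)
    ultimately have D: "(g has_real_derivative 2 * x * (1 + (v x)\<^sup>2) + - (2 * x * v x * ((real p + 1) * v x - h))) (at x)"
      by (simp only: k_mult)
    show ?thesis by (rule DERIV_cong[OF D]) (simp add: g'_def algebra_simps power2_eq_square)
  qed
  show "g' ?x = 0" by (simp add: g'_def vx quad_factor)
  have pos: "0 < v x + 1 / (p * vs)" if "0 < x" for x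
    using v_pos[OF that] vs_pos p by (intro add_pos_pos) auto
  show "g' x < 0" if "0 < x" "x < ?x" for x
  proof -
    have "vs < v x" using v_less_iff[of ?x x] that x0 vx by simp
    then have "p * (vs - v x) * (v x + 1 / (p * vs)) < 0"
      using pos[OF that(1)] p by (intro mult_neg_pos mult_pos_neg) auto
    then show ?thesis using that unfolding g'_def quad_factor by (auto simp: mult_pos_neg)
  qed
  show "0 < g' x" if "?x < x" for x
  proof -
    have x: "0 < x" using x0 that by simp
    have "v x < vs" using v_less_iff[of x ?x] that x x0 vx by simp
    then have "0 < p * (vs - v x) * (v x + 1 / (p * vs))"
      using pos[OF x] p by (intro mult_pos_pos) auto
    then show ?thesis using x unfolding g'_def quad_factor by simp
  qed
  have "continuous_on {0<..} v"
    using deriv_v by (auto intro!: continuous_at_imp_continuous_on DERIV_isCont)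
  then show "continuous_on {0<..} g'"
    unfolding g'_def by (intro continuous_intros)
  have "(g' has_real_derivative 2 * (1 + h * v ?x - p * (v ?x)\<^sup>2)
      + 2 * ?x * (h * - ((real p + 1) * (v ?x - k) / ?x) - p * (2 * v ?x * - ((real p + 1) * (v ?x - k) / ?x)))) (at ?x)"
    unfolding g'_def[abs_def] using x0 by (auto intro!: derivative_eq_intros deriv_v simp: mult_ac)
  then show "(g' has_real_derivative g2) (at ?x)"
    by (rule DERIV_cong) (use x0 in \<open>simp add: vx quad_factor g2_def field_simps\<close>)
  have "2 * p * vs - h = sqrt (h\<^sup>2 + 4 * p)" using p by (simp add: vs_def)
  then show "0 < g2" using k_less_vs p by (simp add: g2_def add_nonneg_pos)
  show "\<exists>x. 0 < x \<and> x < ?x \<and> B < g x" for B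
  proof -
    \<comment> \<open>Near 0 the term \<open>1 / x ^ Suc p\<close> dominates: for
      \<open>x \<le> 1\<close> the square of \<open>v x\<close> is at least \<open>1 / x^3\<close>,
      so \<open>g x \<ge> 1 / x\<close>, and this \<open>x\<close> makes \<open>1 / x\<close> exceed
      \<open>B\<close>.\<close>
    define x where "x = min (?x / 2) (1 / (2 + \<bar>B\<bar>))"
    have x: "0 < x" "x < ?x" "x \<le> 1 / (2 + \<bar>B\<bar>)" using x0 by (auto simp: x_def min_def)
    have "1 / (2 + \<bar>B\<bar>) \<le> 1" by simp
    then have x1: "x \<le> 1" using x(3) by linarith
    have "B < 2 + \<bar>B\<bar>" by simp
    also have "\<dots> \<le> 1 / x" using x by (simp add: field_simps)
    also have "\<dots> = x\<^sup>2 * (1 / x ^ 3)" using x by (simp add: power2_eq_square power3_eq_cube)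
    also have "1 / x ^ 3 \<le> (v x)\<^sup>2"
    proof -
      have "x ^ (2 * Suc p) \<le> x ^ 3" using x x1 p by (intro power_decreasing) auto
      then have "1 / x ^ 3 \<le> 1 / x ^ (2 * Suc p)" using x by (intro divide_left_mono) auto
      also have "\<dots> = (1 / x ^ Suc p)\<^sup>2" by (simp only: power_divide power_one power_mult[symmetric] mult.commute[of 2])
      also have "\<dots> \<le> (v x)\<^sup>2" using x k_pos by (intro power_mono) (auto simp: v_def simp del: power_Suc)
      finally show ?thesis .
    qed
    also have "x\<^sup>2 * (v x)\<^sup>2 \<le> g x" by (simp add: g_def distrib_left)
    finally show ?thesis using x by (auto simp: mult_left_mono)
  qed
  show "\<exists>x > ?x. B < g x" for B
  proof (intro exI conjI)
    show "?x < ?x + \<bar>B\<bar> + 1" by simp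
    have "B < ?x + \<bar>B\<bar> + 1" using x0 by simp
    also have "\<dots> \<le> (?x + \<bar>B\<bar> + 1)\<^sup>2"
      using x0 by (intro self_le_power) auto
    also have "\<dots> \<le> g (?x + \<bar>B\<bar> + 1)" by (simp add: g_def distrib_left)
    finally show "B < g (?x + \<bar>B\<bar> + 1)" .
  qed
qed

section \<open>The half period as a function of the amplitude\<close>

abbreviation "x0 \<equiv> \<mu>_of vs"
abbreviation "g0 \<equiv> g x0"

text \<open>The density of \<open>- d(arctan v)\<close> with respect to the Morse coordinate
  \<open>s = \<sigma> \<mu>\<close>.\<close>

definition "\<kappa> \<mu> = (real p + 1) * (v \<mu> - k) * K \<mu> / (\<mu> * (1 + (v \<mu>)\<^sup>2))"

text \<open>If \<open>1 / c^2 = g0 + a^2\<close> and \<open>s = a sin \<phi>\<close>, then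
  \<open>1 - c^2 g = (c a cos \<phi>)^2\<close>; its root cancels against
  \<open>ds = a cos \<phi> d\<phi>\<close>, and the factor \<open>1 / c\<close> remains in
  front.\<close>

definition "period a = sqrt (g0 + a\<^sup>2) * integral {- (pi / 2)..pi / 2} (\<lambda>\<phi>. \<kappa> (m (a * sin \<phi>)))"

lemma g0_pos: "0 < g0"
  using x0_pos by (simp add: g_def add_pos_nonneg)

lemma v_sq_pos: "0 < 1 + (v \<mu>)\<^sup>2"
  by (simp add: add_pos_nonneg)

lemma \<kappa>_pos: "0 < \<mu> \<Longrightarrow> 0 < \<kappa> \<mu>"
  using v_gt_k[of \<mu>] K_pos[of \<mu>] v_sq_pos[of \<mu>] by (simp add: \<kappa>_def add_nonneg_pos)

lemma isCont_v_m: "isCont (\<lambda>s. v (m s)) s"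
  by (rule isCont_o2[OF isCont_m DERIV_isCont[OF deriv_v[OF m(1)]]])

lemma isCont_K_m: "isCont (\<lambda>s. K (m s)) s"
  using isCont_o2[OF isCont_m, where g = K] continuous_on_interior[OF continuous_K, of "m s"] m(1)[of s]
  by (simp add: interior_open)

lemma isCont_\<kappa>_m: "isCont (\<lambda>s. \<kappa> (m s)) s"
  unfolding \<kappa>_def using m(1)[of s] v_sq_pos[of "m s"]
  by (intro continuous_intros isCont_v_m isCont_K_m isCont_m) auto

lemma deriv_arctan_v: "((\<lambda>s. arctan (v (m s))) has_real_derivative - \<kappa> (m s)) (at s)"
  using m(1)[of s] v_sq_pos[of "m s"] unfolding \<kappa>_def
  by (auto intro!: derivative_eq_intros DERIV_chain2[OF deriv_v] deriv_m simp: field_simps)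

text \<open>Solving \<open>2 s = g' K\<close> for \<open>K\<close> writes
  \<open>|s| \<kappa>\<close> as a function of \<open>v\<close> times \<open>s^2 / g\<close>, and
  the latter is at most 1 because \<open>s^2 = g - g0\<close>. The function of \<open>v\<close>
  vanishes at both ends: for \<open>v\<close> near \<open>k\<close> (large \<open>s\<close>) through
  its numerator, for large \<open>v\<close> (very negative \<open>s\<close>) because its denominator
  is quadratic.\<close>

lemma decay:
  assumes "0 < \<epsilon>"
  shows "\<exists>S>0. \<forall>s. S \<le> \<bar>s\<bar> \<longrightarrow> \<bar>s\<bar> * \<kappa> (m s) \<le> \<epsilon>"
proof -
  have bound: "\<bar>s\<bar> * \<kappa> (m s) \<le> (real p + 1) * (v (m s) - k) / (p * \<bar>vs - v (m s)\<bar> * v (m s))"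
    if "v (m s) \<noteq> vs" "s \<noteq> 0" for s
  proof -
    define \<mu> where "\<mu> = m s"
    have \<mu>: "0 < \<mu>" by (simp add: \<mu>_def m)
    note w = v_pos[OF \<mu>] v_gt_k[OF \<mu>] v_sq_pos[of \<mu>]
    define q where "q = p * \<bar>vs - v \<mu>\<bar> * (v \<mu> + 1 / (p * vs))"
    have q: "\<bar>g' \<mu>\<bar> = 2 * \<mu> * q"
    proof -
      have "g' \<mu> = 2 * \<mu> * (p * (vs - v \<mu>) * (v \<mu> + 1 / (p * vs)))"
        by (simp only: g'_def quad_factor)
      moreover have "0 < v \<mu> + 1 / (p * vs)" using w vs_pos by (simp add: add_pos_nonneg)
      ultimately show ?thesis using \<mu> by (simp add: q_def abs_mult)
    qed
    have le: "p * \<bar>vs - v \<mu>\<bar> * v \<mu> \<le> q" unfolding q_def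
      using vs_pos by (intro mult_left_mono) auto
    have pos: "0 < p * \<bar>vs - v \<mu>\<bar> * v \<mu>" using that w p by (simp add: \<mu>_def)
    have s2: "s\<^sup>2 \<le> \<mu>\<^sup>2 * (1 + (v \<mu>)\<^sup>2)" using g_m[of s] g0_pos by (simp add: g_def \<mu>_def)
    have "2 * \<bar>s\<bar> = 2 * \<mu> * q * K \<mu>"
    proof -
      have "\<bar>2 * s\<bar> = \<bar>g' \<mu>\<bar> * \<bar>K \<mu>\<bar>" using \<sigma>_eq[OF \<mu>] by (simp add: \<mu>_def m abs_mult[symmetric])
      then show ?thesis using K_pos[OF \<mu>] q by (simp add: abs_mult)
    qed
    then have K: "K \<mu> = \<bar>s\<bar> / (\<mu> * q)" using \<mu> le pos by (simp add: field_simps)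
    have "\<bar>s\<bar> * \<kappa> \<mu> = (real p + 1) * (v \<mu> - k) / q * (s\<^sup>2 / (\<mu>\<^sup>2 * (1 + (v \<mu>)\<^sup>2)))"
    proof -
      have "r * ((real p + 1) * (v \<mu> - k) * (r / (\<mu> * q)) / (\<mu> * (1 + (v \<mu>)\<^sup>2)))
          = (real p + 1) * (v \<mu> - k) / q * (r\<^sup>2 / (\<mu>\<^sup>2 * (1 + (v \<mu>)\<^sup>2)))" for r
        by (simp add: power2_eq_square mult_ac)
      from this[of "\<bar>s\<bar>"] show ?thesis unfolding \<kappa>_def K by simp
    qed
    also have "\<dots> \<le> (real p + 1) * (v \<mu> - k) / q * 1"
      using s2 w \<mu> le pos by (intro mult_left_mono) (auto simp: divide_le_eq)
    also have "\<dots> \<le> (real p + 1) * (v \<mu> - k) / (p * \<bar>vs - v \<mu>\<bar> * v \<mu>)"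
      using w le pos by (simp add: frac_le)
    finally show ?thesis by (simp add: \<mu>_def)
  qed
  have p2: "real p + 1 \<le> 2 * p" using p by simp
  \<comment> \<open>Thresholds for the two ends: the bound is at most \<open>4 / v\<close> when
    \<open>v > V\<close>, and at most \<open>4 \<delta> / ((vs - k) k)\<close> when
    \<open>v < k + \<delta>\<close>; both are at most \<open>\<epsilon>\<close>. Since
    \<open>m\<close> increases and \<open>v\<close> decreases, \<open>S\<close> below turns them
    into a condition on \<open>|s|\<close>.\<close>
  define V where "V = max (2 * vs) (4 / \<epsilon>)"
  define \<delta> where "\<delta> = min ((vs - k) / 2) (\<epsilon> * k * (vs - k) / 4)"
  have V: "k < V" "2 * vs \<le> V" "4 / \<epsilon> \<le> V" using k_less_vs vs_pos by (auto simp: V_def)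
  have \<delta>: "0 < \<delta>" "\<delta> \<le> (vs - k) / 2" "\<delta> \<le> \<epsilon> * k * (vs - k) / 4"
    unfolding \<delta>_def by (use k_less_vs k_pos assms in simp, rule min.cobounded1, rule min.cobounded2)
  define S where "S = \<bar>\<sigma> (\<mu>_of V)\<bar> + \<bar>\<sigma> (\<mu>_of (k + \<delta>))\<bar> + 1"
  have "\<bar>s\<bar> * \<kappa> (m s) \<le> \<epsilon>" if s: "S \<le> \<bar>s\<bar>" for s
  proof (cases "0 < s")
    case True
    have "\<sigma> (\<mu>_of (k + \<delta>)) < s" using s True by (simp add: S_def)
    then have "m (\<sigma> (\<mu>_of (k + \<delta>))) < m s" by (simp add: m_less_iff)
    then have "\<mu>_of (k + \<delta>) < m s" using \<delta> by (simp add: m_\<sigma> \<mu>_of_pos)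
    then have "v (m s) < v (\<mu>_of (k + \<delta>))"
      using v_less_iff[of "m s" "\<mu>_of (k + \<delta>)"] \<delta> m(1)[of s] by (simp add: \<mu>_of_pos)
    then have w: "v (m s) < k + \<delta>" using \<delta> by (simp add: v_\<mu>_of)
    then have w2: "(vs - k) / 2 \<le> vs - v (m s)" using \<delta>(2) by (simp add: field_simps)
    moreover have "0 < (vs - k) / 2" using k_less_vs by simp
    ultimately have "v (m s) < vs" by (metis diff_gt_0_iff_gt less_le_trans)
    then have "\<bar>s\<bar> * \<kappa> (m s) \<le> (real p + 1) * (v (m s) - k) / (p * (vs - v (m s)) * v (m s))"
      using bound[of s] True by simp
    also have "\<dots> \<le> (2 * p) * \<delta> / (p * ((vs - k) / 2) * k)"
      using w w2 p2 v_gt_k[OF m(1)[of s]] k_less_vs k_pos p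
      by (intro frac_le mult_mono mult_nonneg_nonneg mult_pos_pos) auto
    also have "\<dots> = 4 * \<delta> / ((vs - k) * k)"
    proof -
      have "(2 * P) * \<delta> / (P * (X / 2) * k) = 4 * \<delta> / (X * k)" if "P \<noteq> 0" for P X :: real
        using that by (simp add: field_simps)
      then show ?thesis using p by simp
    qed
    also have "\<dots> \<le> \<epsilon>" using \<delta>(3) k_less_vs k_pos by (simp add: divide_le_eq mult_ac)
    finally show ?thesis .
  next
    case False
    have "s < \<sigma> (\<mu>_of V)" using s False by (simp add: S_def)
    then have "m s < m (\<sigma> (\<mu>_of V))" by (simp add: m_less_iff)
    then have "m s < \<mu>_of V" using V by (simp add: m_\<sigma> \<mu>_of_pos)
    then have "v (\<mu>_of V) < v (m s)"
      using v_less_iff[of "\<mu>_of V" "m s"] V m(1)[of s] by (simp add: \<mu>_of_pos)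
    then have w: "V < v (m s)" using V by (simp add: v_\<mu>_of)
    then have w2: "v (m s) / 2 \<le> v (m s) - vs" using V by simp
    have w0: "0 < v (m s)" "vs < v (m s)" using v_pos[OF m(1)[of s]] V w vs_pos by auto
    have "s \<noteq> 0" using s by (auto simp: S_def)
    then have "\<bar>s\<bar> * \<kappa> (m s) \<le> (real p + 1) * (v (m s) - k) / (p * (v (m s) - vs) * v (m s))"
      using bound[of s] w0 by simp
    also have "\<dots> \<le> (2 * p) * v (m s) / (p * (v (m s) / 2) * v (m s))"
      using w2 p2 v_gt_k[OF m(1)[of s]] k_pos p w0
      by (intro frac_le mult_mono mult_nonneg_nonneg mult_pos_pos) auto
    also have "\<dots> = 4 / v (m s)" using p w0 by (simp add: field_simps)
    also have "\<dots> \<le> 4 / V" using w w0 V(1) k_pos by (intro divide_left_mono) auto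
    also have "\<dots> \<le> \<epsilon>" using V(1,3) k_pos assms by (simp add: divide_le_eq mult.commute)
    finally show ?thesis .
  qed
  moreover have "0 < S" by (simp add: S_def add_nonneg_pos)
  ultimately show ?thesis by blast
qed

lemma continuous_period: "continuous_on UNIV period"
proof -
  have "continuous_on (UNIV \<times> {- (pi / 2)..pi / 2}) (\<lambda>(a, \<phi>). \<kappa> (m (a * sin \<phi>)))"
    unfolding split_beta
    by (rule continuous_on_compose2[where f = "\<lambda>q. fst q * sin (snd q)" and g = "\<lambda>s. \<kappa> (m s)" and t = UNIV])
      (auto intro!: continuous_intros continuous_at_imp_continuous_on isCont_\<kappa>_m)
  then have "continuous_on UNIV (\<lambda>a. integral (cbox (- (pi / 2)) (pi / 2)) (\<lambda>\<phi>. \<kappa> (m (a * sin \<phi>))))"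
    by (intro integral_continuous_on_param) simp
  then show ?thesis
    unfolding period_def[abs_def] by (intro continuous_intros) (simp add: cbox_interval)
qed

text \<open>At \<open>a = 0\<close> the integrand is the constant \<open>\<kappa> x0\<close>, so
  everything is explicit: \<open>K x0 = sqrt (2 / g2)\<close> and the equation of \<open>vs\<close>
  reduce the value to \<open>pi / sqrt (2 + h vs)\<close>.\<close>

lemma period_0: "pi / 2 < period 0"
proof -
  define y where "y = (real p + 1) * (vs - k)"
  have "vs * y = 1 + vs\<^sup>2"
    using vs_eq unfolding y_def right_diff_distrib k_mult by (simp add: algebra_simps power2_eq_square)
  then have y: "y = (1 + vs\<^sup>2) / vs" using vs_pos by (simp add: field_simps)
  have y0: "0 < y" using k_less_vs unfolding y_def by (intro mult_pos_pos) auto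
  have "vs * (2 * p * vs - h) = 2 + h * vs" using vs_eq by (simp add: algebra_simps power2_eq_square)
  then have z: "2 * p * vs - h = (2 + h * vs) / vs" using vs_pos by (simp add: field_simps)
  have vx: "v x0 = vs" by (rule v_\<mu>_of[OF k_less_vs])
  have s: "0 < 1 + vs\<^sup>2" by (simp add: add_pos_nonneg)
  have "g2 = 2 * y * ((2 + h * vs) / vs)" unfolding g2_def z y_def by simp
  have "period 0 = sqrt g0 * (pi * \<kappa> x0)" by (simp add: period_def m_0)
  also have "sqrt g0 = x0 * sqrt (1 + vs\<^sup>2)" using x0_pos by (simp add: g_def vx real_sqrt_mult)
  also have "\<kappa> x0 = y * sqrt (2 / g2) / (x0 * (1 + vs\<^sup>2))" by (simp add: \<kappa>_def K_def vx y_def)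
  also have "x0 * sqrt (1 + vs\<^sup>2) * (pi * (y * sqrt (2 / g2) / (x0 * (1 + vs\<^sup>2))))
      = pi * (y * sqrt (2 / g2) * sqrt (1 + vs\<^sup>2) / (1 + vs\<^sup>2))"
    using x0_pos by simp
  also have "y * sqrt (2 / g2) * sqrt (1 + vs\<^sup>2) / (1 + vs\<^sup>2) = sqrt (y\<^sup>2 * (2 / g2) * (1 + vs\<^sup>2) / (1 + vs\<^sup>2)\<^sup>2)"
    using y0 s by (simp add: real_sqrt_mult real_sqrt_divide)
  also have "y\<^sup>2 * (2 / g2) * (1 + vs\<^sup>2) / (1 + vs\<^sup>2)\<^sup>2 = 1 / (2 + h * vs)"
  proof -
    have "y\<^sup>2 * (2 / g2) * (1 + vs\<^sup>2) / (1 + vs\<^sup>2)\<^sup>2 = y * vs / ((2 + h * vs) * (1 + vs\<^sup>2))"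
      using y0 s vs_pos by (simp add: \<open>g2 = _\<close> power2_eq_square)
    also have "y * vs = 1 + vs\<^sup>2" using vs_pos by (simp add: y)
    finally show ?thesis using s by simp
  qed
  finally have "period 0 = pi * sqrt (1 / (2 + h * vs))" .
  moreover have "1 / 2 < sqrt (1 / (2 + h * vs))"
  proof (rule real_less_rsqrt)
    have "0 < 2 + h * vs" using h_pos vs_pos by (simp add: add_pos_pos)
    then show "(1 / 2)\<^sup>2 < 1 / (2 + h * vs)" using h_vs by (simp add: power2_eq_square field_simps)
  qed
  ultimately show ?thesis by (simp add: field_simps)
qed

lemma continuous_integrand: "continuous_on A (\<lambda>\<phi>. \<kappa> (m (a * sin \<phi>)))"
proof (intro continuous_at_imp_continuous_on ballI)
  show "isCont (\<lambda>\<phi>. \<kappa> (m (a * sin \<phi>))) \<phi>" for \<phi>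
    by (rule isCont_o2[where f = "\<lambda>\<phi>. a * sin \<phi>" and g = "\<lambda>s. \<kappa> (m s)"])
      (intro continuous_intros, rule isCont_\<kappa>_m)
qed

text \<open>\<open>\<kappa>(m s) ds\<close> is a finite measure, of total mass \<open>\<pi>/2 - arctan k < \<pi>/2\<close>, and
  \<open>s \<kappa>(m s)\<close> vanishes at infinity. Hence, as \<open>a\<close> grows, only the part of the integral near
  \<open>\<phi> = 0\<close> survives.\<close>

lemma period_large: "\<exists>a>0. period a < pi / 2"
proof -
  define A where "A = pi / 2 - arctan k"
  have A: "0 < A" "A < pi / 2" using k_pos arctan_bounded[of k] by (auto simp: A_def)
  \<comment> \<open>The gap between \<open>A\<close> and \<open>pi / 2\<close> is cut into thirds:
    one pays for dropping the factor \<open>cos \<phi>\<close>, one for the tail, and one for the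
    factor \<open>sqrt (g0 / a^2 + 1)\<close>.\<close>
  define A2 where "A2 = A + (pi / 2 - A) / 3"
  define A3 where "A3 = A + 2 * (pi / 2 - A) / 3"
  have A2: "A < A2" "A2 < A3" "A3 < pi / 2" using A by (auto simp: A2_def A3_def field_simps)
  \<comment> \<open>On the interval, \<open>|sin \<phi>| \<le> \<theta>\<close> means
    \<open>cos \<phi> \<ge> A / A2\<close>, so inserting the cosine there costs at most the factor
    \<open>A2 / A\<close>.\<close>
  define \<theta> where "\<theta> = sqrt (1 - (A / A2)\<^sup>2)"
  have "(A / A2)\<^sup>2 < 1" using A A2 by (simp add: power_less_one_iff abs_square_less_1)
  then have \<theta>: "0 < \<theta>" "\<theta>\<^sup>2 = 1 - (A / A2)\<^sup>2" by (auto simp: \<theta>_def)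
  \<comment> \<open>Outside that region \<open>f\<close> will be at most
    \<open>\<epsilon> / \<theta>\<close>; over an interval of length \<open>pi\<close> this
    contributes at most \<open>A3 - A2\<close>.\<close>
  define \<epsilon> where "\<epsilon> = \<theta> * (A3 - A2) / pi"
  have \<epsilon>: "0 < \<epsilon>" using \<theta> A2 by (simp add: \<epsilon>_def)
  obtain S where S: "0 < S" "\<And>s. S \<le> \<bar>s\<bar> \<Longrightarrow> \<bar>s\<bar> * \<kappa> (m s) \<le> \<epsilon>" using decay[OF \<epsilon>] by blast
  have "((\<lambda>a. sqrt (g0 / a\<^sup>2 + 1) * A3) \<longlongrightarrow> sqrt (0 + 1) * A3) at_top"
    by (intro tendsto_intros tendsto_divide_0[OF tendsto_const] filterlim_at_top_imp_at_infinity
        filterlim_pow_at_top filterlim_ident) auto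
  then have "\<forall>\<^sub>F a in at_top. sqrt (g0 / a\<^sup>2 + 1) * A3 < pi / 2"
    using A2(3) by (intro order_tendstoD(2)) auto
  moreover have "\<forall>\<^sub>F a in at_top. S / \<theta> < (a :: real)" by (rule eventually_gt_at_top)
  ultimately have "\<forall>\<^sub>F a in at_top. sqrt (g0 / a\<^sup>2 + 1) * A3 < pi / 2 \<and> S / \<theta> < a" by (rule eventually_conj)
  then obtain a where a: "sqrt (g0 / a\<^sup>2 + 1) * A3 < pi / 2" "S / \<theta> < a"
    using eventually_happens'[OF trivial_limit_at_top_linorder] by blast
  have a0: "0 < a" using a(2) divide_pos_pos[OF S(1) \<theta>(1)] by linarith
  define f where "f \<phi> = a * \<kappa> (m (a * sin \<phi>))" for \<phi>
  have f_pos: "0 < f \<phi>" for \<phi> using a0 \<kappa>_pos[OF m(1)] by (simp add: f_def)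
  have le: "f \<phi> \<le> A2 / A * (f \<phi> * cos \<phi>) + \<epsilon> / \<theta>" if \<phi>: "\<phi> \<in> {- (pi / 2)..pi / 2}" for \<phi>
  proof (cases "\<bar>sin \<phi>\<bar> \<le> \<theta>")
    case True
    have "0 \<le> cos \<phi>" using \<phi> by (intro cos_ge_zero) auto
    have "\<bar>sin \<phi>\<bar> \<le> \<bar>\<theta>\<bar>" using True by simp
    then have "(sin \<phi>)\<^sup>2 \<le> \<theta>\<^sup>2" by (simp only: abs_le_square_iff)
    then have "(A / A2)\<^sup>2 \<le> (cos \<phi>)\<^sup>2" using \<theta>(2) by (simp add: cos_squared_eq)
    then have "A / A2 \<le> cos \<phi>" using \<open>0 \<le> cos \<phi>\<close> by (rule power2_le_imp_le)
    then have "1 \<le> A2 / A * cos \<phi>" using A A2 by (simp add: field_simps)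
    then have "f \<phi> * 1 \<le> f \<phi> * (A2 / A * cos \<phi>)" using f_pos[of \<phi>] by (intro mult_left_mono) auto
    moreover have "0 < \<epsilon> / \<theta>" using \<epsilon> \<theta> by simp
    ultimately show ?thesis by (simp add: mult_ac)
  next
    case False
    then have s: "\<theta> < \<bar>sin \<phi>\<bar>" by simp
    have "S \<le> a * \<theta>" using a(2) \<theta>(1) by (simp add: field_simps)
    also have "\<dots> \<le> \<bar>a * sin \<phi>\<bar>" using s a0 by (simp add: abs_mult)
    finally have "\<bar>a * sin \<phi>\<bar> * \<kappa> (m (a * sin \<phi>)) \<le> \<epsilon>" by (rule S(2))
    then have "f \<phi> * \<bar>sin \<phi>\<bar> \<le> \<epsilon>" using a0 by (simp add: f_def abs_mult mult_ac)
    moreover have "f \<phi> * \<theta> \<le> f \<phi> * \<bar>sin \<phi>\<bar>" using s f_pos[of \<phi>] by (intro mult_left_mono) auto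
    ultimately have "f \<phi> \<le> \<epsilon> / \<theta>" using \<theta>(1) by (simp add: field_simps)
    moreover have "0 \<le> cos \<phi>" using \<phi> by (intro cos_ge_zero) auto
    then have "0 \<le> A2 / A * (f \<phi> * cos \<phi>)" using A A2 f_pos[of \<phi>] by simp
    ultimately show ?thesis by simp
  qed
  have cf: "continuous_on B f" for B
    unfolding f_def by (intro continuous_intros continuous_integrand)
  \<comment> \<open>With the cosine the integrand is exact, so its integral is a difference of two
    arctangents, bounded by \<open>A\<close> whatever the amplitude.\<close>
  have D: "((\<lambda>\<phi>. - arctan (v (m (a * sin \<phi>)))) has_real_derivative f \<phi> * cos \<phi>) (at \<phi> within B)" for \<phi> B
  proof -
    have "((\<lambda>\<phi>. a * sin \<phi>) has_real_derivative a * cos \<phi>) (at \<phi> within B)"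
      by (auto intro!: derivative_eq_intros)
    from DERIV_minus[OF DERIV_chain2[OF deriv_arctan_v this]]
    show ?thesis by (simp add: f_def mult_ac)
  qed
  have "((\<lambda>\<phi>. f \<phi> * cos \<phi>) has_integral (- arctan (v (m (a * sin (pi / 2)))) - - arctan (v (m (a * sin (- (pi / 2)))))))
      {- (pi / 2)..pi / 2}"
    by (rule fundamental_theorem_of_calculus)
      (auto intro!: D simp: has_real_derivative_iff_has_vector_derivative[symmetric])
  then have I: "((\<lambda>\<phi>. f \<phi> * cos \<phi>) has_integral (arctan (v (m (- a))) - arctan (v (m a)))) {- (pi / 2)..pi / 2}"
    by simp
  have "arctan (v (m (- a))) - arctan (v (m a)) \<le> A"
    using arctan_bounded[of "v (m (- a))"] arctan_monotone[OF v_gt_k[OF m(1)[of a]]] unfolding A_def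
    by linarith
  then have "A2 / A * (arctan (v (m (- a))) - arctan (v (m a))) \<le> A2 / A * A"
    using A A2 by (intro mult_left_mono) auto
  then have bd: "A2 / A * (arctan (v (m (- a))) - arctan (v (m a))) \<le> A2" using A by simp
  have "integral {- (pi / 2)..pi / 2} f \<le> integral {- (pi / 2)..pi / 2} (\<lambda>\<phi>. A2 / A * (f \<phi> * cos \<phi>) + \<epsilon> / \<theta>)"
    using le by (intro integral_le integrable_continuous_real continuous_intros cf) auto
  also have "\<dots> = A2 / A * (arctan (v (m (- a))) - arctan (v (m a))) + pi * (\<epsilon> / \<theta>)"
    using has_integral_add[OF has_integral_mult_right[OF I, of "A2 / A"] has_integral_const_real[of "\<epsilon> / \<theta>" "- (pi / 2)" "pi / 2"]]
    by (simp add: integral_unique)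
  also have "pi * (\<epsilon> / \<theta>) = A3 - A2" using \<theta> by (simp add: \<epsilon>_def)
  finally have If: "integral {- (pi / 2)..pi / 2} f \<le> A3" using bd by simp
  have "sqrt (g0 + a\<^sup>2) = sqrt (g0 / a\<^sup>2 + 1) * a"
  proof -
    have "g0 + a\<^sup>2 = (g0 / a\<^sup>2 + 1) * a\<^sup>2" using a0 by (simp add: field_simps)
    then show ?thesis using a0 by (simp add: real_sqrt_mult)
  qed
  then have "period a = sqrt (g0 / a\<^sup>2 + 1) * integral {- (pi / 2)..pi / 2} f"
    by (simp add: period_def f_def[abs_def])
  also have "\<dots> \<le> sqrt (g0 / a\<^sup>2 + 1) * A3"
    using If g0_pos by (intro mult_left_mono) (auto intro: add_nonneg_nonneg)
  also have "\<dots> < pi / 2" by (rule a(1))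
  finally show ?thesis using a0 by blast
qed

lemma exists_period: "\<exists>a>0. period a = pi / 2"
proof -
  obtain a where a: "0 < a" "period a < pi / 2" using period_large by blast
  have "continuous_on {0..a} period" using continuous_period by (rule continuous_on_subset) simp
  then obtain b where b: "0 \<le> b" "b \<le> a" "period b = pi / 2"
    using IVT2'[of period a "pi / 2" 0] a period_0 by auto
  then show ?thesis using period_0 by (intro exI[of _ b]) (auto simp: less_le)
qed

end

section \<open>The profile curve\<close>

text \<open>If \<open>\<rho>\<close> and \<open>\<rho>'\<close> have order \<open>j\<close>, so does
  \<open>G \<circ> \<rho>\<close>, and both gain one order. The argument is needed because
  \<open>K\<close> is only known to be continuous, which leaves the smoothness of the
  parametrization open.\<close>

lemma smooth_on_second_order_ode:
  fixes \<rho> \<rho>' G :: "real \<Rightarrow> real"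
  assumes "open J" "smooth_on J G" "\<And>t. \<rho> t \<in> J"
    and "\<And>t. (\<rho> has_real_derivative \<rho>' t) (at t)"
    and "\<And>t. (\<rho>' has_real_derivative G (\<rho> t)) (at t)"
  shows "smooth_on UNIV \<rho>"
proof -
  have "times_differentiable_on j UNIV \<rho> \<and> times_differentiable_on j UNIV \<rho>'" for j
  proof (induction j)
    case 0
    show ?case
      using assms(4,5) by (auto intro!: continuous_at_imp_continuous_on DERIV_isCont)
  next
    case (Suc j)
    have "times_differentiable_on j UNIV (\<lambda>t. G (\<rho> t))"
    proof (rule times_differentiable_on_compose[where f = G and g = \<rho> and T = J])
      show "times_differentiable_on j J G" using assms(2) by (simp add: smooth_on_def)
    qed (use assms(1,3) Suc.IH in auto)
    then have "times_differentiable_on (Suc j) UNIV \<rho>'"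
      using assms(5) unfolding has_field_derivative_def
      by (intro times_differentiable_on_SucI[where f' = "\<lambda>t v. G (\<rho> t) * v"]
          times_differentiable_on_linear[OF _ bounded_linear_mult_left] open_UNIV)
    moreover have "times_differentiable_on (Suc j) UNIV \<rho>"
      using assms(4) Suc.IH unfolding has_field_derivative_def
      by (intro times_differentiable_on_SucI[where f' = "\<lambda>t v. \<rho>' t * v"]
          times_differentiable_on_linear[OF _ bounded_linear_mult_left] open_UNIV) auto
    ultimately show ?case by (intro conjI)
  qed
  then show ?thesis by (simp add: smooth_on_def)
qed

lemma exists_antiderivative:
  fixes f :: "real \<Rightarrow> real"
  assumes "\<And>x. isCont f x"
  shows "\<exists>F. \<forall>x. (F has_real_derivative f x) (at x)"
  using einterval_antiderivative[of "-\<infinity>" "\<infinity>" f] assms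
  by (auto simp: has_real_derivative_iff_has_vector_derivative)

lemma deriv_zero_const:
  fixes f :: "real \<Rightarrow> real"
  assumes "\<And>x. (f has_real_derivative 0) (at x)"
  shows "f x = f y"
  using DERIV_isconst_all[of f x y] assms by blast

text \<open>The parameter \<open>\<phi>\<close> with \<open>\<sigma> = a sin \<phi>\<close> removes the singularities at the turning points:
  \<open>E (S \<phi>) = (c a cos \<phi>)\<^sup>2\<close> where \<open>E = (L\<^sup>2 - R\<^sup>2) / sin\<^bsup>2 p\<^esup>\<close>, and \<open>S1 \<phi>\<close> is the value of \<open>s\<^sub>1\<close> at
  \<open>S \<phi>\<close>. All of this makes sense for every real \<open>\<phi>\<close>, and the symmetries of the sine turn
  \<open>S \<circ> S1\<^bsup>-1\<^esup>\<close> into the even periodic extension of the profile.\<close>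

locale unduloid_period = unduloid +
  fixes a :: real
  assumes a_pos: "0 < a" and period_a: "period a = pi / 2"
begin

definition "c = 1 / sqrt (g0 + a\<^sup>2)"
definition "C = c ^ Suc p"
text \<open>This is \<open>R / sin^(p+1) s\<close>, the quantity \<open>v\<close> expressed in the
  angle \<open>s\<close>.\<close>

definition "V s = k + C / sin s ^ Suc p"
definition "E s = 1 - (sin s)\<^sup>2 * (1 + (V s)\<^sup>2)"
definition "x \<phi> = c * m (a * sin \<phi>)"
definition "S \<phi> = arcsin (x \<phi>)"
text \<open>The integrand of \<open>s_1\<close> at \<open>S \<phi>\<close> times the derivative of
  \<open>S\<close>. The factor \<open>c a cos \<phi>\<close>, which vanishes at the turning points,
  has cancelled, so \<open>I\<close> is positive everywhere.\<close>

definition "I \<phi> = K (m (a * sin \<phi>)) * x \<phi> * v (m (a * sin \<phi>)) / (1 - (x \<phi>)\<^sup>2)"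

lemma ga_pos: "0 < g0 + a\<^sup>2"
  using g0_pos by (simp add: add_pos_nonneg)

lemma c_pos: "0 < c"
  using ga_pos by (simp add: c_def)

lemma c_sq: "c\<^sup>2 * (g0 + a\<^sup>2) = 1"
  using ga_pos by (simp add: c_def power_divide)

lemma C_pos: "0 < C"
  using c_pos by (simp add: C_def)

lemma V_eq: "0 < sin s \<Longrightarrow> V s = v (sin s / c)"
  by (simp add: V_def v_def C_def power_divide del: power_Suc)

lemma V_pos: "0 < sin s \<Longrightarrow> 0 < V s"
  using k_pos C_pos by (simp add: V_def add_pos_pos)

lemma E_eq: "0 < sin s \<Longrightarrow> E s = c\<^sup>2 * (a\<^sup>2 - (\<sigma> (sin s / c))\<^sup>2)"
proof -
  assume s: "0 < sin s"
  then have "(\<sigma> (sin s / c))\<^sup>2 = g (sin s / c) - g0" using c_pos by (intro \<sigma>_sq) simp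
  moreover have "c\<^sup>2 * g (sin s / c) = (sin s)\<^sup>2 * (1 + (V s)\<^sup>2)"
    using c_pos by (simp add: g_def V_eq[OF s] power_divide)
  ultimately show ?thesis using c_sq unfolding E_def by algebra
qed

lemma x_pos: "0 < x \<phi>"
  using c_pos m by (simp add: x_def)

lemma x_eq: "(x \<phi>)\<^sup>2 * (1 + (v (m (a * sin \<phi>)))\<^sup>2) = 1 - (c * a * cos \<phi>)\<^sup>2"
proof -
  have "(x \<phi>)\<^sup>2 * (1 + (v (m (a * sin \<phi>)))\<^sup>2) = c\<^sup>2 * g (m (a * sin \<phi>))"
    by (simp add: x_def g_def power_mult_distrib)
  also have "\<dots> = c\<^sup>2 * (g0 + a\<^sup>2) - c\<^sup>2 * a\<^sup>2 * (1 - (sin \<phi>)\<^sup>2)"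
    by (simp add: g_m power_mult_distrib algebra_simps)
  also have "\<dots> = 1 - (c * a * cos \<phi>)\<^sup>2"
    unfolding c_sq by (simp add: cos_squared_eq power_mult_distrib)
  finally show ?thesis .
qed

lemma x_less_1: "x \<phi> < 1"
proof -
  have "(x \<phi>)\<^sup>2 * 1 < (x \<phi>)\<^sup>2 * (1 + (v (m (a * sin \<phi>)))\<^sup>2)"
    using x_pos[of \<phi>] v_pos[OF m(1)[of "a * sin \<phi>"]] by (intro mult_strict_left_mono) auto
  also have "\<dots> \<le> 1" unfolding x_eq by simp
  finally show ?thesis using x_pos[of \<phi>] by (simp add: abs_square_less_1)
qed

lemma sin_S: "sin (S \<phi>) = x \<phi>"
  using x_pos[of \<phi>] x_less_1[of \<phi>] by (simp add: S_def)

lemma S_pos: "0 < S \<phi>" and S_less: "S \<phi> < pi / 2"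
  using x_pos[of \<phi>] x_less_1[of \<phi>] arcsin_less_arcsin[of 0 "x \<phi>"] arcsin_less_arcsin[of "x \<phi>" 1]
  by (auto simp: S_def)

lemma cos_S: "0 < cos (S \<phi>)" "(cos (S \<phi>))\<^sup>2 = 1 - (x \<phi>)\<^sup>2"
  using S_pos[of \<phi>] S_less[of \<phi>] by (auto intro!: cos_gt_zero_pi simp: cos_squared_eq sin_S)

lemma V_S: "V (S \<phi>) = v (m (a * sin \<phi>))"
  using x_pos[of \<phi>] c_pos by (simp add: V_eq sin_S) (simp add: x_def)

lemma E_S: "E (S \<phi>) = (c * a * cos \<phi>)\<^sup>2"
  using x_eq[of \<phi>] by (simp add: E_def V_S sin_S)

lemma deriv_m_sin: "((\<lambda>\<phi>. m (a * sin \<phi>)) has_real_derivative K (m (a * sin \<phi>)) * (a * cos \<phi>)) (at \<phi>)"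
  by (rule DERIV_chain2[OF deriv_m]) (auto intro!: derivative_eq_intros)

lemma deriv_x: "(x has_real_derivative c * (K (m (a * sin \<phi>)) * (a * cos \<phi>))) (at \<phi>)"
  unfolding x_def[abs_def] by (rule DERIV_cmult[OF deriv_m_sin])

lemma deriv_S: "(S has_real_derivative c * a * cos \<phi> * K (m (a * sin \<phi>)) / cos (S \<phi>)) (at \<phi>)"
proof -
  have "sqrt (1 - (x \<phi>)\<^sup>2) = cos (S \<phi>)" using cos_S[of \<phi>] by (simp add: real_sqrt_unique)
  moreover have "(S has_real_derivative inverse (sqrt (1 - (x \<phi>)\<^sup>2)) * (c * (K (m (a * sin \<phi>)) * (a * cos \<phi>)))) (at \<phi>)"
    unfolding S_def[abs_def] using x_pos[of \<phi>] x_less_1[of \<phi>]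
    by (intro DERIV_chain2[OF DERIV_arcsin deriv_x]) auto
  ultimately show ?thesis by (simp add: field_simps)
qed

lemma I_pos: "0 < I \<phi>"
  using K_pos[OF m(1)] x_pos[of \<phi>] v_pos[OF m(1)] cos_S[of \<phi>] zero_less_power[OF cos_S(1)[of \<phi>], of 2]
  by (simp add: I_def)

lemma isCont_m_sin: "isCont (\<lambda>\<phi>. m (a * sin \<phi>)) \<phi>" "isCont (\<lambda>\<phi>. K (m (a * sin \<phi>))) \<phi>"
    "isCont (\<lambda>\<phi>. v (m (a * sin \<phi>))) \<phi>"
proof -
  have "isCont (\<lambda>\<phi>. a * sin \<phi>) \<phi>" by (intro continuous_intros)
  note o = isCont_o2[OF this]
  show "isCont (\<lambda>\<phi>. m (a * sin \<phi>)) \<phi>" "isCont (\<lambda>\<phi>. K (m (a * sin \<phi>))) \<phi>"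
    "isCont (\<lambda>\<phi>. v (m (a * sin \<phi>))) \<phi>"
    by (rule o[OF isCont_m] o[OF isCont_K_m] o[OF isCont_v_m])+
qed

lemma isCont_I: "isCont I \<phi>"
proof -
  have "1 - (x \<phi>)\<^sup>2 \<noteq> 0" using cos_S[of \<phi>] zero_less_power[OF cos_S(1)[of \<phi>], of 2] by simp
  then show ?thesis
    unfolding I_def[abs_def] by (intro continuous_intros isCont_m_sin DERIV_isCont[OF deriv_x])
qed

text \<open>An antiderivative on the whole line, since the reflections below evaluate
  \<open>S1\<close> beyond the turning points; \<open>S1\<close> normalizes it to vanish at the left
  one.\<close>

definition "J = (SOME F. \<forall>\<phi>. (F has_real_derivative I \<phi>) (at \<phi>))"

definition "S1 \<phi> = J \<phi> - J (- (pi / 2))"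

lemma deriv_S1: "(S1 has_real_derivative I \<phi>) (at \<phi>)"
proof -
  have "\<forall>\<phi>. (J has_real_derivative I \<phi>) (at \<phi>)"
    unfolding J_def using exists_antiderivative[OF isCont_I] by (rule someI_ex)
  then show ?thesis unfolding S1_def[abs_def] by (auto intro!: derivative_eq_intros)
qed

lemma deriv_S1_comp:
  "(f has_real_derivative d) (at \<phi>) \<Longrightarrow> ((\<lambda>\<phi>. S1 (f \<phi>)) has_real_derivative I (f \<phi>) * d) (at \<phi>)"
  by (rule DERIV_chain2[OF deriv_S1])

lemma I_cong: "sin \<phi> = sin \<psi> \<Longrightarrow> I \<phi> = I \<psi>"
  by (simp add: I_def x_def)

lemma S_cong: "sin \<phi> = sin \<psi> \<Longrightarrow> S \<phi> = S \<psi>"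
  by (simp add: S_def x_def)

lemma S1_start: "S1 (- (pi / 2)) = 0"
  by (simp add: S1_def)

lemma strict_mono_S1: "strict_mono S1"
proof (rule strict_monoI)
  fix \<phi> \<psi> :: real assume "\<phi> < \<psi>"
  then show "S1 \<phi> < S1 \<psi>"
  proof (rule DERIV_pos_imp_increasing)
    show "\<exists>d. (S1 has_real_derivative d) (at z) \<and> 0 < d" for z
      using deriv_S1[of z] I_pos[of z] by (intro exI[of _ "I z"]) simp
  qed
qed

lemma S1_less_iff: "S1 \<phi> < S1 \<psi> \<longleftrightarrow> \<phi> < \<psi>"
  using strict_mono_less[OF strict_mono_S1] .

lemma S1_le_iff: "S1 \<phi> \<le> S1 \<psi> \<longleftrightarrow> \<phi> \<le> \<psi>"
  using S1_less_iff[of \<psi> \<phi>] by linarith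

text \<open>\<open>I\<close> depends on \<open>\<phi>\<close> only through
  \<open>sin \<phi>\<close>, so \<open>S1 (- pi - \<phi>) + S1 \<phi>\<close> is constant; its value
  is read off at the fixed point \<open>- (pi / 2)\<close> of the reflection. This becomes the
  evenness of the profile.\<close>

lemma S1_reflect_left: "S1 (- pi - \<phi>) = - S1 \<phi>"
proof -
  have "((\<lambda>\<phi>. S1 (- pi - \<phi>) + S1 \<phi>) has_real_derivative I (- pi - \<phi>) * - 1 + I \<phi>) (at \<phi>)" for \<phi>
    by (intro DERIV_add deriv_S1 deriv_S1_comp) (auto intro!: derivative_eq_intros)
  moreover have "I (- pi - \<phi>) * - 1 + I \<phi> = 0" for \<phi>
    using I_cong[of "- pi - \<phi>" \<phi>] by (simp add: sin_diff)
  ultimately have "S1 (- pi - \<phi>) + S1 \<phi> = S1 (- pi - (- (pi / 2))) + S1 (- (pi / 2))"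
    by (intro deriv_zero_const[where f = "\<lambda>\<phi>. S1 (- pi - \<phi>) + S1 \<phi>"]) simp
  moreover have "- pi - (- (pi / 2)) = - (pi / 2)" by simp
  ultimately show ?thesis by (simp add: S1_start)
qed

text \<open>Here \<open>period a = pi / 2\<close> enters. The derivative of \<open>H\<close> below
  is the integrand of \<open>period a\<close>, up to \<open>1 / c\<close>, and \<open>H\<close>
  agrees with \<open>S1\<close> at both ends because the cosine vanishes there.\<close>

lemma S1_end: "S1 (pi / 2) = pi / 2"
proof -
  \<comment> \<open>\<open>H\<close> locates the point where the normal geodesic of the hypersurface meets the great circle;
    it is constant on the spheres that correspond to \<open>C = 0\<close>.\<close>
  define H where "H \<phi> = S1 \<phi> + arctan (c * a * cos \<phi> / v (m (a * sin \<phi>)))" for \<phi>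
  have dH: "(H has_real_derivative \<kappa> (m (a * sin \<phi>)) / c) (at \<phi>)" for \<phi>
  proof -
    define \<mu> where "\<mu> = m (a * sin \<phi>)"
    define w where "w = v \<mu>"
    define b where "b = c * a * cos \<phi>"
    have \<mu>: "0 < \<mu>" by (simp add: \<mu>_def m)
    have w: "0 < w" using v_pos[OF \<mu>] by (simp add: w_def)
    have xc: "x \<phi> = c * \<mu>" by (simp add: x_def \<mu>_def)
    have b: "b\<^sup>2 = 1 - (c * \<mu>)\<^sup>2 * (1 + w\<^sup>2)"
      using x_eq[of \<phi>] by (simp add: b_def w_def \<mu>_def x_def)
    have z: "0 < 1 - (c * \<mu>)\<^sup>2" using cos_S[of \<phi>] zero_less_power[OF cos_S(1)[of \<phi>], of 2] by (simp add: xc)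
    have s: "2 * (a * sin \<phi>) = 2 * \<mu> * (1 + h * w - p * w\<^sup>2) * K \<mu>"
      using \<sigma>_eq[OF \<mu>] by (simp add: \<mu>_def m g'_def w_def)
    have dv: "((\<lambda>\<phi>. v (m (a * sin \<phi>))) has_real_derivative
        - ((real p + 1) * (w - k) / \<mu>) * (K \<mu> * (a * cos \<phi>))) (at \<phi>)"
      unfolding w_def \<mu>_def by (rule DERIV_chain2[OF deriv_v[OF m(1)] deriv_m_sin])
    have "((\<lambda>\<phi>. c * a * cos \<phi>) has_real_derivative - (c * (a * sin \<phi>))) (at \<phi>)"
      by (auto intro!: derivative_eq_intros)
    note DERIV_divide[OF this dv]
    then have "((\<lambda>\<phi>. c * a * cos \<phi> / v (m (a * sin \<phi>))) has_real_derivative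
        (- (c * (a * sin \<phi>)) * w - b * (- ((real p + 1) * (w - k) / \<mu>) * (K \<mu> * (a * cos \<phi>)))) / (w * w)) (at \<phi>)"
      using w by (simp add: w_def \<mu>_def b_def)
    from DERIV_add[OF deriv_S1 DERIV_chain2[OF DERIV_arctan this]]
    have "(H has_real_derivative I \<phi> + inverse (1 + (b / w)\<^sup>2) *
        ((- (c * (a * sin \<phi>)) * w - b * (- ((real p + 1) * (w - k) / \<mu>) * (K \<mu> * (a * cos \<phi>)))) / (w * w))) (at \<phi>)"
      unfolding H_def by (simp add: w_def \<mu>_def b_def)
    moreover have "I \<phi> + inverse (1 + (b / w)\<^sup>2) *
        ((- (c * (a * sin \<phi>)) * w - b * (- ((real p + 1) * (w - k) / \<mu>) * (K \<mu> * (a * cos \<phi>)))) / (w * w))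
        = \<kappa> \<mu> / c"
    proof -
      have "inverse (1 + (b / w)\<^sup>2) = w\<^sup>2 / ((1 + w\<^sup>2) * (1 - (c * \<mu>)\<^sup>2))"
      proof -
        \<comment> \<open>This factorization gives the derivative of the arctangent the same
          denominator \<open>1 - (c \<mu>)^2\<close> as \<open>I\<close>, so that the two can
          cancel.\<close>
        have "w\<^sup>2 + b\<^sup>2 = (1 + w\<^sup>2) * (1 - (c * \<mu>)\<^sup>2)" unfolding b by algebra
        then have "1 + (b / w)\<^sup>2 = (1 + w\<^sup>2) * (1 - (c * \<mu>)\<^sup>2) / w\<^sup>2"
          using w by (simp add: power_divide field_simps)
        then show ?thesis by simp
      qed
      moreover have "- (c * (a * sin \<phi>)) * w - b * (- ((real p + 1) * (w - k) / \<mu>) * (K \<mu> * (a * cos \<phi>)))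
          = K \<mu> * (- c * w * \<mu> * (1 + h * w - p * w\<^sup>2) + (real p + 1) * (w - k) / (c * \<mu>) * b\<^sup>2)"
      proof -
        have ac: "a * cos \<phi> = b / c" using c_pos by (simp add: b_def)
        have as: "a * sin \<phi> = \<mu> * (1 + h * w - p * w\<^sup>2) * K \<mu>" using s by simp
        show ?thesis unfolding ac as using c_pos \<mu> by (simp add: field_simps power2_eq_square)
      qed
      moreover have "I \<phi> = K \<mu> * (c * \<mu>) * w / (1 - (c * \<mu>)\<^sup>2)"
        by (simp add: I_def xc w_def \<mu>_def)
      moreover have "K \<mu> * (c * \<mu>) * w / Z + w\<^sup>2 / (W * Z) *
          (K \<mu> * (- c * w * \<mu> * (1 + h * w - p * w\<^sup>2) + (real p + 1) * (w - k) / (c * \<mu>) * b\<^sup>2) / (w * w))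
          = (real p + 1) * (w - k) * K \<mu> / (\<mu> * W) / c"
        if Z: "Z = 1 - (c * \<mu>)\<^sup>2" "0 < Z" and W: "W = 1 + w\<^sup>2" "0 < W" for Z W
      proof -
        \<comment> \<open>Expressed through \<open>W\<close>, \<open>Z\<close> and
          \<open>(p + 1) (w - k)\<close>, the terms with denominator \<open>Z\<close> cancel; only
          the part of \<open>b^2\<close> equal to \<open>Z\<close> survives.\<close>
        have b2: "b\<^sup>2 = Z - (c * \<mu>)\<^sup>2 * w\<^sup>2" unfolding b Z(1) by algebra
        have hh: "1 + h * w - p * w\<^sup>2 = W - w * ((real p + 1) * w - h)" unfolding W by algebra
        have hk: "(real p + 1) * w - h = (real p + 1) * (w - k)" by (simp add: right_diff_distrib k_mult)
        define Y where "Y = (real p + 1) * (w - k)"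
        have "K \<mu> * (c * \<mu>) * w / Z + w\<^sup>2 / (W * Z) *
            (K \<mu> * (- c * w * \<mu> * (W - w * Y) + Y / (c * \<mu>) * (Z - (c * \<mu>)\<^sup>2 * w\<^sup>2)) / (w * w))
            = Y * K \<mu> / (\<mu> * W) / c"
          using c_pos \<mu> w Z(2) W(2) by (simp add: field_simps power2_eq_square)
        then show ?thesis unfolding b2 hh hk Y_def .
      qed
      ultimately show ?thesis
        unfolding \<kappa>_def using z v_sq_pos[of \<mu>] by (simp add: w_def)
    qed
    ultimately show ?thesis by (simp add: \<mu>_def)
  qed
  have "((\<lambda>\<phi>. \<kappa> (m (a * sin \<phi>)) / c) has_integral H (pi / 2) - H (- (pi / 2))) {- (pi / 2)..pi / 2}"
    by (rule fundamental_theorem_of_calculus)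
      (auto intro!: has_field_derivative_at_within[OF dH]
        simp: has_real_derivative_iff_has_vector_derivative[symmetric])
  then have "((\<lambda>\<phi>. \<kappa> (m (a * sin \<phi>)) / c) has_integral S1 (pi / 2)) {- (pi / 2)..pi / 2}"
    by (simp add: H_def S1_start)
  then have "integral {- (pi / 2)..pi / 2} (\<lambda>\<phi>. \<kappa> (m (a * sin \<phi>)) / c) = S1 (pi / 2)"
    by (rule integral_unique)
  moreover have "integral {- (pi / 2)..pi / 2} (\<lambda>\<phi>. \<kappa> (m (a * sin \<phi>)) / c) = period a"
    by (simp add: period_def c_def mult.commute)
  ultimately show ?thesis using period_a by simp
qed

lemma S1_reflect_right: "S1 (pi - \<phi>) = pi - S1 \<phi>"
proof -
  have "((\<lambda>\<phi>. S1 (pi - \<phi>) + S1 \<phi>) has_real_derivative I (pi - \<phi>) * - 1 + I \<phi>) (at \<phi>)" for \<phi>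
    by (intro DERIV_add deriv_S1 deriv_S1_comp) (auto intro!: derivative_eq_intros)
  moreover have "I (pi - \<phi>) * - 1 + I \<phi> = 0" for \<phi>
    using I_cong[of "pi - \<phi>" \<phi>] by (simp add: sin_diff)
  ultimately have "S1 (pi - \<phi>) + S1 \<phi> = S1 (pi - pi / 2) + S1 (pi / 2)"
    by (intro deriv_zero_const[where f = "\<lambda>\<phi>. S1 (pi - \<phi>) + S1 \<phi>"]) simp
  moreover have "pi - pi / 2 = pi / 2" by simp
  ultimately show ?thesis using S1_end by simp
qed

lemma S1_shift: "S1 (\<phi> + 2 * pi) = S1 \<phi> + pi"
  using S1_reflect_right[of "- pi - \<phi>"] S1_reflect_left[of \<phi>] by (simp add: algebra_simps)

text \<open>\<open>S1 \<phi> - \<phi> / 2\<close> is \<open>2 * pi\<close>-periodic, so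
  \<open>S1\<close> runs through all multiples of \<open>pi\<close>, and the intermediate value
  theorem fills the gaps.\<close>

lemma S1_surj: "\<exists>\<phi>. S1 \<phi> = t"
proof -
  have per: "S1 (\<phi> + 2 * pi) - (\<phi> + 2 * pi) / 2 = S1 \<phi> - \<phi> / 2" for \<phi>
    by (simp add: S1_shift add_divide_distrib)
  have S1_int: "S1 (- (pi / 2) + 2 * pi * of_int j) = pi * of_int j" for j :: int
  proof -
    define A where "A = - (pi / 2) + 2 * pi * of_int j"
    have "S1 A - A / 2 = S1 (- (pi / 2)) - (- (pi / 2)) / 2"
      unfolding A_def using periodic_int[where f = "\<lambda>\<phi>. S1 \<phi> - \<phi> / 2", OF per] .
    moreover have "A / 2 = - (pi / 4) + pi * of_int j" by (simp add: A_def add_divide_distrib)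
    ultimately have "S1 A = pi * of_int j" by (simp add: S1_start)
    then show ?thesis by (simp only: A_def)
  qed
  define j where "j = \<lfloor>t / pi\<rfloor>"
  have "of_int j \<le> t / pi" "t / pi \<le> of_int (j + 1)" unfolding j_def by linarith+
  then have "pi * of_int j \<le> t" "t \<le> pi * of_int (j + 1)" by (simp_all add: field_simps)
  then have "S1 (- (pi / 2) + 2 * pi * of_int j) \<le> t" "t \<le> S1 (- (pi / 2) + 2 * pi * of_int (j + 1))"
    unfolding S1_int .
  moreover have "continuous_on B S1" for B
    by (auto intro!: continuous_at_imp_continuous_on DERIV_isCont[OF deriv_S1])
  moreover have "- (pi / 2) + 2 * pi * of_int j \<le> - (pi / 2) + 2 * pi * of_int (j + 1)" by simp
  ultimately show ?thesis using IVT'[of S1 _ t] by blast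
qed

section \<open>The profile on the real line and its differential equation\<close>

definition "\<Phi> = inv S1"

lemma S1_\<Phi>: "S1 (\<Phi> t) = t"
  unfolding \<Phi>_def inv_def using S1_surj by (rule someI_ex)

lemma \<Phi>_S1: "\<Phi> (S1 \<phi>) = \<phi>"
  unfolding \<Phi>_def by (rule inv_f_f) (rule strict_mono_imp_inj_on[OF strict_mono_S1])

lemma deriv_\<Phi>: "(\<Phi> has_real_derivative inverse (I (\<Phi> t))) (at t)"
proof (rule DERIV_inverse_function)
  show "(S1 has_real_derivative I (\<Phi> t)) (at (\<Phi> t))" by (rule deriv_S1)
  show "I (\<Phi> t) \<noteq> 0" using I_pos[of "\<Phi> t"] by simp
  show "t - 1 < t" "t < t + 1" by simp_all
  show "S1 (\<Phi> y) = y" for y by (rule S1_\<Phi>)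
  have "isCont \<Phi> (S1 (\<Phi> t))"
    by (rule isCont_inverse_function[where d = 1]) (auto simp: \<Phi>_S1 intro: DERIV_isCont[OF deriv_S1])
  then show "isCont \<Phi> t" by (simp add: S1_\<Phi>)
qed

text \<open>The quotient \<open>L / R\<close>. The profile obeys the first-order equation
  \<open>\<rho>'^2 = cos^2 \<rho> (q^2 - 1)\<close>, with \<open>q = 1\<close> at the turning
  points.\<close>

definition "q s = cos s / (sin s * V s)"
definition "q' s = - 1 / V s - (cos s)\<^sup>2 * (h - p * V s) / ((sin s)\<^sup>2 * (V s)\<^sup>2)"
text \<open>Half the derivative of \<open>cos^2 s ((q s)^2 - 1)\<close>, the right-hand side of the
  first-order equation.\<close>

definition "G2 s = - cos s * sin s * ((q s)\<^sup>2 - 1) + (cos s)\<^sup>2 * q s * q' s"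

definition "\<rho> t = S (\<Phi> t)"
definition "\<rho>' t = c * a * cos (\<Phi> t) * q (\<rho> t)"

lemma deriv_V:
  assumes "0 < sin s"
  shows "(V has_real_derivative - ((real p + 1) * (V s - k) * cos s / sin s)) (at s)"
proof -
  have "((\<lambda>s. v (sin s / c)) has_real_derivative
      - ((real p + 1) * (v (sin s / c) - k) / (sin s / c)) * (cos s / c)) (at s)"
    using assms c_pos by (intro DERIV_chain2[OF deriv_v]) (auto intro!: derivative_eq_intros)
  moreover have "\<forall>\<^sub>F s in nhds s. v (sin s / c) = V s"
  proof -
    have "open (sin -` {0 :: real<..})" by (intro open_vimage continuous_intros open_greaterThan)
    then show ?thesis using assms
      by (intro eventually_mono[OF eventually_nhds_in_open[of "sin -` {0<..}" s]]) (auto simp: V_eq)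
  qed
  ultimately show ?thesis
    using assms c_pos DERIV_cong_ev[of s s "\<lambda>s. v (sin s / c)" V] by (simp add: V_eq mult_ac)
qed

lemma deriv_q:
  assumes "0 < sin s"
  shows "(q has_real_derivative q' s) (at s)"
proof -
  have V: "0 < V s" using assms by (rule V_pos)
  have "(q has_real_derivative ((- sin s) * (sin s * V s) - cos s * (cos s * V s
      + - ((real p + 1) * (V s - k) * cos s / sin s) * sin s)) / ((sin s * V s) * (sin s * V s))) (at s)"
    unfolding q_def[abs_def] using assms V
    by (intro DERIV_divide DERIV_mult deriv_V DERIV_sin DERIV_cos) auto
  moreover have "((- sin s) * (sin s * V s) - cos s * (cos s * V s
      + - ((real p + 1) * (V s - k) * cos s / sin s) * sin s)) / ((sin s * V s) * (sin s * V s)) = q' s"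
  proof -
    have "((- X) * (X * W) - Z * (Z * W + - (Y * Z / X) * X)) / ((X * W) * (X * W))
        = - 1 / W - Z\<^sup>2 * (W - Y) / (X\<^sup>2 * W\<^sup>2)" if "0 < X" "0 < W" for X W Y Z :: real
      using that by (simp add: field_simps power2_eq_square)
    from this[OF assms V, of "cos s" "(real p + 1) * (V s - k)"]
    have "((- sin s) * (sin s * V s) - cos s * (cos s * V s
      + - ((real p + 1) * (V s - k) * cos s / sin s) * sin s)) / ((sin s * V s) * (sin s * V s))
      = - 1 / V s - (cos s)\<^sup>2 * (V s - (real p + 1) * (V s - k)) / ((sin s)\<^sup>2 * (V s)\<^sup>2)" .
    moreover have "V s - (real p + 1) * (V s - k) = h - p * V s"
      unfolding right_diff_distrib k_mult by (simp add: algebra_simps)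
    ultimately show ?thesis by (simp add: q'_def)
  qed
  ultimately show ?thesis by simp
qed

lemma sin_S_pos: "0 < sin (S \<phi>)"
  using x_pos by (simp add: sin_S)

lemma deriv_\<rho>: "(\<rho> has_real_derivative \<rho>' t) (at t)"
proof -
  define \<phi> where "\<phi> = \<Phi> t"
  have "((\<lambda>t. S (\<Phi> t)) has_real_derivative
      c * a * cos \<phi> * K (m (a * sin \<phi>)) / cos (S \<phi>) * inverse (I \<phi>)) (at t)"
    unfolding \<phi>_def by (rule DERIV_chain2[OF deriv_S deriv_\<Phi>])
  moreover have "c * a * cos \<phi> * K (m (a * sin \<phi>)) / cos (S \<phi>) * inverse (I \<phi>)
      = c * a * cos \<phi> * q (S \<phi>)"
    using cos_S(1)[of \<phi>] x_pos[of \<phi>] K_pos[OF m(1)[of "a * sin \<phi>"]] v_pos[OF m(1)[of "a * sin \<phi>"]]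
    unfolding I_def q_def V_S sin_S cos_S(2)[symmetric] by (simp add: field_simps power2_eq_square)
  ultimately show ?thesis unfolding \<rho>_def[abs_def] \<rho>'_def by (simp add: \<phi>_def)
qed

lemma \<rho>'_sq: "(\<rho>' t)\<^sup>2 = (cos (\<rho> t))\<^sup>2 * ((q (\<rho> t))\<^sup>2 - 1)"
proof -
  have "(\<rho>' t)\<^sup>2 = E (\<rho> t) * (q (\<rho> t))\<^sup>2"
    by (simp add: \<rho>'_def \<rho>_def E_S power_mult_distrib)
  moreover have "E s * (q s)\<^sup>2 = (cos s)\<^sup>2 * ((q s)\<^sup>2 - 1)" if "0 < sin s" for s
  proof -
    have "sin s * V s * q s = cos s" using that V_pos[OF that] by (simp add: q_def)
    moreover have "E s * (q s)\<^sup>2 = (1 - (sin s)\<^sup>2) * (q s)\<^sup>2 - (sin s * V s * q s)\<^sup>2"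
      by (simp add: E_def algebra_simps power_mult_distrib)
    ultimately show ?thesis by (simp add: cos_squared_eq[symmetric] right_diff_distrib)
  qed
  ultimately show ?thesis using sin_S_pos by (simp add: \<rho>_def)
qed

text \<open>Differentiating the first-order equation would only give
  \<open>\<rho>' \<rho>'' = \<rho>' G2\<close>, which says nothing where \<open>\<rho>'\<close>
  vanishes. The product \<open>c a cos \<Phi> q(\<rho>)\<close> has no square root and is
  differentiated directly, turning points included.\<close>

lemma deriv_\<rho>': "(\<rho>' has_real_derivative G2 (\<rho> t)) (at t)"
proof -
  define \<phi> where "\<phi> = \<Phi> t"
  define \<mu> where "\<mu> = m (a * sin \<phi>)"
  define X where "X = sin (S \<phi>)"
  define Z where "Z = cos (S \<phi>)"
  define W where "W = v \<mu>"
  define b where "b = c * a * cos \<phi>"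
  have \<mu>: "0 < \<mu>" "0 < K \<mu>" by (simp_all add: \<mu>_def m K_pos)
  have pos: "0 < X" "0 < Z" "0 < W" using sin_S_pos cos_S v_pos[OF \<mu>(1)] by (auto simp: X_def Z_def W_def)
  have X: "X = c * \<mu>" by (simp add: X_def sin_S x_def \<mu>_def)
  have VW: "V (S \<phi>) = W" by (simp add: V_S W_def \<mu>_def)
  have s: "a * sin \<phi> = \<mu> * (1 + h * W - p * W\<^sup>2) * K \<mu>"
    using \<sigma>_eq[OF \<mu>(1)] by (simp add: \<mu>_def m g'_def W_def)
  have b2: "b\<^sup>2 = Z\<^sup>2 - X\<^sup>2 * W\<^sup>2"
    using E_S[of \<phi>] by (simp add: E_def b_def X_def Z_def VW cos_squared_eq algebra_simps)
  have I: "I \<phi> = K \<mu> * X * W / Z\<^sup>2"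
    by (simp add: I_def \<mu>_def X_def Z_def W_def sin_S cos_S)
  have "((\<lambda>t. c * a * cos (\<Phi> t)) has_real_derivative - (c * (a * sin \<phi>) * inverse (I \<phi>))) (at t)"
    unfolding \<phi>_def by (auto intro!: derivative_eq_intros deriv_\<Phi>)
  from DERIV_mult[OF this DERIV_chain2[OF deriv_q deriv_\<rho>]]
  have "(\<rho>' has_real_derivative - (c * (a * sin \<phi>) * inverse (I \<phi>)) * q (S \<phi>) + q' (S \<phi>) * (b * q (S \<phi>)) * b) (at t)"
    unfolding \<rho>'_def[abs_def] using sin_S_pos[of "\<Phi> t"] by (simp add: \<rho>_def \<phi>_def b_def)
  moreover have "- (c * (a * sin \<phi>) * inverse (I \<phi>)) * q (S \<phi>) + q' (S \<phi>) * (b * q (S \<phi>)) * b = G2 (S \<phi>)"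
  proof -
    have A: "- (c * (a * sin \<phi>) * inverse (I \<phi>)) = - (1 + h * W - p * W\<^sup>2) * Z\<^sup>2 / W"
    proof -
      have "- (c * (\<mu> * B * K \<mu>) * inverse (K \<mu> * (c * \<mu>) * W / Z\<^sup>2)) = - B * Z\<^sup>2 / W" for B
        using pos \<mu> c_pos by (simp add: field_simps)
      then show ?thesis unfolding s I X .
    qed
    have B: "q' (S \<phi>) * (b * q (S \<phi>)) * b = q' (S \<phi>) * q (S \<phi>) * (Z\<^sup>2 - X\<^sup>2 * W\<^sup>2)"
      unfolding b2[symmetric] by (simp add: power2_eq_square)
    have Q: "q (S \<phi>) = Z / (X * W)" "q' (S \<phi>) = - 1 / W - Z\<^sup>2 * (h - p * W) / (X\<^sup>2 * W\<^sup>2)"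
      by (simp_all add: q_def q'_def VW X_def Z_def)
    have gen: "- (1 + h * W - P * W\<^sup>2) * Z\<^sup>2 / W * (Z / (X * W))
        + (- 1 / W - Z\<^sup>2 * (h - P * W) / (X\<^sup>2 * W\<^sup>2)) * (Z / (X * W)) * (Z\<^sup>2 - X\<^sup>2 * W\<^sup>2)
        = - Z * X * ((Z / (X * W))\<^sup>2 - 1) + Z\<^sup>2 * (Z / (X * W)) * (- 1 / W - Z\<^sup>2 * (h - P * W) / (X\<^sup>2 * W\<^sup>2))" for P
      using pos by (simp add: field_simps power2_eq_square)
    show ?thesis
      unfolding A B unfolding G2_def X_def[symmetric] Z_def[symmetric] Q by (rule gen)
  qed
  ultimately show ?thesis by (simp add: \<rho>_def \<phi>_def)
qed

lemma \<Phi>_shift: "\<Phi> (t + pi) = \<Phi> t + 2 * pi"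
  using \<Phi>_S1[of "\<Phi> t + 2 * pi"] by (simp add: S1_shift S1_\<Phi>)

text \<open>The period is twice the half period \<open>pi / 2\<close>, so one turn around the great
  circle contains two periods of the profile.\<close>

lemma \<rho>_shift: "\<rho> (t + pi) = \<rho> t"
  by (simp add: \<rho>_def \<Phi>_shift S_def x_def)

lemma \<Phi>_minus: "\<Phi> (- t) = - pi - \<Phi> t"
  using \<Phi>_S1[of "- pi - \<Phi> t"] by (simp only: S1_reflect_left S1_\<Phi>)

lemma \<rho>_minus: "\<rho> (- t) = \<rho> t"
  unfolding \<rho>_def \<Phi>_minus by (rule S_cong) (simp add: sin_diff)

lemma smooth_G2: "smooth_on {0<..<pi / 2} G2"
proof -
  have s: "0 < sin s" if "s \<in> {0<..<pi / 2}" for s :: real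
    using that by (intro sin_gt_zero) auto
  have sm: "smooth_on {0<..<pi / 2} (sin :: real \<Rightarrow> real)" "smooth_on {0<..<pi / 2} (cos :: real \<Rightarrow> real)"
    using smooth_on_sin_cos_real smooth_on_subset by blast+
  have V: "smooth_on {0<..<pi / 2} V"
    unfolding V_def[abs_def]
    by (intro smooth_on_add smooth_on_divide smooth_on_const smooth_on_power sm open_greaterThanLessThan)
      (use s in force)
  have q: "smooth_on {0<..<pi / 2} q"
    unfolding q_def[abs_def]
    by (intro smooth_on_divide smooth_on_mult V sm open_greaterThanLessThan)
      (use s V_pos in force)
  have "smooth_on {0<..<pi / 2} q'"
    unfolding q'_def[abs_def]
    by (intro smooth_on_diff smooth_on_divide smooth_on_mult smooth_on_power smooth_on_const V sm
        open_greaterThanLessThan) (use s V_pos in force)+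
  then show ?thesis
    unfolding G2_def[abs_def]
    by (intro smooth_on_add smooth_on_diff smooth_on_minus smooth_on_mult smooth_on_power smooth_on_const V q sm
        open_greaterThanLessThan)
qed

sublocale rotation_profile \<rho> \<rho>' "\<lambda>t. G2 (\<rho> t)"
proof
  show "0 < \<rho> t" "\<rho> t < pi / 2" for t unfolding \<rho>_def by (rule S_pos S_less)+
  show "\<rho> (t + 2 * pi) = \<rho> t" for t
    using \<rho>_shift[of t] \<rho>_shift[of "t + pi"] by (simp add: algebra_simps)
  show "(\<rho> has_real_derivative \<rho>' t) (at t)" for t by (rule deriv_\<rho>)
  show "(\<rho>' has_real_derivative G2 (\<rho> t)) (at t)" for t by (rule deriv_\<rho>')
  show "smooth_on UNIV \<rho>"
    by (rule smooth_on_second_order_ode[OF _ smooth_G2 _ deriv_\<rho> deriv_\<rho>'])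
      (auto simp del: less_divide_eq_numeral1 simp: \<rho>_def S_pos S_less)
qed

text \<open>The first-order equation gives \<open>N = cos \<rho> q\<close>. All terms become
  rational in the sine, the cosine and \<open>V\<close>, and the claim is an algebraic identity in
  which \<open>p\<close> may be any real number \<open>P\<close>.\<close>

lemma mean_curv_eq: "mean_curv (real p + 1) t = h"
proof -
  define X where "X = sin (\<rho> t)"
  define Z where "Z = cos (\<rho> t)"
  define W where "W = V (\<rho> t)"
  have X: "0 < X" unfolding X_def by (rule sin_pos)
  have Z: "0 < Z" unfolding Z_def by (rule cos_pos)
  have W: "0 < W" unfolding W_def using sin_pos by (rule V_pos)
  have q: "q (\<rho> t) = Z / (X * W)" by (simp add: q_def X_def Z_def W_def)
  have "(N t)\<^sup>2 = (Z * q (\<rho> t))\<^sup>2"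
    unfolding N_sq \<rho>'_sq by (simp add: Z_def power_mult_distrib algebra_simps)
  then have N: "N t = Z * (Z / (X * W))"
    using N_pos[of t] X Z W by (simp add: q power2_eq_iff_nonneg)
  have "- (Z * (- Z * X * ((Z / (X * W))\<^sup>2 - 1) + Z\<^sup>2 * (Z / (X * W)) * (- 1 / W - Z\<^sup>2 * (h - P * W) / (X\<^sup>2 * W\<^sup>2)))
       + X * Z\<^sup>2 + 2 * X * (Z\<^sup>2 * ((Z / (X * W))\<^sup>2 - 1))) / (Z * (Z / (X * W))) ^ 3
      + P * Z\<^sup>2 / (Z * (Z / (X * W)) * X) = h" for P
    using X Z W by (simp add: field_simps power2_eq_square power3_eq_cube)
  from this[of "real p"] show ?thesis
    unfolding mean_curv_def \<rho>'_sq N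
    unfolding G2_def q q'_def X_def[symmetric] Z_def[symmetric] W_def[symmetric]
    by (simp only: add_diff_cancel_right')
qed

section \<open>Identification with the prescribed curve\<close>

lemma R_fun_eq:
  assumes "0 < sin s"
  shows "R_fun (Suc (Suc p)) s C h = sin s ^ p * (sin s * V s)"
proof -
  have k: "h / (real (Suc (Suc p)) - 1) = k" by (simp add: k_def add.commute)
  show ?thesis
    unfolding R_fun_def V_def k using assms by (simp add: field_simps)
qed

lemma L_fun_eq: "L_fun (Suc (Suc p)) s = cos s * sin s ^ p"
  by (simp add: L_fun_def)

lemma S_less_S:
  assumes "- (pi / 2) \<le> \<phi>" "\<phi> < \<psi>" "\<psi> \<le> pi / 2"
  shows "S \<phi> < S \<psi>"
proof -
  have "sin \<phi> < sin \<psi>" using assms by (intro sin_monotone_2pi) auto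
  then have "m (a * sin \<phi>) < m (a * sin \<psi>)" using a_pos by (simp add: m_less_iff)
  then have "x \<phi> < x \<psi>" using c_pos by (simp add: x_def)
  then show ?thesis
    unfolding S_def using x_pos[of \<phi>] x_less_1[of \<psi>] by (intro arcsin_less_arcsin) auto
qed

lemma S_le_S: "- (pi / 2) \<le> \<phi> \<Longrightarrow> \<phi> \<le> \<psi> \<Longrightarrow> \<psi> \<le> pi / 2 \<Longrightarrow> S \<phi> \<le> S \<psi>"
  using S_less_S[of \<phi> \<psi>] by (cases "\<phi> = \<psi>") auto

lemma S_image:
  assumes "S (- (pi / 2)) \<le> s" "s \<le> S (pi / 2)"
  obtains \<psi> where "- (pi / 2) \<le> \<psi>" "\<psi> \<le> pi / 2" "s = S \<psi>"
proof -
  have "continuous_on B S" for B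
    by (auto intro!: continuous_at_imp_continuous_on DERIV_isCont[OF deriv_S])
  then show ?thesis using IVT'[of S "- (pi / 2)" s "pi / 2"] assms that by auto
qed

text \<open>Since \<open>L^2 - R^2\<close> has the sign of \<open>E\<close>, the condition
  \<open>R < L\<close> reads \<open>|\<sigma>| < a\<close> in the Morse coordinate, and monotonicity
  of \<open>m\<close> and of the sine turns this into an interval of \<open>s\<close>.\<close>

lemma admissible_eq: "admissible (Suc (Suc p)) h C = {S (- (pi / 2))<..<S (pi / 2)}"
proof (intro set_eqI)
  fix s
  have "R_fun (Suc (Suc p)) s C h < L_fun (Suc (Suc p)) s \<longleftrightarrow> S (- (pi / 2)) < s \<and> s < S (pi / 2)"
    if s: "0 < s" "s < pi / 2"
  proof -
    have sin: "0 < sin s" and cos: "0 < cos s" using s by (auto intro: sin_gt_zero cos_gt_zero_pi)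
    have \<mu>: "0 < sin s / c" using sin c_pos by simp
    have "R_fun (Suc (Suc p)) s C h < L_fun (Suc (Suc p)) s \<longleftrightarrow> sin s ^ p * (sin s * V s) < sin s ^ p * cos s"
      unfolding R_fun_eq[OF sin] L_fun_eq by (simp add: mult.commute)
    also have "\<dots> \<longleftrightarrow> sin s * V s < cos s" using sin by simp
    also have "\<dots> \<longleftrightarrow> (sin s * V s)\<^sup>2 < (cos s)\<^sup>2"
    proof -
      have sq: "y < z \<longleftrightarrow> y\<^sup>2 < z\<^sup>2" if "0 \<le> y" "0 \<le> z" for y z :: real
        using that abs_le_square_iff[of z y] by linarith
      show ?thesis by (rule sq) (use sin cos V_pos[OF sin] in auto)
    qed
    also have "\<dots> \<longleftrightarrow> 0 < E s"
      by (auto simp: E_def cos_squared_eq power_mult_distrib distrib_left)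
    also have "\<dots> \<longleftrightarrow> (\<sigma> (sin s / c))\<^sup>2 < a\<^sup>2"
      using c_pos by (simp add: E_eq[OF sin] zero_less_mult_iff)
    also have "\<dots> \<longleftrightarrow> - a < \<sigma> (sin s / c) \<and> \<sigma> (sin s / c) < a"
      using a_pos abs_le_square_iff[of a "\<sigma> (sin s / c)"] by linarith
    also have "\<dots> \<longleftrightarrow> m (- a) < sin s / c \<and> sin s / c < m a"
      using m_less_iff[of "- a" "\<sigma> (sin s / c)"] m_less_iff[of "\<sigma> (sin s / c)" a] m_\<sigma>[OF \<mu>] by simp
    also have "\<dots> \<longleftrightarrow> sin (S (- (pi / 2))) < sin s \<and> sin s < sin (S (pi / 2))"
      unfolding sin_S using c_pos by (simp add: x_def field_simps)
    also have "\<dots> \<longleftrightarrow> S (- (pi / 2)) < s \<and> s < S (pi / 2)"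
      using s S_pos[of "pi / 2"] S_less[of "pi / 2"] S_pos[of "- (pi / 2)"] S_less[of "- (pi / 2)"]
      by (simp add: sin_mono_less_eq)
    finally show ?thesis .
  qed
  then show "s \<in> admissible (Suc (Suc p)) h C \<longleftrightarrow> s \<in> {S (- (pi / 2))<..<S (pi / 2)}"
    using S_pos[of "- (pi / 2)"] S_less[of "pi / 2"] by (auto simp: admissible_def)
qed

lemma z_L_eq: "z_L (Suc (Suc p)) h C = S (- (pi / 2))" and z_R_eq: "z_R (Suc (Suc p)) h C = S (pi / 2)"
  using S_less_S[of "- (pi / 2)" "pi / 2"]
  by (simp_all add: z_L_def z_R_def admissible_eq)

text \<open>The integrand is singular at the turning points, so the fundamental theorem is used in
  the version that asks for continuity on the closed interval and a derivative inside. The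
  antiderivative \<open>F\<close> is \<open>S1\<close> after the explicit inverse of
  \<open>S\<close>, obtained by solving \<open>sin s = c m(a sin \<phi>)\<close> for
  \<open>\<phi>\<close>.\<close>

lemma s_one_S:
  assumes \<phi>: "- (pi / 2) \<le> \<phi>" "\<phi> \<le> pi / 2"
  shows "s_one (Suc (Suc p)) h C (S \<phi>) = S1 \<phi>"
proof -
  define F where "F s = S1 (arcsin (\<sigma> (sin s / c) / a))" for s
  have \<sigma>S: "\<sigma> (sin (S \<psi>) / c) / a = sin \<psi>" for \<psi>
    using c_pos a_pos by (simp add: sin_S x_def m)
  have FS: "F (S \<psi>) = S1 \<psi>" if "- (pi / 2) \<le> \<psi>" "\<psi> \<le> pi / 2" for \<psi>
    using that by (simp add: F_def \<sigma>S arcsin_sin)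
  have le: "S (- (pi / 2)) \<le> S \<phi>" "S \<phi> \<le> S (pi / 2)"
    using \<phi> by (auto intro!: S_le_S)
  have "continuous_on {S (- (pi / 2))..S \<phi>} F"
  proof -
    have rng: "0 < sin s / c \<and> \<sigma> (sin s / c) / a \<in> {-1..1}" if s: "s \<in> {S (- (pi / 2))..S \<phi>}" for s
    proof -
      obtain \<psi> where "s = S \<psi>" using s le by (auto intro: S_image[of s])
      then show ?thesis using \<sigma>S[of \<psi>] sin_S_pos[of \<psi>] c_pos by simp
    qed
    then have "continuous_on {S (- (pi / 2))..S \<phi>} (\<lambda>s. \<sigma> (sin s / c))"
      by (intro continuous_on_compose2[OF continuous_\<sigma>, of _ "\<lambda>s. sin s / c"] continuous_intros)
        (use c_pos in auto)
    then have "continuous_on {S (- (pi / 2))..S \<phi>} (\<lambda>s. arcsin (\<sigma> (sin s / c) / a))"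
      using rng a_pos by (intro continuous_on_arcsin continuous_on_divide continuous_on_const) auto
    moreover have "continuous_on UNIV S1"
      by (auto intro!: continuous_at_imp_continuous_on DERIV_isCont[OF deriv_S1])
    ultimately show ?thesis
      unfolding F_def using continuous_on_compose2[of UNIV S1 _ "\<lambda>s. arcsin (\<sigma> (sin s / c) / a)"] by blast
  qed
  moreover have "(F has_vector_derivative
      R_fun (Suc (Suc p)) s C h / (cos s * sqrt ((L_fun (Suc (Suc p)) s)\<^sup>2 - (R_fun (Suc (Suc p)) s C h)\<^sup>2))) (at s)"
    if s: "s \<in> {S (- (pi / 2))<..<S \<phi>}" for s
  proof -
    obtain \<psi> where \<psi>: "- (pi / 2) \<le> \<psi>" "\<psi> \<le> pi / 2" "s = S \<psi>"
      using s le by (auto intro: S_image[of s])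
    have "S \<psi> \<noteq> S (- (pi / 2))" "S \<psi> \<noteq> S (pi / 2)" using s le \<psi>(3) by auto
    then have "\<psi> \<noteq> - (pi / 2)" "\<psi> \<noteq> pi / 2" by metis+
    then have \<psi>': "- (pi / 2) < \<psi>" "\<psi> < pi / 2" using \<psi> by auto
    have cos: "0 < cos \<psi>" using \<psi>' by (intro cos_gt_zero_pi) auto
    have sin1: "-1 < sin \<psi>" "sin \<psi> < 1"
      using sin_monotone_2pi[of "- (pi / 2)" \<psi>] sin_monotone_2pi[of \<psi> "pi / 2"] \<psi>' by auto
    define \<mu> where "\<mu> = m (a * sin \<psi>)"
    have \<mu>: "0 < \<mu>" "0 < K \<mu>" "0 < v \<mu>" by (simp_all add: \<mu>_def m K_pos v_pos)
    have X: "sin s / c = \<mu>" using c_pos by (simp add: \<psi>(3) sin_S x_def \<mu>_def)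
    have sn: "0 < sin s" "0 < cos s" using sin_S_pos cos_S by (simp_all add: \<psi>(3))
    have "((\<lambda>s. sin s / c) has_real_derivative cos s / c) (at s)"
      using c_pos by (auto intro!: derivative_eq_intros)
    from DERIV_cdivide[OF DERIV_chain2[OF _ this, of \<sigma> "inverse (K \<mu>)"], of a]
    have "((\<lambda>s. \<sigma> (sin s / c) / a) has_real_derivative inverse (K \<mu>) * (cos s / c) / a) (at s)"
      using deriv_\<sigma>[OF \<mu>(1)] by (simp add: X)
    then have d: "((\<lambda>s. arcsin (\<sigma> (sin s / c) / a)) has_real_derivative
        inverse (sqrt (1 - (sin \<psi>)\<^sup>2)) * (inverse (K \<mu>) * (cos s / c) / a)) (at s)"
      using sin1 by (intro DERIV_chain2[of arcsin]) (simp_all add: \<psi>(3) \<sigma>S DERIV_arcsin)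
    have arc: "arcsin (\<sigma> (sin s / c) / a) = \<psi>" using \<psi> by (simp only: \<sigma>S arcsin_sin)
    have "(F has_real_derivative I \<psi> * (inverse (sqrt (1 - (sin \<psi>)\<^sup>2)) * (inverse (K \<mu>) * (cos s / c) / a))) (at s)"
      using deriv_S1_comp[OF d] unfolding arc F_def[abs_def] .
    moreover have "sqrt (1 - (sin \<psi>)\<^sup>2) = cos \<psi>"
      using cos by (intro real_sqrt_unique) (simp_all add: cos_squared_eq)
    moreover have "I \<psi> * (inverse (cos \<psi>) * (inverse (K \<mu>) * (cos s / c) / a))
        = sin s * V s / (cos s * (c * a * cos \<psi>))"
    proof -
      have "I \<psi> = K \<mu> * sin s * V s / (cos s)\<^sup>2"
        by (simp add: I_def \<mu>_def \<psi>(3) sin_S V_S cos_S(2))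
      then show ?thesis using \<mu> sn cos a_pos c_pos by (simp add: field_simps power2_eq_square)
    qed
    moreover have "R_fun (Suc (Suc p)) s C h / (cos s * sqrt ((L_fun (Suc (Suc p)) s)\<^sup>2 - (R_fun (Suc (Suc p)) s C h)\<^sup>2))
        = sin s * V s / (cos s * (c * a * cos \<psi>))"
    proof -
      have "(L_fun (Suc (Suc p)) s)\<^sup>2 - (R_fun (Suc (Suc p)) s C h)\<^sup>2 = (sin s ^ p)\<^sup>2 * E s"
        unfolding R_fun_eq[OF sn(1)] L_fun_eq E_def power_mult_distrib cos_squared_eq
        by (simp add: algebra_simps)
      also have "\<dots> = (sin s ^ p * (c * a * cos \<psi>))\<^sup>2"
        unfolding \<psi>(3) E_S by (simp only: power_mult_distrib)
      finally have "sqrt ((L_fun (Suc (Suc p)) s)\<^sup>2 - (R_fun (Suc (Suc p)) s C h)\<^sup>2) = sin s ^ p * (c * a * cos \<psi>)"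
        using sn cos a_pos c_pos by simp
      then show ?thesis unfolding R_fun_eq[OF sn(1)] using sn by simp
    qed
    ultimately show ?thesis
      by (simp add: has_real_derivative_iff_has_vector_derivative[symmetric])
  qed
  ultimately have "((\<lambda>s. R_fun (Suc (Suc p)) s C h / (cos s * sqrt ((L_fun (Suc (Suc p)) s)\<^sup>2 - (R_fun (Suc (Suc p)) s C h)\<^sup>2)))
      has_integral (F (S \<phi>) - F (S (- (pi / 2))))) {S (- (pi / 2))..S \<phi>}"
    using le by (intro fundamental_theorem_of_calculus_interior) auto
  then show ?thesis
    using \<phi> by (simp add: s_one_def z_L_eq integral_unique FS S1_start)
qed

lemma half_period_eq: "half_period (Suc (Suc p)) h C = pi / 2"
  by (simp add: half_period_def z_R_eq s_one_S S1_end)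

text \<open>Reducing \<open>t\<close> by a multiple of the period \<open>pi\<close> and taking the
  absolute value leaves the interval from 0 to \<open>pi / 2\<close>; there
  \<open>S \<circ> \<Phi>\<close> inverts \<open>s_one\<close>, and periodicity and evenness of
  \<open>\<rho>\<close> carry the equality back to \<open>t\<close>.\<close>

lemma profile_eq: "profile (Suc (Suc p)) h C t = \<rho> t"
proof -
  define \<tau> where "\<tau> = t - pi * of_int (round (t / pi))"
  have "\<bar>t / pi - of_int (round (t / pi))\<bar> \<le> 1 / 2"
    using of_int_round_abs_le[of "t / pi"] by (simp add: abs_minus_commute)
  then have "pi * \<bar>t / pi - of_int (round (t / pi))\<bar> \<le> pi * (1 / 2)" by (intro mult_left_mono) auto
  moreover have "pi * \<bar>t / pi - of_int (round (t / pi))\<bar> = \<bar>\<tau>\<bar>"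
    by (simp add: \<tau>_def abs_mult_pos' right_diff_distrib)
  ultimately have \<tau>: "\<bar>\<tau>\<bar> \<le> pi / 2" by simp
  have "\<rho> t = \<rho> (\<tau> + pi * of_int (round (t / pi)))" by (simp add: \<tau>_def)
  also have "\<dots> = \<rho> \<tau>" by (rule periodic_int) (rule \<rho>_shift)
  also have "\<dots> = \<rho> \<bar>\<tau>\<bar>" by (cases "0 \<le> \<tau>") (simp_all add: \<rho>_minus)
  finally have \<rho>: "\<rho> t = S (\<Phi> \<bar>\<tau>\<bar>)" by (simp add: \<rho>_def)
  define \<phi> where "\<phi> = \<Phi> \<bar>\<tau>\<bar>"
  have "S1 (- (pi / 2)) \<le> S1 \<phi>" "S1 \<phi> \<le> S1 (pi / 2)"
    using \<tau> by (simp_all add: \<phi>_def S1_\<Phi> S1_start S1_end)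
  then have \<phi>: "- (pi / 2) \<le> \<phi>" "\<phi> \<le> pi / 2" unfolding S1_le_iff .
  have "inv_into {S (- (pi / 2))..S (pi / 2)} (s_one (Suc (Suc p)) h C) \<bar>\<tau>\<bar> = S \<phi>"
  proof (rule inv_into_f_eq)
    show "inj_on (s_one (Suc (Suc p)) h C) {S (- (pi / 2))..S (pi / 2)}"
    proof (rule inj_onI)
      fix s s' assume s: "s \<in> {S (- (pi / 2))..S (pi / 2)}" "s' \<in> {S (- (pi / 2))..S (pi / 2)}"
        and eq: "s_one (Suc (Suc p)) h C s = s_one (Suc (Suc p)) h C s'"
      obtain \<psi> where \<psi>: "- (pi / 2) \<le> \<psi>" "\<psi> \<le> pi / 2" "s = S \<psi>" using s(1) by (auto intro: S_image[of s])
      obtain \<psi>' where \<psi>': "- (pi / 2) \<le> \<psi>'" "\<psi>' \<le> pi / 2" "s' = S \<psi>'" using s(2) by (auto intro: S_image[of s'])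
      have "S1 \<psi> = S1 \<psi>'" using eq \<psi> \<psi>' by (simp add: s_one_S)
      then have "\<Phi> (S1 \<psi>) = \<Phi> (S1 \<psi>')" by simp
      then show "s = s'" by (simp add: \<Phi>_S1 \<psi> \<psi>')
    qed
    show "S \<phi> \<in> {S (- (pi / 2))..S (pi / 2)}"
      using \<phi> S_le_S[of "- (pi / 2)" \<phi>] S_le_S[of \<phi> "pi / 2"] by auto
    show "s_one (Suc (Suc p)) h C (S \<phi>) = \<bar>\<tau>\<bar>" using \<phi> by (simp add: s_one_S \<phi>_def S1_\<Phi>)
  qed
  then show ?thesis
    by (simp add: profile_def half_period_eq z_L_eq z_R_eq \<rho> \<phi>_def \<tau>_def)
qed

lemma unduloid_curve_eq: "unduloid_curve (Suc (Suc p)) h C = curve"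
  by (rule ext) (simp add: unduloid_curve_def profile_eq curve_def)

text \<open>The critical constant belongs to \<open>a = 0\<close>: it is \<open>c0 ^ Suc p\<close>
  with \<open>c0 = 1 / sqrt g0\<close>, because \<open>sin s_h = c0 x0\<close>. A positive amplitude
  makes \<open>c\<close> smaller than \<open>c0\<close>.\<close>

lemma C_less_C_crit: "C < C_crit (Suc (Suc p)) h"
proof -
  have crit: "- tan s + real p * cot s = h \<longleftrightarrow> s = arctan (1 / vs)" if s: "0 < s" "s < pi / 2" for s
  proof -
    have t: "0 < tan s" using s by (intro tan_gt_zero) auto
    \<comment> \<open>In terms of the cotangent the equation of \<open>s_h\<close> is the quadratic
      whose positive root is \<open>vs\<close>.\<close>
    define w where "w = cot s"
    have w: "0 < w" "tan s = 1 / w" using t by (simp_all add: w_def cot_altdef inverse_eq_divide)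
    have "- tan s + real p * cot s = h \<longleftrightarrow> 1 + h * w - real p * w\<^sup>2 = 0"
      unfolding w(2) w_def[symmetric] using w(1) by (auto simp: field_simps power2_eq_square)
    also have "\<dots> \<longleftrightarrow> w = vs"
    proof -
      have "0 < w + 1 / (p * vs)" using w vs_pos by (simp add: add_pos_nonneg)
      then show ?thesis unfolding quad_factor using p by auto
    qed
    also have "\<dots> \<longleftrightarrow> tan s = 1 / vs" unfolding w(2) using w(1) vs_pos by simp
    also have "\<dots> \<longleftrightarrow> s = arctan (1 / vs)"
    proof
      assume "tan s = 1 / vs"
      then show "s = arctan (1 / vs)" using s arctan_tan[of s] by simp
    qed (simp add: tan_arctan)
    finally show ?thesis .
  qed
  define s where "s = arctan (1 / vs)"
  have s: "0 < s" "s < pi / 2" using vs_pos arctan_ubound by (auto simp: s_def)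
  have "s_crit (Suc (Suc p)) h = s"
    unfolding s_crit_def using crit s by (intro the_equality) (auto simp: s_def)
  have sin: "0 < sin s" using s by (intro sin_gt_zero) auto
  have cos: "cos s = vs * sin s"
  proof -
    have "tan s = 1 / vs" by (simp add: s_def tan_arctan)
    then show ?thesis using vs_pos cos_gt_zero_pi[of s] s by (simp add: tan_def field_simps)
  qed
  have sin2: "(sin s)\<^sup>2 * (1 + vs\<^sup>2) = 1"
    using sin_cos_squared_add[of s] unfolding cos by (simp add: algebra_simps power_mult_distrib)
  have crit_eq: "C_crit (Suc (Suc p)) h = sin s ^ Suc p * (vs - k)"
    unfolding C_crit_def \<open>s_crit (Suc (Suc p)) h = s\<close> L_fun_eq cos
    by (simp add: k_def add.commute algebra_simps)
  have x0p: "x0 ^ Suc p * (vs - k) = 1"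
    using k_less_vs v_\<mu>_of[OF k_less_vs] x0_pos by (simp add: v_def field_simps)
  have "0 < c\<^sup>2 * a\<^sup>2" using a_pos c_pos by simp
  then have "c\<^sup>2 * g0 < 1" using c_sq unfolding distrib_left by linarith
  then have "(c * x0)\<^sup>2 * (1 + vs\<^sup>2) < (sin s)\<^sup>2 * (1 + vs\<^sup>2)"
    unfolding sin2 by (simp add: g_def v_\<mu>_of[OF k_less_vs] power_mult_distrib)
  then have "(c * x0)\<^sup>2 < (sin s)\<^sup>2" by (rule mult_right_less_imp_less) simp
  then have "c * x0 < sin s" by (rule power2_less_imp_less) (use sin in simp)
  then have "(c * x0) ^ Suc p < sin s ^ Suc p"
    using c_pos x0_pos by (intro power_strict_mono) auto
  then have "(c * x0) ^ Suc p * (vs - k) < sin s ^ Suc p * (vs - k)"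
    using k_less_vs by (intro mult_strict_right_mono) auto
  moreover have "(c * x0) ^ Suc p * (vs - k) = C"
    using x0p unfolding C_def power_mult_distrib mult.assoc by simp
  ultimately show ?thesis by (simp add: crit_eq)
qed

end

theorem theorem5p12:
  fixes n :: nat
  assumes "n \<ge> 3" and "CARD('m::finite) = n - 1"
  shows "uncountable {h::real. h > 0 \<and>
           (\<exists>C. 0 < C \<and> C < C_crit n h \<and>
             (\<exists>M :: (complex \<times> (real ^ 'm)) set.
                M = generated_hypersurface (unduloid_curve n h C) \<and>
                closed_embedded_hypersurface_in_sphere M \<and>
                has_constant_mean_curvature M h))}"
proof -
  define p where "p = n - 2"
  have n: "n = Suc (Suc p)" and p: "1 \<le> p" and card: "real CARD('m) = real p + 1"
    using assms by (auto simp: p_def)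
  have "{0<..<1} \<subseteq> {h::real. h > 0 \<and>
           (\<exists>C. 0 < C \<and> C < C_crit n h \<and>
             (\<exists>M :: (complex \<times> (real ^ 'm)) set.
                M = generated_hypersurface (unduloid_curve n h C) \<and>
                closed_embedded_hypersurface_in_sphere M \<and>
                has_constant_mean_curvature M h))}"
  proof
    fix h :: real assume h: "h \<in> {0<..<1}"
    interpret unduloid p h using p h by unfold_locales auto
    obtain a where a: "0 < a" "period a = pi / 2" using exists_period by blast
    interpret unduloid_period p h a using a by unfold_locales
    have "closed_embedded_hypersurface_in_sphere (M :: (complex \<times> (real ^ 'm)) set)"
      unfolding closed_embedded_hypersurface_in_sphere_def
      using M_nonempty M_subset_sphere compact_M embedded_submanifold_M by simp
    moreover have "has_constant_mean_curvature (M :: (complex \<times> (real ^ 'm)) set) h"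
      by (rule has_constant_mean_curvature_M) (simp only: card mean_curv_eq)
    ultimately show "h \<in> {h::real. h > 0 \<and>
           (\<exists>C. 0 < C \<and> C < C_crit n h \<and>
             (\<exists>M :: (complex \<times> (real ^ 'm)) set.
                M = generated_hypersurface (unduloid_curve n h C) \<and>
                closed_embedded_hypersurface_in_sphere M \<and>
                has_constant_mean_curvature M h))}"
      using h C_pos C_less_C_crit unfolding n by (auto simp: unduloid_curve_eq M_def)
  qed
  then show ?thesis
    using uncountable_open_interval[of 0 1] countable_subset by auto
qed

end
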